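(* Let $p$ be a prime. Let $c$ and $d$ be odd positive integers such that $p \nmid cd$, $c$ is cube-free, $d$ is square-free and $\gcd(c,d) = 1$. Let $l = \gcd(cd,p-1)$, $m = \gcd(d,p-1)$ and $s = \gcd(cd,p+1)$. (i) Let $f_{\mathcal S}(p^2cd^2)$ denote the number of isomorphism classes of groups in $\mathcal S = \mathcal S_{(p,p),(cd,d)}$, the set of split extensions of $\mathbb Z_p \times \mathbb Z_p$ by $\mathbb Z_{cd}\times \mathbb Z_d$. Then $$f_{\mathcal S}(p^2cd^2) = \sum_{t \mid lm} N_{red}(H(t)) + \Omega(s,l),$$ where $$\Omega(s,l) = \begin{cases} 0 & \text{if } s = 1,\\ \tau(l)(\tau(s)-1) & \text{otherwise.}\end{cases}$$ (ii) Let $\alpha$ be a positive integer and let $f_{\mathcal S}(p^{\alpha}cd^2)$ denote the number of isomorphism classes of groups in $\mathcal S = \mathcal S_{p^{\alpha},(cd,d)}$, the set of split extensions of $\mathbb Z_{p^\alpha}$ by $\mathbb Z_{cd}\times\mathbb Z_d$. Then $$f_{\mathcal S}(p^{\alpha}cd^2) = \tau(l).$$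
   Context: An integer is cube-free (square-free) if it is not divisible by the cube (square) of any prime. $\tau(n)$ is the number of positive divisors of $n$. A split extension of $P$ by $Q$ is a semidirect product $P \rtimes_\theta Q$ with normal subgroup $P$, for a homomorphism $\theta: Q \to \mathrm{Aut}(P)$, where $\theta_x(a) = xax^{-1}$ for $x\in Q$, $a\in P$. For finite abelian groups $P \cong \mathbb Z_{m_1}\times\cdots\times\mathbb Z_{m_k}$ and $Q\cong \mathbb Z_{n_1}\times\cdots\times\mathbb Z_{n_r}$ with $m_{i+1}\mid m_i$ and $n_{i+1}\mid n_i$ for all $i$, the set of split extensions of $P$ by $Q$ is denoted $\mathcal S_{(m_1,\ldots,m_k),(n_1,\ldots,n_r)}$. Any two subgroups of $\mathbb Z_{cd}\times\mathbb Z_d$ (with $c$ cube-free, $d$ square-free, $\gcd(c,d)=1$) of the same order are isomorphic. A $p'$-subgroup is a subgroup of order not divisible by $p$; a subgroup of $\mathrm{GL}(2,p)$ is reducible if it stabilises some one-dimensional subspace of $\mathbb F_p^2$. For $t \mid lm$, $H(t)$ denotes the group, unique up to isomorphism, which is isomorphic to the subgroups of $\mathbb Z_{cd}\times\mathbb Z_d$ of order $t$ (it is isomorphic to a reducible $p'$-subgroup of $\mathrm{GL}(2,p)$ of order $t$), and $N_{red}(H(t))$ denotes the number of $\mathrm{GL}(2,p)$-conjugacy classes of reducible subgroups of $\mathrm{GL}(2,p)$ isomorphic to $H(t)$. *)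

theory Defs
  imports
    "HOL-Analysis.Determinants"
    "HOL-Algebra.Bij"
    "HOL-Algebra.Coset"
    "HOL-Algebra.Elementary_Groups"
    "HOL-Computational_Algebra.Squarefree"
begin

subsection \<open>Arithmetic\<close>

definition cubefree :: "nat \<Rightarrow> bool" where
  "cubefree n \<longleftrightarrow> (\<forall>q. prime q \<longrightarrow> \<not> q ^ 3 dvd n)"

definition tau :: "nat \<Rightarrow> nat" where
  "tau n = card {k. k dvd n}"

definition Omega :: "nat \<Rightarrow> nat \<Rightarrow> nat" where
  "Omega s l = (if s = 1 then 0 else tau l * (tau s - 1))"

subsection \<open>Split extensions and isomorphism classes\<close>

text \<open>In the semidirect product the pair \<open>(a, x)\<close> stands for the product \<open>ax\<close>, so that
  \<open>(ax)(by) = a(xbx\<^sup>-\<^sup>1)xy\<close> with \<open>xbx\<^sup>-\<^sup>1 = \<theta> x b\<close>.\<close>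

definition semidirect ::
  "('a, 'm) monoid_scheme \<Rightarrow> ('b, 'n) monoid_scheme \<Rightarrow> ('b \<Rightarrow> 'a \<Rightarrow> 'a) \<Rightarrow> ('a \<times> 'b) monoid" where
  "semidirect P Q \<theta> =
     \<lparr>carrier = carrier P \<times> carrier Q,
      mult = (\<lambda>(a, x) (b, y). (a \<otimes>\<^bsub>P\<^esub> \<theta> x b, x \<otimes>\<^bsub>Q\<^esub> y)),
      one = (\<one>\<^bsub>P\<^esub>, \<one>\<^bsub>Q\<^esub>)\<rparr>"

definition split_extensions ::
  "('a, 'm) monoid_scheme \<Rightarrow> ('b, 'n) monoid_scheme \<Rightarrow> ('a \<times> 'b) monoid set" where
  "split_extensions P Q = {semidirect P Q \<theta> | \<theta>. \<theta> \<in> hom Q (AutoGroup P)}"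

text \<open>Elements of \<open>hom\<close> are unconstrained outside the carrier, so a semidirect product can occur
  here as several records that agree on the carrier; these are isomorphic and are counted once.\<close>

definition num_iso_classes :: "'a monoid set \<Rightarrow> nat" where
  "num_iso_classes \<S> = card (\<S> // {(G, H). G \<in> \<S> \<and> H \<in> \<S> \<and> G \<cong> H})"

subsection \<open>The group \<open>GL(2,p)\<close>\<close>

text \<open>The field \<open>F\<^sub>p\<close> is represented by the residues \<open>{0..<p}\<close>; vectors and matrices over it are
  integral ones with all entries in this range, and results are reduced entrywise.\<close>

definition vec_red :: "nat \<Rightarrow> int ^ 2 \<Rightarrow> int ^ 2" where
  "vec_red p v = (\<chi> i. v $ i mod int p)"

definition mat_red :: "nat \<Rightarrow> int ^ 2 ^ 2 \<Rightarrow> int ^ 2 ^ 2" where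
  "mat_red p A = (\<chi> i j. A $ i $ j mod int p)"

definition vecs :: "nat \<Rightarrow> (int ^ 2) set" where
  "vecs p = {v. \<forall>i. v $ i \<in> {0..<int p}}"

definition mat2 :: "nat \<Rightarrow> (int ^ 2 ^ 2) monoid" where
  "mat2 p =
     \<lparr>carrier = {A. \<forall>i j. A $ i $ j \<in> {0..<int p}},
      mult = (\<lambda>A B. mat_red p (A ** B)),
      one = mat 1\<rparr>"

definition GL2 :: "nat \<Rightarrow> (int ^ 2 ^ 2) monoid" where
  "GL2 p = units_of (mat2 p)"

definition one_dim_subspace :: "nat \<Rightarrow> (int ^ 2) set \<Rightarrow> bool" where
  "one_dim_subspace p L \<longleftrightarrow>
     (\<exists>v \<in> vecs p. v \<noteq> 0 \<and> L = (\<lambda>k. vec_red p (k *s v)) ` {0..<int p})"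

definition reducible :: "nat \<Rightarrow> (int ^ 2 ^ 2) set \<Rightarrow> bool" where
  "reducible p K \<longleftrightarrow>
     (\<exists>L. one_dim_subspace p L \<and> (\<forall>A \<in> K. (\<lambda>v. vec_red p (A *v v)) ` L = L))"

definition conj_rel :: "('a, 'm) monoid_scheme \<Rightarrow> ('a set \<times> 'a set) set" where
  "conj_rel G =
     {(K, K'). subgroup K G \<and> (\<exists>g \<in> carrier G. K' = (g <#\<^bsub>G\<^esub> K) #>\<^bsub>G\<^esub> (inv\<^bsub>G\<^esub> g))}"

definition N_red :: "nat \<Rightarrow> ('a, 'm) monoid_scheme \<Rightarrow> nat" where
  "N_red p H =
     card ({K. subgroup K (GL2 p) \<and> reducible p K \<and> (GL2 p)\<lparr>carrier := K\<rparr> \<cong> H} // conj_rel (GL2 p))"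

subsection \<open>The groups \<open>Z\<^bsub>cd\<^esub> \<times> Z\<^sub>d\<close> and \<open>H(t)\<close>\<close>

definition Qgrp :: "nat \<Rightarrow> nat \<Rightarrow> (int \<times> int) monoid" where
  "Qgrp c d = integer_mod_group (c * d) \<times>\<times> integer_mod_group d"

text \<open>A subgroup of order \<open>t\<close> exists whenever \<open>t\<close> divides \<open>cd\<^sup>2\<close>, and for cube-free \<open>c\<close>
  coprime to the square-free \<open>d\<close> all subgroups of order \<open>t\<close> are isomorphic, so the choice
  below only fixes a representative of the isomorphism class.\<close>

definition Hgrp :: "nat \<Rightarrow> nat \<Rightarrow> nat \<Rightarrow> (int \<times> int) monoid" where
  "Hgrp c d t = (Qgrp c d)\<lparr>carrier := (SOME K. subgroup K (Qgrp c d) \<and> card K = t)\<rparr>"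

end

theory Submission
  imports
    Defs
    "HOL-Number_Theory.Number_Theory"
    "HOL-Algebra.Multiplicative_Group"
begin

text \<open>
  Write \<open>Q = Z\<^bsub>cd\<^esub> \<times> Z\<^sub>d\<close>. Its order is prime to \<open>p\<close>, so in a split extension of an abelian \<open>p\<close>-group
  \<open>P\<close> by \<open>Q\<close> the subgroup \<open>P\<close> is characteristic, and an isomorphism between two extensions induces an
  automorphism of \<open>P\<close> that conjugates the image of one action in \<open>Aut(P)\<close> to the image of the other.
  Conversely two actions with conjugate images give isomorphic extensions as soon as homomorphisms
  from \<open>Q\<close> with the same image differ by an automorphism of \<open>Q\<close>. For \<open>Q\<close> this follows from a
  Gaschuetz-style counting of lifts (\<open>self_lifting_imp_images_determine_homs\<close>, \<open>self_lifting_Qgrp\<close>).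
  Hence the isomorphism classes correspond to the conjugacy classes of homomorphic images of \<open>Q\<close> in
  \<open>Aut(P)\<close> (\<open>num_iso_classes_split_extensions\<close>), and these remain to be counted.

  If \<open>P\<close> is cyclic of order \<open>p\<^sup>\<alpha>\<close>, then \<open>Aut(P)\<close> is cyclic for odd \<open>p\<close> and an
  abelian \<open>2\<close>-group for \<open>p = 2\<close>, where \<open>l = 1\<close>. In a cyclic group of order \<open>N\<close> the images of \<open>Q\<close> are the subgroups whose order divides
  \<open>gcd(cd, N)\<close> (\<open>hom_images_cyclic\<close>), which gives \<open>\<tau>(l)\<close>.

  If \<open>P = Z\<^sub>p \<times> Z\<^sub>p\<close>, then \<open>Aut(P)\<close> is \<open>GL(2,p)\<close>. An image of \<open>Q\<close> is determined up to isomorphism by its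
  order, and so are the subgroups of \<open>Q\<close>; thus a subgroup of order \<open>t\<close> is an image if and only if
  it is isomorphic to \<open>H(t)\<close> (\<open>iso_Hgrp_iff\<close>). All elements of a reducible image satisfy
  \<open>x\<^bsup>p - 1\<^esup> = 1\<close>, because they are triangular of order prime to \<open>p\<close>, and therefore the order of the
  image divides \<open>lm\<close> (\<open>card_reducible_image_dvd\<close>). So the reducible images contribute the sum over
  \<open>t\<close>.

  An irreducible image contains a matrix \<open>A\<close> without eigenvectors and lies in the centraliser of \<open>A\<close>.
  The matrix \<open>A\<close> is conjugate to an element of one fixed quadratic extension field of \<open>F\<^sub>p\<close> inside
  the matrix ring, so every irreducible image is conjugate into the cyclic group \<open>E\<close> of order
  \<open>p\<^sup>2 - 1\<close> formed by the nonzero elements of this field (\<open>irreducible_conj_into_E\<close>). There it is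
  determined by its order \<open>r\<close>, which divides \<open>gcd(cd, p\<^sup>2 - 1) = ls\<close>, and it is irreducible if and
  only if \<open>r\<close> does not divide \<open>p - 1\<close>. As \<open>l\<close> and \<open>s\<close> are coprime, this leaves
  \<open>\<tau>(l)\<tau>(s) - \<tau>(l) = \<Omega>(s,l)\<close> classes (\<open>card_irreducible_classes\<close>, \<open>card_divisors_not_dvd\<close>).
\<close>

section \<open>Counting classes\<close>

lemma card_image_cong_classes:
  assumes "\<And>x y. x \<in> T \<Longrightarrow> y \<in> T \<Longrightarrow> g x = g y \<longleftrightarrow> h x = h y"
  shows "card (g ` T) = card (h ` T)"
proof -
  define f where "f u = h (SOME x. x \<in> T \<and> g x = u)" for u
  have f: "f (g x) = h x" if "x \<in> T" for x
  proof -
    have "\<exists>y. y \<in> T \<and> g y = g x" using that by blast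
    then have "(SOME y. y \<in> T \<and> g y = g x) \<in> T \<and> g (SOME y. y \<in> T \<and> g y = g x) = g x"
      by (rule someI_ex)
    then show ?thesis unfolding f_def using assms that by blast
  qed
  have "bij_betw f (g ` T) (h ` T)"
    unfolding bij_betw_def inj_on_def
  proof (intro conjI ballI impI)
    show "f ` g ` T = h ` T" using f by (simp add: image_image)
  next
    fix u v assume "u \<in> g ` T" "v \<in> g ` T" "f u = f v"
    then show "u = v" using f assms by auto
  qed
  then show ?thesis by (rule bij_betw_same_card)
qed

abbreviation conjugation :: "('a, 'm) monoid_scheme \<Rightarrow> 'a \<Rightarrow> 'a \<Rightarrow> 'a" where
  "conjugation G g x \<equiv> g \<otimes>\<^bsub>G\<^esub> x \<otimes>\<^bsub>G\<^esub> inv\<^bsub>G\<^esub> g"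

lemma (in group) conj_rel_iff:
  assumes "subgroup K G"
  shows "(K, K') \<in> conj_rel G \<longleftrightarrow> (\<exists>g\<in>carrier G. K' = conjugation G g ` K)"
  using assms by (auto simp: conj_rel_def l_coset_def r_coset_def)

lemma (in group) conj_conj:
  assumes "K \<subseteq> carrier G" "g \<in> carrier G" "h \<in> carrier G"
  shows "conjugation G h ` conjugation G g ` K
       = (\<lambda>k. (h \<otimes> g) \<otimes> k \<otimes> inv (h \<otimes> g)) ` K"
  unfolding image_image
  by (rule image_cong) (use assms in \<open>auto simp: inv_mult_group m_assoc subset_iff\<close>)

lemma (in group) subgroup_conj:
  assumes "subgroup K G" "g \<in> carrier G"
  shows "subgroup (conjugation G g ` K) G"
proof -
  have "(conjugation G g) \<in> hom G G"
    using assms by (auto simp: hom_def m_assoc inv_solve_left)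
  then interpret group_hom G G "\<lambda>k. g \<otimes> k \<otimes> inv g" by unfold_locales
  show ?thesis using subgroup_img_is_subgroup[OF assms(1)] .
qed

lemma (in group) equiv_conj_rel: "equiv {K. subgroup K G} (conj_rel G)"
proof (rule equivI)
  show "conj_rel G \<subseteq> {K. subgroup K G} \<times> {K. subgroup K G}"
  proof (rule subrelI)
    fix K K' assume *: "(K, K') \<in> conj_rel G"
    then have K: "subgroup K G" by (simp add: conj_rel_def)
    with * obtain g where "g \<in> carrier G" "K' = conjugation G g ` K"
      using conj_rel_iff by blast
    then show "(K, K') \<in> {K. subgroup K G} \<times> {K. subgroup K G}"
      using K subgroup_conj by simp
  qed
  show "refl_on {K. subgroup K G} (conj_rel G)"
  proof (rule refl_onI)
    fix K assume K: "K \<in> {K. subgroup K G}"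
    then have "conjugation G \<one> ` K = id ` K"
      by (intro image_cong) (auto dest: subgroup.mem_carrier)
    then have "K = conjugation G \<one> ` K" by simp
    then show "(K, K) \<in> conj_rel G" using conj_rel_iff K one_closed by blast
  qed
  show "sym (conj_rel G)"
  proof (rule symI)
    fix K K' assume *: "(K, K') \<in> conj_rel G"
    then have K: "subgroup K G" by (simp add: conj_rel_def)
    from * obtain g where g: "g \<in> carrier G" "K' = conjugation G g ` K"
      using conj_rel_iff K by blast
    have "(\<lambda>k. inv g \<otimes> k \<otimes> inv (inv g)) ` K' = conjugation G \<one> ` K"
      unfolding g(2) using conj_conj[OF subgroup.subset[OF K], of g "inv g"] g(1) by simp
    also have "\<dots> = id ` K" by (intro image_cong) (use K in \<open>auto dest: subgroup.mem_carrier\<close>)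
    finally have "K = (\<lambda>k. inv g \<otimes> k \<otimes> inv (inv g)) ` K'" by simp
    moreover have "subgroup K' G" using subgroup_conj[OF K] g by simp
    ultimately show "(K', K) \<in> conj_rel G"
      using conj_rel_iff g inv_closed by blast
  qed
  show "trans (conj_rel G)"
  proof (rule transI)
    fix K K' K'' assume 1: "(K, K') \<in> conj_rel G" and 2: "(K', K'') \<in> conj_rel G"
    then have K: "subgroup K G" "subgroup K' G" by (auto simp: conj_rel_def)
    from 1 2 obtain g h where g: "g \<in> carrier G" "K' = conjugation G g ` K"
      and h: "h \<in> carrier G" "K'' = conjugation G h ` K'"
      using conj_rel_iff K by meson
    then show "(K, K'') \<in> conj_rel G"
      using conj_rel_iff[OF K(1)] conj_conj[OF subgroup.subset[OF K(1)], of g h] m_closed[of h g]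
      by blast
  qed
qed

lemma (in group) conj_class_eq_iff:
  assumes "subgroup K G" "subgroup K' G"
  shows "conj_rel G `` {K} = conj_rel G `` {K'} \<longleftrightarrow> (K, K') \<in> conj_rel G"
  using eq_equiv_class_iff[OF equiv_conj_rel] assms by simp

lemma (in group) card_conj_rel:
  assumes "(K, K') \<in> conj_rel G"
  shows "card K' = card K"
proof -
  have K: "subgroup K G" using assms by (simp add: conj_rel_def)
  then obtain g where g: "g \<in> carrier G" "K' = conjugation G g ` K"
    using assms conj_rel_iff by blast
  have "inj_on (conjugation G g) K"
    using subgroup.subset[OF K] g(1) by (auto simp: inj_on_def subset_iff)
  then show ?thesis using g(2) card_image by blast
qed

section \<open>Isomorphism of split extensions\<close>

definition hom_images :: "('b, 'n) monoid_scheme \<Rightarrow> ('a, 'm) monoid_scheme \<Rightarrow> 'a set set" where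
  "hom_images Q G = {h ` carrier Q | h. h \<in> hom Q G}"

definition images_determine_homs :: "('b, 'n) monoid_scheme \<Rightarrow> ('a, 'm) monoid_scheme \<Rightarrow> bool" where
  "images_determine_homs Q G \<longleftrightarrow>
     (\<forall>h\<in>hom Q G. \<forall>h'\<in>hom Q G. h ` carrier Q = h' ` carrier Q \<longrightarrow>
        (\<exists>\<beta>\<in>iso Q Q. \<forall>x\<in>carrier Q. h x = h' (\<beta> x)))"

lemma hom_images_subgroup:
  assumes "group Q" "group G" "K \<in> hom_images Q G"
  shows "subgroup K G"
  using assms group_hom.img_is_subgroup by (auto simp: hom_images_def group_hom_def group_hom_axioms_def)

lemma semidirect_simps [simp]:
  "carrier (semidirect P Q \<theta>) = carrier P \<times> carrier Q"
  "(a, x) \<otimes>\<^bsub>semidirect P Q \<theta>\<^esub> (b, y) = (a \<otimes>\<^bsub>P\<^esub> \<theta> x b, x \<otimes>\<^bsub>Q\<^esub> y)"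
  "\<one>\<^bsub>semidirect P Q \<theta>\<^esub> = (\<one>\<^bsub>P\<^esub>, \<one>\<^bsub>Q\<^esub>)"
  by (simp_all add: semidirect_def)

locale action = P: comm_group P + Q: comm_group Q
  for P (structure) and Q (structure) +
  fixes \<theta>
  assumes \<theta>: "\<theta> \<in> hom Q (AutoGroup P)"
begin

lemma \<theta>_auto: "x \<in> carrier Q \<Longrightarrow> \<theta> x \<in> auto P"
  using \<theta> by (auto simp: hom_def AutoGroup_def)

lemma \<theta>_hom: "x \<in> carrier Q \<Longrightarrow> \<theta> x \<in> hom P P"
  using \<theta>_auto by (auto simp: auto_def)

lemma \<theta>_closed [simp]: "x \<in> carrier Q \<Longrightarrow> a \<in> carrier P \<Longrightarrow> \<theta> x a \<in> carrier P"
  using \<theta>_hom by (auto simp: hom_def)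

lemma \<theta>_mult: "x \<in> carrier Q \<Longrightarrow> a \<in> carrier P \<Longrightarrow> b \<in> carrier P \<Longrightarrow>
  \<theta> x (a \<otimes>\<^bsub>P\<^esub> b) = \<theta> x a \<otimes>\<^bsub>P\<^esub> \<theta> x b"
  using \<theta>_hom by (auto simp: hom_def)

lemma \<theta>_one_P [simp]: "x \<in> carrier Q \<Longrightarrow> \<theta> x \<one>\<^bsub>P\<^esub> = \<one>\<^bsub>P\<^esub>"
  using hom_one[OF \<theta>_hom] P.is_group by blast

lemma \<theta>_comp: "x \<in> carrier Q \<Longrightarrow> y \<in> carrier Q \<Longrightarrow> a \<in> carrier P \<Longrightarrow>
  \<theta> (x \<otimes>\<^bsub>Q\<^esub> y) a = \<theta> x (\<theta> y a)"
proof -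
  assume xy: "x \<in> carrier Q" "y \<in> carrier Q" and a: "a \<in> carrier P"
  have "\<theta> (x \<otimes>\<^bsub>Q\<^esub> y) = \<theta> x \<otimes>\<^bsub>AutoGroup P\<^esub> \<theta> y"
    using \<theta> xy by (auto simp: hom_def)
  also have "\<dots> = compose (carrier P) (\<theta> x) (\<theta> y)"
    using \<theta>_auto xy by (simp add: AutoGroup_def BijGroup_def auto_def)
  finally show ?thesis using a by (simp add: compose_def)
qed

lemma \<theta>_one [simp]: "a \<in> carrier P \<Longrightarrow> \<theta> \<one>\<^bsub>Q\<^esub> a = a"
proof -
  assume a: "a \<in> carrier P"
  have "\<theta> \<one>\<^bsub>Q\<^esub> = \<one>\<^bsub>AutoGroup P\<^esub>"
    using hom_one[OF \<theta>] P.AutoGroup Q.is_group by blast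
  then show ?thesis using a by (simp add: AutoGroup_def BijGroup_def)
qed

lemma group_semidirect: "group (semidirect P Q \<theta>)"
proof (rule groupI)
  fix u assume u: "u \<in> carrier (semidirect P Q \<theta>)"
  then obtain a x where ax: "u = (a, x)" "a \<in> carrier P" "x \<in> carrier Q" by auto
  have "(\<theta> (inv\<^bsub>Q\<^esub> x) (inv\<^bsub>P\<^esub> a), inv\<^bsub>Q\<^esub> x) \<otimes>\<^bsub>semidirect P Q \<theta>\<^esub> u = \<one>\<^bsub>semidirect P Q \<theta>\<^esub>"
  proof -
    have "\<theta> (inv\<^bsub>Q\<^esub> x) (inv\<^bsub>P\<^esub> a) \<otimes>\<^bsub>P\<^esub> \<theta> (inv\<^bsub>Q\<^esub> x) a = \<theta> (inv\<^bsub>Q\<^esub> x) (inv\<^bsub>P\<^esub> a \<otimes>\<^bsub>P\<^esub> a)"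
      using ax \<theta>_mult by (metis P.inv_closed Q.inv_closed)
    also have "\<dots> = \<one>\<^bsub>P\<^esub>" using ax by (simp only: P.l_inv \<theta>_one_P Q.inv_closed)
    finally show ?thesis using ax(3) unfolding ax(1) by (simp only: semidirect_simps Q.l_inv)
  qed
  then show "\<exists>v\<in>carrier (semidirect P Q \<theta>). v \<otimes>\<^bsub>semidirect P Q \<theta>\<^esub> u = \<one>\<^bsub>semidirect P Q \<theta>\<^esub>"
    by (rule bexI) (use ax in auto)
qed (auto simp: \<theta>_mult \<theta>_comp P.m_assoc Q.m_assoc)

lemma semidirect_pow_snd:
  "u \<in> carrier (semidirect P Q \<theta>) \<Longrightarrow>
     snd (u [^]\<^bsub>semidirect P Q \<theta>\<^esub> (n::nat)) = snd u [^]\<^bsub>Q\<^esub> n"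
proof (induction n)
  case (Suc n)
  interpret S: group "semidirect P Q \<theta>" by (rule group_semidirect)
  have "u [^]\<^bsub>semidirect P Q \<theta>\<^esub> n \<in> carrier (semidirect P Q \<theta>)"
    using Suc.prems by (rule S.nat_pow_closed)
  then show ?case using Suc by (auto simp: semidirect_def split: prod.splits)
qed simp

lemma semidirect_pow_fst:
  "a \<in> carrier P \<Longrightarrow> (a, \<one>\<^bsub>Q\<^esub>) [^]\<^bsub>semidirect P Q \<theta>\<^esub> (n::nat) = (a [^]\<^bsub>P\<^esub> n, \<one>\<^bsub>Q\<^esub>)"
  by (induction n) auto

end

lemma auto_compose_eq:
  assumes "\<alpha> \<in> auto P" "\<gamma> \<in> auto P"
  shows "\<alpha> \<otimes>\<^bsub>AutoGroup P\<^esub> \<gamma> = compose (carrier P) \<alpha> \<gamma>"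
  using assms by (simp add: AutoGroup_def BijGroup_def auto_def)

text \<open>Because the orders are coprime, \<open>P\<close> is exactly the set of elements of the semidirect product
  whose order divides \<open>\<bar>P\<bar>\<close>, so an isomorphism maps \<open>P\<close> to \<open>P\<close> and \<open>Q\<close> to \<open>Q\<close> modulo \<open>P\<close>; since
  \<open>P\<close> is abelian, the conjugation action only sees the classes modulo \<open>P\<close>.\<close>

lemma semidirect_iso_imp_conj:
  assumes "comm_group P" "comm_group Q" "finite (carrier P)" "finite (carrier Q)"
    and cop: "coprime (order P) (order Q)"
    and "\<theta> \<in> hom Q (AutoGroup P)" "\<theta>' \<in> hom Q (AutoGroup P)"
    and \<phi>: "\<phi> \<in> iso (semidirect P Q \<theta>) (semidirect P Q \<theta>')"
  shows "(\<theta> ` carrier Q, \<theta>' ` carrier Q) \<in> conj_rel (AutoGroup P)"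
proof -
  interpret S: action P Q \<theta> using assms by (simp add: action_def action_axioms_def)
  interpret S': action P Q \<theta>' using assms by (simp add: action_def action_axioms_def)
  interpret A: group "AutoGroup P" by (rule S.P.AutoGroup)
  let ?G = "semidirect P Q \<theta>" and ?G' = "semidirect P Q \<theta>'"
  interpret G: group ?G by (rule S.group_semidirect)
  interpret G': group ?G' by (rule S'.group_semidirect)
  have \<phi>h: "\<phi> \<in> hom ?G ?G'" and \<phi>b: "bij_betw \<phi> (carrier ?G) (carrier ?G')"
    using \<phi> by (auto simp: iso_def)
  interpret h: group_hom ?G ?G' \<phi> by unfold_locales (rule \<phi>h)
  have fst_closed: "fst (\<phi> (a, x)) \<in> carrier P" and snd_closed: "snd (\<phi> (a, x)) \<in> carrier Q"
    if "a \<in> carrier P" "x \<in> carrier Q" for a x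
    using h.hom_closed[of "(a, x)"] that by (auto simp: mem_Times_iff)
  have snd1: "snd (\<phi> (a, \<one>\<^bsub>Q\<^esub>)) = \<one>\<^bsub>Q\<^esub>" if a: "a \<in> carrier P" for a
  proof -
    let ?y = "snd (\<phi> (a, \<one>\<^bsub>Q\<^esub>))"
    have y: "?y \<in> carrier Q" using snd_closed a by simp
    have "\<phi> (a, \<one>\<^bsub>Q\<^esub>) [^]\<^bsub>?G'\<^esub> order P = \<phi> ((a, \<one>\<^bsub>Q\<^esub>) [^]\<^bsub>?G\<^esub> order P)"
      using h.hom_nat_pow[of "(a, \<one>\<^bsub>Q\<^esub>)"] a by simp
    also have "\<dots> = \<one>\<^bsub>?G'\<^esub>"
      using S.semidirect_pow_fst[OF a] S.P.pow_order_eq_1[OF a] h.hom_one by simp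
    finally have "?y [^]\<^bsub>Q\<^esub> order P = \<one>\<^bsub>Q\<^esub>"
      using S'.semidirect_pow_snd[of "\<phi> (a, \<one>\<^bsub>Q\<^esub>)" "order P"] h.hom_closed[of "(a, \<one>\<^bsub>Q\<^esub>)"] a by simp
    then have "S.Q.ord ?y dvd order P" using S.Q.pow_eq_id y by blast
    moreover have "S.Q.ord ?y dvd order Q" using S.Q.ord_dvd_group_order y by blast
    ultimately have "S.Q.ord ?y = 1" using cop by (metis coprime_common_divisor_nat)
    then show ?thesis using S.Q.ord_eq_1 y by blast
  qed
  define \<alpha> where "\<alpha> = (\<lambda>a\<in>carrier P. fst (\<phi> (a, \<one>\<^bsub>Q\<^esub>)))"
  define f where "f x = fst (\<phi> (\<one>\<^bsub>P\<^esub>, x))" for x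
  define g where "g x = snd (\<phi> (\<one>\<^bsub>P\<^esub>, x))" for x
  have \<phi>1: "\<phi> (a, \<one>\<^bsub>Q\<^esub>) = (\<alpha> a, \<one>\<^bsub>Q\<^esub>)" if "a \<in> carrier P" for a
    using snd1[OF that] that unfolding \<alpha>_def by (metis prod.collapse restrict_apply)
  have \<phi>2: "\<phi> (\<one>\<^bsub>P\<^esub>, x) = (f x, g x)" for x unfolding f_def g_def by simp
  have fc: "f x \<in> carrier P" and gc: "g x \<in> carrier Q" if "x \<in> carrier Q" for x
    unfolding f_def g_def using fst_closed snd_closed that by auto
  have \<alpha>c: "\<alpha> a \<in> carrier P" if "a \<in> carrier P" for a
    unfolding \<alpha>_def using fst_closed that by simp
  have \<phi>ax: "\<phi> (a, x) = (\<alpha> a \<otimes>\<^bsub>P\<^esub> f x, g x)" if "a \<in> carrier P" "x \<in> carrier Q" for a x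
  proof -
    have "\<phi> (a, x) = \<phi> ((a, \<one>\<^bsub>Q\<^esub>) \<otimes>\<^bsub>?G\<^esub> (\<one>\<^bsub>P\<^esub>, x))" using that by simp
    also have "\<dots> = \<phi> (a, \<one>\<^bsub>Q\<^esub>) \<otimes>\<^bsub>?G'\<^esub> \<phi> (\<one>\<^bsub>P\<^esub>, x)" using that by (intro h.hom_mult) auto
    finally show ?thesis using \<phi>1 \<phi>2 fc gc that by simp
  qed
  have \<alpha>hom: "\<alpha> \<in> hom P P"
  proof (rule homI)
    fix a b assume ab: "a \<in> carrier P" "b \<in> carrier P"
    have "\<phi> (a \<otimes>\<^bsub>P\<^esub> b, \<one>\<^bsub>Q\<^esub>) = \<phi> ((a, \<one>\<^bsub>Q\<^esub>) \<otimes>\<^bsub>?G\<^esub> (b, \<one>\<^bsub>Q\<^esub>))" using ab by simp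
    also have "\<dots> = \<phi> (a, \<one>\<^bsub>Q\<^esub>) \<otimes>\<^bsub>?G'\<^esub> \<phi> (b, \<one>\<^bsub>Q\<^esub>)" using ab by (intro h.hom_mult) auto
    finally show "\<alpha> (a \<otimes>\<^bsub>P\<^esub> b) = \<alpha> a \<otimes>\<^bsub>P\<^esub> \<alpha> b" using \<phi>1 ab \<alpha>c by simp
  qed (rule \<alpha>c)
  have \<alpha>inj: "inj_on \<alpha> (carrier P)"
  proof (rule inj_onI)
    fix a b assume ab: "a \<in> carrier P" "b \<in> carrier P" "\<alpha> a = \<alpha> b"
    then have "\<phi> (a, \<one>\<^bsub>Q\<^esub>) = \<phi> (b, \<one>\<^bsub>Q\<^esub>)" using \<phi>1 by simp
    then have "(a, \<one>\<^bsub>Q\<^esub>) = (b, \<one>\<^bsub>Q\<^esub>)"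
      by (rule inj_onD[OF bij_betw_imp_inj_on[OF \<phi>b]]) (use ab in auto)
    then show "a = b" by simp
  qed
  have \<alpha>img: "\<alpha> ` carrier P = carrier P"
    using endo_inj_surj[OF assms(3) _ \<alpha>inj] \<alpha>c by blast
  have \<alpha>: "\<alpha> \<in> auto P"
    unfolding auto_def Bij_def bij_betw_def using \<alpha>hom \<alpha>inj \<alpha>img by (auto simp: \<alpha>_def)
  have key: "\<alpha> (\<theta> x a) = \<theta>' (g x) (\<alpha> a)" if xa: "x \<in> carrier Q" "a \<in> carrier P" for x a
  proof -
    have "\<phi> (\<theta> x a, x) = \<phi> ((\<one>\<^bsub>P\<^esub>, x) \<otimes>\<^bsub>?G\<^esub> (a, \<one>\<^bsub>Q\<^esub>))" using xa by simp
    also have "\<dots> = \<phi> (\<one>\<^bsub>P\<^esub>, x) \<otimes>\<^bsub>?G'\<^esub> \<phi> (a, \<one>\<^bsub>Q\<^esub>)" using xa by (intro h.hom_mult) auto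
    finally have "\<alpha> (\<theta> x a) \<otimes>\<^bsub>P\<^esub> f x = f x \<otimes>\<^bsub>P\<^esub> \<theta>' (g x) (\<alpha> a)"
      using \<phi>1 \<phi>2 \<phi>ax xa by simp
    also have "\<dots> = \<theta>' (g x) (\<alpha> a) \<otimes>\<^bsub>P\<^esub> f x"
      by (intro S.P.m_comm fc S'.\<theta>_closed gc \<alpha>c xa)
    finally show ?thesis
      by (metis S.P.right_cancel S'.\<theta>_closed S.\<theta>_closed fc gc \<alpha>c xa)
  qed
  have gsurj: "g ` carrier Q = carrier Q"
  proof (intro equalityI subsetI)
    fix y assume y: "y \<in> carrier Q"
    then have "(\<one>\<^bsub>P\<^esub>, y) \<in> \<phi> ` carrier ?G" using \<phi>b by (simp add: bij_betw_def)
    then obtain a x where "a \<in> carrier P" "x \<in> carrier Q" "\<phi> (a, x) = (\<one>\<^bsub>P\<^esub>, y)" by auto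
    then show "y \<in> g ` carrier Q" using \<phi>ax by auto
  qed (use gc in auto)
  have conj: "\<alpha> \<otimes>\<^bsub>AutoGroup P\<^esub> \<theta> x \<otimes>\<^bsub>AutoGroup P\<^esub> inv\<^bsub>AutoGroup P\<^esub> \<alpha> = \<theta>' (g x)"
    if x: "x \<in> carrier Q" for x
  proof -
    have "\<alpha> \<otimes>\<^bsub>AutoGroup P\<^esub> \<theta> x = \<theta>' (g x) \<otimes>\<^bsub>AutoGroup P\<^esub> \<alpha>"
      using key x \<alpha> S.\<theta>_auto S'.\<theta>_auto gc
      by (auto simp: auto_compose_eq compose_def restrict_def)
    moreover have "\<alpha> \<in> carrier (AutoGroup P)" "\<theta> x \<in> carrier (AutoGroup P)"
      "\<theta>' (g x) \<in> carrier (AutoGroup P)"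
      using \<alpha> S.\<theta>_auto S'.\<theta>_auto gc x by (auto simp: AutoGroup_def)
    ultimately show ?thesis by (simp add: A.m_assoc)
  qed
  have "\<theta>' ` carrier Q = (\<lambda>x. \<theta>' (g x)) ` carrier Q"
    unfolding image_image[of \<theta>' g, symmetric] gsurj ..
  also have "\<dots> = conjugation (AutoGroup P) \<alpha> ` \<theta> ` carrier Q"
    using conj by (simp add: image_image)
  finally have "\<theta>' ` carrier Q
    = conjugation (AutoGroup P) \<alpha> ` \<theta> ` carrier Q" .
  moreover have "subgroup (\<theta> ` carrier Q) (AutoGroup P)"
    using hom_images_subgroup[OF S.Q.is_group S.P.AutoGroup] S.\<theta> by (auto simp: hom_images_def)
  moreover have "\<alpha> \<in> carrier (AutoGroup P)" using \<alpha> by (simp add: AutoGroup_def)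
  ultimately show ?thesis using A.conj_rel_iff by blast
qed

text \<open>After conjugation by \<open>\<alpha>\<close> both actions have the same image, so an automorphism \<open>\<beta>\<close> of \<open>Q\<close> turns
  one into the other, and \<open>\<alpha>\<close> and \<open>\<beta>\<close> together define the isomorphism.\<close>

lemma semidirect_conj_imp_iso:
  assumes "comm_group P" "comm_group Q"
    and det: "images_determine_homs Q (AutoGroup P)"
    and \<theta>: "\<theta> \<in> hom Q (AutoGroup P)" and \<theta>': "\<theta>' \<in> hom Q (AutoGroup P)"
    and conj: "(\<theta> ` carrier Q, \<theta>' ` carrier Q) \<in> conj_rel (AutoGroup P)"
  shows "semidirect P Q \<theta> \<cong> semidirect P Q \<theta>'"
proof -
  interpret S: action P Q \<theta> using assms by (simp add: action_def action_axioms_def)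
  interpret S': action P Q \<theta>' using assms by (simp add: action_def action_axioms_def)
  interpret A: group "AutoGroup P" by (rule S.P.AutoGroup)
  have sub: "subgroup (\<theta> ` carrier Q) (AutoGroup P)"
    using hom_images_subgroup[OF S.Q.is_group S.P.AutoGroup] S.\<theta> by (auto simp: hom_images_def)
  obtain \<alpha> where \<alpha>: "\<alpha> \<in> carrier (AutoGroup P)" and img:
    "\<theta>' ` carrier Q = conjugation (AutoGroup P) \<alpha> ` \<theta> ` carrier Q"
    using conj A.conj_rel_iff[OF sub] by blast
  have \<alpha>a: "\<alpha> \<in> auto P" using \<alpha> by (simp add: AutoGroup_def)
  define \<eta> where "\<eta> x = \<alpha> \<otimes>\<^bsub>AutoGroup P\<^esub> \<theta> x \<otimes>\<^bsub>AutoGroup P\<^esub> inv\<^bsub>AutoGroup P\<^esub> \<alpha>" for x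
  have \<theta>c: "\<theta> x \<in> carrier (AutoGroup P)" "\<theta>' x \<in> carrier (AutoGroup P)" if "x \<in> carrier Q" for x
    using \<theta> \<theta>' that by (auto simp: hom_def)
  have "\<eta> \<in> hom Q (AutoGroup P)"
  proof (rule homI)
    fix x y assume xy: "x \<in> carrier Q" "y \<in> carrier Q"
    have "\<theta> (x \<otimes>\<^bsub>Q\<^esub> y) = \<theta> x \<otimes>\<^bsub>AutoGroup P\<^esub> \<theta> y" using \<theta> xy by (auto simp: hom_def)
    then show "\<eta> (x \<otimes>\<^bsub>Q\<^esub> y) = \<eta> x \<otimes>\<^bsub>AutoGroup P\<^esub> \<eta> y"
      unfolding \<eta>_def using \<theta>c xy \<alpha> by (simp add: A.m_assoc A.inv_solve_left)
  qed (use \<alpha> \<theta>c in \<open>auto simp: \<eta>_def\<close>)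
  moreover have "\<eta> ` carrier Q = \<theta>' ` carrier Q" unfolding img \<eta>_def by (simp add: image_image)
  ultimately obtain \<beta> where \<beta>: "\<beta> \<in> iso Q Q" and \<eta>\<beta>: "\<And>x. x \<in> carrier Q \<Longrightarrow> \<eta> x = \<theta>' (\<beta> x)"
    using det \<theta>' unfolding images_determine_homs_def by blast
  have \<beta>c: "\<beta> x \<in> carrier Q" if "x \<in> carrier Q" for x
    using \<beta> that by (auto simp: iso_def hom_def)
  have key: "\<alpha> (\<theta> x a) = \<theta>' (\<beta> x) (\<alpha> a)" if xa: "x \<in> carrier Q" "a \<in> carrier P" for x a
  proof -
    have "\<theta>' (\<beta> x) \<otimes>\<^bsub>AutoGroup P\<^esub> \<alpha> = \<eta> x \<otimes>\<^bsub>AutoGroup P\<^esub> \<alpha>" using \<eta>\<beta> xa by simp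
    also have "\<dots> = \<alpha> \<otimes>\<^bsub>AutoGroup P\<^esub> \<theta> x"
      unfolding \<eta>_def using \<alpha> \<theta>c xa by (simp add: A.m_assoc)
    finally have "compose (carrier P) (\<theta>' (\<beta> x)) \<alpha> = compose (carrier P) \<alpha> (\<theta> x)"
      using auto_compose_eq \<alpha>a S.\<theta>_auto S'.\<theta>_auto xa \<beta>c by metis
    then show ?thesis using xa by (metis compose_eq)
  qed
  have \<alpha>h: "\<alpha> \<in> hom P P" and \<alpha>b: "bij_betw \<alpha> (carrier P) (carrier P)"
    using \<alpha>a by (auto simp: auto_def Bij_def)
  have \<alpha>c: "\<alpha> a \<in> carrier P" if "a \<in> carrier P" for a using \<alpha>h that by (auto simp: hom_def)
  have "(\<lambda>(a, x). (\<alpha> a, \<beta> x)) \<in> iso (semidirect P Q \<theta>) (semidirect P Q \<theta>')"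
    unfolding iso_def
  proof (intro CollectI conjI homI)
    fix u v assume "u \<in> carrier (semidirect P Q \<theta>)" "v \<in> carrier (semidirect P Q \<theta>)"
    then obtain a x b y where uv: "u = (a, x)" "v = (b, y)" "a \<in> carrier P" "x \<in> carrier Q"
      "b \<in> carrier P" "y \<in> carrier Q" by auto
    have "\<alpha> (a \<otimes>\<^bsub>P\<^esub> \<theta> x b) = \<alpha> a \<otimes>\<^bsub>P\<^esub> \<theta>' (\<beta> x) (\<alpha> b)"
      using \<alpha>h uv key by (simp add: hom_def)
    moreover have "\<beta> (x \<otimes>\<^bsub>Q\<^esub> y) = \<beta> x \<otimes>\<^bsub>Q\<^esub> \<beta> y" using \<beta> uv by (auto simp: iso_def hom_def)
    ultimately show "(\<lambda>(a, x). (\<alpha> a, \<beta> x)) (u \<otimes>\<^bsub>semidirect P Q \<theta>\<^esub> v)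
      = (\<lambda>(a, x). (\<alpha> a, \<beta> x)) u \<otimes>\<^bsub>semidirect P Q \<theta>'\<^esub> (\<lambda>(a, x). (\<alpha> a, \<beta> x)) v"
      using uv by simp
  next
    show "bij_betw (\<lambda>(a, x). (\<alpha> a, \<beta> x)) (carrier (semidirect P Q \<theta>)) (carrier (semidirect P Q \<theta>'))"
      using bij_betw_map_prod[OF \<alpha>b, of \<beta> "carrier Q" "carrier Q"] \<beta>
      by (simp add: iso_def map_prod_def)
  qed (use \<alpha>c \<beta>c in auto)
  then show ?thesis by (rule is_isoI)
qed

text \<open>The isomorphic copy \<open>M\<close> of \<open>Aut(P)\<close> will be a group of residues or of matrices.\<close>

theorem num_iso_classes_split_extensions:
  assumes "comm_group P" "comm_group Q" "finite (carrier P)" "finite (carrier Q)"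
    and "coprime (order P) (order Q)"
    and det: "images_determine_homs Q (AutoGroup P)"
    and "group M" and \<Psi>: "\<Psi> \<in> iso M (AutoGroup P)"
  shows "num_iso_classes (split_extensions P Q) = card (hom_images Q M // conj_rel M)"
proof -
  interpret P: comm_group P by fact
  interpret Q: comm_group Q by fact
  interpret M: group M by fact
  interpret A: group "AutoGroup P" by (rule P.AutoGroup)
  let ?\<S> = "split_extensions P Q"
  let ?R = "{(G, H). G \<in> ?\<S> \<and> H \<in> ?\<S> \<and> G \<cong> H}"
  let ?T = "hom Q (AutoGroup P)"
  define \<Phi> where "\<Phi> = inv_into (carrier M) \<Psi>"
  have \<Phi>: "\<Phi> \<in> iso (AutoGroup P) M" unfolding \<Phi>_def using M.iso_set_sym[OF \<Psi>] .
  have \<Phi>h: "\<Phi> \<in> hom (AutoGroup P) M" using \<Phi> by (simp add: iso_def)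
  interpret \<Phi>: group_hom "AutoGroup P" M \<Phi> by unfold_locales (rule \<Phi>h)
  have \<Psi>h: "\<Psi> \<in> hom M (AutoGroup P)" and \<Psi>b: "bij_betw \<Psi> (carrier M) (carrier (AutoGroup P))"
    using \<Psi> by (auto simp: iso_def)
  have \<Phi>\<Psi>: "\<Phi> (\<Psi> m) = m" if "m \<in> carrier M" for m
    using \<Psi>b that by (simp add: \<Phi>_def bij_betw_def inv_into_f_f)
  have \<Phi>b: "bij_betw \<Phi> (carrier (AutoGroup P)) (carrier M)" using \<Phi> by (simp add: iso_def)
  have grp: "group G" if "G \<in> ?\<S>" for G
    using that action.group_semidirect P.comm_group_axioms Q.comm_group_axioms
    by (fastforce simp: split_extensions_def action_def action_axioms_def)
  have equiv: "equiv ?\<S> ?R"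
  proof (rule equivI)
    show "refl_on ?\<S> ?R" by (auto simp: refl_on_def iso_refl)
    show "sym ?R" using grp group.iso_sym by (auto simp: sym_def)
    show "trans ?R" using iso_trans by (fastforce simp: trans_def)
  qed auto
  have sub: "subgroup (\<theta> ` carrier Q) (AutoGroup P)" if "\<theta> \<in> ?T" for \<theta>
    using hom_images_subgroup[OF Q.is_group P.AutoGroup] that by (auto simp: hom_images_def)
  have subM: "subgroup (\<Phi> ` \<theta> ` carrier Q) M" if "\<theta> \<in> ?T" for \<theta>
    using sub[OF that] \<Phi>.subgroup_img_is_subgroup by blast
  have conjM: "(\<Phi> ` K, \<Phi> ` K') \<in> conj_rel M \<longleftrightarrow> (K, K') \<in> conj_rel (AutoGroup P)"
    if K: "subgroup K (AutoGroup P)" and K': "subgroup K' (AutoGroup P)" for K K'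
  proof -
    have KM: "subgroup (\<Phi> ` K) M" using K \<Phi>.subgroup_img_is_subgroup by blast
    have *: "(\<lambda>k. \<Phi> g \<otimes>\<^bsub>M\<^esub> k \<otimes>\<^bsub>M\<^esub> inv\<^bsub>M\<^esub> (\<Phi> g)) ` \<Phi> ` K
      = \<Phi> ` conjugation (AutoGroup P) g ` K"
      if g: "g \<in> carrier (AutoGroup P)" for g
      unfolding image_image
      by (rule image_cong) (use g subgroup.subset[OF K] in \<open>auto simp: subset_iff\<close>)
    have **: "conjugation (AutoGroup P) g ` K \<subseteq> carrier (AutoGroup P)"
      if g: "g \<in> carrier (AutoGroup P)" for g
      using subgroup.subset[OF A.subgroup_conj[OF K g]] .
    have inj: "\<Phi> ` X = \<Phi> ` Y \<longleftrightarrow> X = Y"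
      if "X \<subseteq> carrier (AutoGroup P)" "Y \<subseteq> carrier (AutoGroup P)" for X Y
      using \<Phi>b that by (meson bij_betw_def inj_on_image_eq_iff)
    have "(\<Phi> ` K, \<Phi> ` K') \<in> conj_rel M \<longleftrightarrow>
      (\<exists>g\<in>\<Phi> ` carrier (AutoGroup P). \<Phi> ` K' = conjugation M g ` \<Phi> ` K)"
      using M.conj_rel_iff[OF KM] \<Phi>b by (simp add: bij_betw_def)
    also have "\<dots> \<longleftrightarrow> (\<exists>g\<in>carrier (AutoGroup P).
        K' = conjugation (AutoGroup P) g ` K)"
      unfolding bex_simps
    proof (intro bex_cong refl)
      fix g assume g: "g \<in> carrier (AutoGroup P)"
      show "\<Phi> ` K' = (\<lambda>k. \<Phi> g \<otimes>\<^bsub>M\<^esub> k \<otimes>\<^bsub>M\<^esub> inv\<^bsub>M\<^esub> (\<Phi> g)) ` \<Phi> ` K \<longleftrightarrow>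
        K' = conjugation (AutoGroup P) g ` K"
        unfolding *[OF g] by (rule inj[OF subgroup.subset[OF K'] **[OF g]])
    qed
    also have "\<dots> \<longleftrightarrow> (K, K') \<in> conj_rel (AutoGroup P)"
      by (rule A.conj_rel_iff[OF K, symmetric])
    finally show ?thesis .
  qed
  have "?\<S> // ?R = (\<lambda>\<theta>. ?R `` {semidirect P Q \<theta>}) ` ?T"
    by (auto simp: quotient_def split_extensions_def)
  moreover have "hom_images Q M // conj_rel M = (\<lambda>\<theta>. conj_rel M `` {\<Phi> ` \<theta> ` carrier Q}) ` ?T"
  proof -
    have "hom_images Q M = (\<lambda>\<theta>. \<Phi> ` \<theta> ` carrier Q) ` ?T"
    proof (intro equalityI subsetI)
      fix K assume "K \<in> hom_images Q M"
      then obtain h where h: "h \<in> hom Q M" "K = h ` carrier Q" by (auto simp: hom_images_def)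
      have "\<Psi> \<circ> h \<in> ?T" using hom_compose[OF h(1) \<Psi>h] .
      moreover have "K = \<Phi> ` (\<Psi> \<circ> h) ` carrier Q"
        unfolding h(2) image_image using h(1) \<Phi>\<Psi> by (intro image_cong) (auto simp: hom_def Pi_iff)
      ultimately show "K \<in> (\<lambda>\<theta>. \<Phi> ` \<theta> ` carrier Q) ` ?T" by blast
    next
      fix K assume "K \<in> (\<lambda>\<theta>. \<Phi> ` \<theta> ` carrier Q) ` ?T"
      then obtain \<theta> where \<theta>: "\<theta> \<in> ?T" "K = \<Phi> ` \<theta> ` carrier Q" by blast
      then have "K = (\<Phi> \<circ> \<theta>) ` carrier Q" by (simp add: image_comp)
      then show "K \<in> hom_images Q M"
        using hom_compose[OF \<theta>(1) \<Phi>h] unfolding hom_images_def by blast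
    qed
    then show ?thesis by (auto simp: quotient_def)
  qed
  moreover have "card ((\<lambda>\<theta>. ?R `` {semidirect P Q \<theta>}) ` ?T)
    = card ((\<lambda>\<theta>. conj_rel M `` {\<Phi> ` \<theta> ` carrier Q}) ` ?T)"
  proof (rule card_image_cong_classes)
    fix \<theta> \<theta>' assume t: "\<theta> \<in> ?T" "\<theta>' \<in> ?T"
    have "?R `` {semidirect P Q \<theta>} = ?R `` {semidirect P Q \<theta>'} \<longleftrightarrow> semidirect P Q \<theta> \<cong> semidirect P Q \<theta>'"
      using eq_equiv_class_iff[OF equiv, of "semidirect P Q \<theta>" "semidirect P Q \<theta>'"] t
      by (auto simp: split_extensions_def)
    also have "\<dots> \<longleftrightarrow> (\<theta> ` carrier Q, \<theta>' ` carrier Q) \<in> conj_rel (AutoGroup P)"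
      using semidirect_iso_imp_conj[OF assms(1-5) t] semidirect_conj_imp_iso[OF assms(1,2) det t]
      by (auto simp: is_iso_def)
    also have "\<dots> \<longleftrightarrow> conj_rel M `` {\<Phi> ` \<theta> ` carrier Q} = conj_rel M `` {\<Phi> ` \<theta>' ` carrier Q}"
      using M.conj_class_eq_iff[OF subM[OF t(1)] subM[OF t(2)]] conjM[OF sub[OF t(1)] sub[OF t(2)]]
      by simp
    finally show "?R `` {semidirect P Q \<theta>} = ?R `` {semidirect P Q \<theta>'} \<longleftrightarrow>
      conj_rel M `` {\<Phi> ` \<theta> ` carrier Q} = conj_rel M `` {\<Phi> ` \<theta>' ` carrier Q}" .
  qed
  ultimately show ?thesis by (simp add: num_iso_classes_def)
qed

section \<open>Homomorphisms with the same image\<close>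

text \<open>\<open>Q\<close> need not be projective among abelian groups, but it is enough that homomorphisms
  from \<open>Q\<close> lift along restrictions of homomorphisms defined on \<open>Q\<close> itself.\<close>

definition self_lifting :: "('b, 'n) monoid_scheme \<Rightarrow> ('a, 'm) monoid_scheme \<Rightarrow> bool" where
  "self_lifting Q G \<longleftrightarrow>
     (\<forall>h\<in>hom Q G. \<forall>k\<in>hom Q G. \<forall>H. subgroup H Q \<longrightarrow> k ` carrier Q \<subseteq> h ` H \<longrightarrow>
        (\<exists>f\<in>hom Q Q. f ` carrier Q \<subseteq> H \<and> (\<forall>x\<in>carrier Q. h (f x) = k x)))"

text \<open>A counting argument in the style of Gaschuetz: the number of lifts of \<open>k\<close> along \<open>h\<close> with
  values in a subgroup \<open>H\<close> is the number of homomorphisms into \<open>H \<inter> ker h\<close>, whatever \<open>k\<close> is.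
  Removing the lifts with a smaller image shows, by induction on \<open>H\<close>, that the number of lifts
  with image exactly \<open>H\<close> is the same for all \<open>k\<close> with the same image. For \<open>k = h\<close> and \<open>H = Q\<close>
  this number is positive because of the identity, so every such \<open>k\<close> has a surjective lift.\<close>

theorem self_lifting_imp_images_determine_homs:
  assumes "comm_group Q" "finite (carrier Q)" "group G" and lift: "self_lifting Q G"
  shows "images_determine_homs Q G"
  unfolding images_determine_homs_def
proof (intro ballI impI)
  fix k h assume kh: "k \<in> hom Q G" "h \<in> hom Q G" "k ` carrier Q = h ` carrier Q"
  interpret Q: comm_group Q by fact
  interpret G: group G by fact
  interpret h: group_hom Q G h by unfold_locales (use kh in auto)
  define lifts where "lifts H k = {f \<in> hom Q Q \<inter> extensional (carrier Q).
    f ` carrier Q \<subseteq> H \<and> (\<forall>x\<in>carrier Q. h (f x) = k x)}" for H k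
  define onto where "onto H k = {f \<in> lifts H k. f ` carrier Q = H}" for H k
  have fin: "finite (lifts H k)" for H k
  proof (rule finite_subset)
    show "lifts H k \<subseteq> carrier Q \<rightarrow>\<^sub>E carrier Q"
      by (auto simp: lifts_def hom_def extensional_def PiE_def)
  qed (use assms(2) in \<open>auto intro: finite_PiE\<close>)
  \<comment> \<open>Multiplication by one fixed lift of \<open>k\<close> turns lifts of the trivial homomorphism into lifts of \<open>k\<close>.\<close>
  have translate: "card (lifts H k) = card (lifts H (\<lambda>_. \<one>\<^bsub>G\<^esub>))"
    if H: "subgroup H Q" and k: "k \<in> hom Q G" "k ` carrier Q \<subseteq> h ` H" for H k
  proof -
    obtain f' where f': "f' \<in> hom Q Q" "f' ` carrier Q \<subseteq> H" "\<And>x. x \<in> carrier Q \<Longrightarrow> h (f' x) = k x"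
      using lift H k kh(2) unfolding self_lifting_def by meson
    have f'c: "f' x \<in> carrier Q" "f' x \<in> H" if "x \<in> carrier Q" for x
      using f' that by (auto simp: hom_def)
    have Hc: "H \<subseteq> carrier Q" using H subgroup.subset by blast
    let ?t = "\<lambda>f. \<lambda>x\<in>carrier Q. f x \<otimes>\<^bsub>Q\<^esub> f' x"
    let ?s = "\<lambda>f. \<lambda>x\<in>carrier Q. f x \<otimes>\<^bsub>Q\<^esub> inv\<^bsub>Q\<^esub> f' x"
    have tr: "?t f \<in> lifts H k" if f: "f \<in> lifts H (\<lambda>_. \<one>\<^bsub>G\<^esub>)" for f
    proof -
      have fh: "f \<in> hom Q Q" using f by (simp add: lifts_def)
      have fc: "f x \<in> carrier Q" "f x \<in> H" "h (f x) = \<one>\<^bsub>G\<^esub>" if "x \<in> carrier Q" for x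
        using f that by (auto simp: lifts_def hom_def)
      have "?t f \<in> hom Q Q"
      proof (rule homI)
        fix x y assume xy: "x \<in> carrier Q" "y \<in> carrier Q"
        then have "f (x \<otimes>\<^bsub>Q\<^esub> y) = f x \<otimes>\<^bsub>Q\<^esub> f y" "f' (x \<otimes>\<^bsub>Q\<^esub> y) = f' x \<otimes>\<^bsub>Q\<^esub> f' y"
          using fh f'(1) by (auto simp: hom_def)
        then show "?t f (x \<otimes>\<^bsub>Q\<^esub> y) = ?t f x \<otimes>\<^bsub>Q\<^esub> ?t f y"
          using xy fc f'c by (simp add: Q.m_ac)
      qed (use fc f'c in auto)
      then show ?thesis
        using fc f'c f'(3) H hom_in_carrier[OF k(1)] by (auto simp: lifts_def subgroup.m_closed)
    qed
    have sr: "?s f \<in> lifts H (\<lambda>_. \<one>\<^bsub>G\<^esub>)" if f: "f \<in> lifts H k" for f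
    proof -
      have fh: "f \<in> hom Q Q" using f by (simp add: lifts_def)
      have fc: "f x \<in> carrier Q" "f x \<in> H" "h (f x) = k x" if "x \<in> carrier Q" for x
        using f that by (auto simp: lifts_def hom_def)
      have "?s f \<in> hom Q Q"
      proof (rule homI)
        fix x y assume xy: "x \<in> carrier Q" "y \<in> carrier Q"
        then have "f (x \<otimes>\<^bsub>Q\<^esub> y) = f x \<otimes>\<^bsub>Q\<^esub> f y" "f' (x \<otimes>\<^bsub>Q\<^esub> y) = f' x \<otimes>\<^bsub>Q\<^esub> f' y"
          using fh f'(1) by (auto simp: hom_def)
        then show "?s f (x \<otimes>\<^bsub>Q\<^esub> y) = ?s f x \<otimes>\<^bsub>Q\<^esub> ?s f y"
          using xy fc f'c by (simp add: Q.m_ac Q.inv_mult)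
      qed (use fc f'c in auto)
      moreover have "k x \<otimes>\<^bsub>G\<^esub> inv\<^bsub>G\<^esub> k x = \<one>\<^bsub>G\<^esub>" if "x \<in> carrier Q" for x
        using hom_in_carrier[OF k(1) that] by simp
      ultimately show ?thesis
        using fc f'c f'(3) H by (auto simp: lifts_def subgroup.m_closed subgroup.m_inv_closed)
    qed
    have "bij_betw ?t (lifts H (\<lambda>_. \<one>\<^bsub>G\<^esub>)) (lifts H k)"
    proof (rule bij_betwI[where g = ?s])
      have cancel: "f x \<in> carrier Q" if "x \<in> carrier Q" "f \<in> lifts H k'" for x f k'
        using that by (auto simp: lifts_def hom_def)
      show "?s (?t f) = f" if "f \<in> lifts H (\<lambda>_. \<one>\<^bsub>G\<^esub>)" for f
      proof (rule extensionalityI[where A = "carrier Q"])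
        show "?s (?t f) x = f x" if "x \<in> carrier Q" for x
          using that f'c cancel[OF that \<open>f \<in> _\<close>] by (simp add: Q.m_assoc)
      qed (use that in \<open>auto simp: lifts_def\<close>)
      show "?t (?s f) = f" if "f \<in> lifts H k" for f
      proof (rule extensionalityI[where A = "carrier Q"])
        show "?t (?s f) x = f x" if "x \<in> carrier Q" for x
          using that f'c cancel[OF that \<open>f \<in> _\<close>] by (simp add: Q.m_assoc)
      qed (use that in \<open>auto simp: lifts_def\<close>)
    qed (use tr sr in blast)+
    then show ?thesis by (simp add: bij_betw_same_card)
  qed
  have "card (onto H k) = card (onto H h)"
    if "subgroup H Q" "k \<in> hom Q G" "k ` carrier Q = h ` carrier Q" for H k
    using that
  proof (induction "card H" arbitrary: H rule: less_induct)
    case less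
    show ?case
    proof (cases "h ` H = h ` carrier Q")
      case False
      have "h ` H = k' ` carrier Q" if "f \<in> onto H k'" for f k'
      proof -
        have "h ` H = (\<lambda>x. h (f x)) ` carrier Q"
          using that by (auto simp: onto_def image_image[symmetric])
        also have "\<dots> = k' ` carrier Q"
          by (rule image_cong) (use that in \<open>auto simp: onto_def lifts_def\<close>)
        finally show ?thesis .
      qed
      then have "f \<notin> onto H k" "f \<notin> onto H h" for f using False less.prems(3) by metis+
      then have "onto H k = {}" "onto H h = {}" by blast+
      then show ?thesis by simp
    next
      case True
      define S where "S = {H'. subgroup H' Q \<and> H' \<subset> H}"
      have Hc: "H \<subseteq> carrier Q" using less.prems(1) subgroup.subset by blast
      have finH: "finite H" using Hc assms(2) finite_subset by blast
      have finS: "finite S" by (rule finite_subset[of _ "Pow H"]) (use finH in \<open>auto simp: S_def\<close>)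
      have split: "card (lifts H k') = card (onto H k') + (\<Sum>H'\<in>S. card (onto H' k'))" for k'
      proof -
        have un: "lifts H k' = onto H k' \<union> (\<Union>H'\<in>S. onto H' k')"
        proof (intro equalityI subsetI)
          fix f assume f: "f \<in> lifts H k'"
          then have "group_hom Q Q f" by unfold_locales (simp add: lifts_def)
          then have "subgroup (f ` carrier Q) Q" using group_hom.img_is_subgroup by blast
          then show "f \<in> onto H k' \<union> (\<Union>H'\<in>S. onto H' k')"
            using f by (auto simp: S_def onto_def lifts_def)
        qed (auto simp: S_def onto_def lifts_def)
        have "card (onto H k' \<union> (\<Union>H'\<in>S. onto H' k')) = card (onto H k') + card (\<Union>H'\<in>S. onto H' k')"
          by (rule card_Un_disjoint) (use fin finS in \<open>auto simp: S_def onto_def\<close>)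
        also have "card (\<Union>H'\<in>S. onto H' k') = (\<Sum>H'\<in>S. card (onto H' k'))"
          by (rule card_UN_disjoint) (use fin finS in \<open>auto simp: onto_def\<close>)
        finally show ?thesis unfolding un .
      qed
      have "(\<Sum>H'\<in>S. card (onto H' k)) = (\<Sum>H'\<in>S. card (onto H' h))"
        by (rule sum.cong) (use less finH in \<open>auto simp: S_def intro!: psubset_card_mono\<close>)
      moreover have "card (lifts H k) = card (lifts H h)"
        using translate[OF less.prems(1)] less.prems True kh(2) by simp
      ultimately show ?thesis using split[of k] split[of h] by simp
    qed
  qed
  then have "card (onto (carrier Q) k) = card (onto (carrier Q) h)"
    using kh Q.subgroup_self by blast
  moreover have "(\<lambda>x\<in>carrier Q. x) \<in> onto (carrier Q) h"
    by (auto simp: onto_def lifts_def hom_def)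
  then have "card (onto (carrier Q) h) > 0"
    using fin by (auto simp: card_gt_0_iff onto_def)
  ultimately obtain f where f: "f \<in> onto (carrier Q) k"
    by (metis card.empty equals0I less_numeral_extra(3))
  then have "f ` carrier Q = carrier Q" by (simp add: onto_def)
  then have "inj_on f (carrier Q)" using assms(2) by (simp add: eq_card_imp_inj_on)
  then have "f \<in> iso Q Q" using f by (auto simp: iso_def bij_betw_def onto_def lifts_def)
  moreover have "\<forall>x\<in>carrier Q. k x = h (f x)" using f by (auto simp: onto_def lifts_def)
  ultimately show "\<exists>\<beta>\<in>iso Q Q. \<forall>x\<in>carrier Q. k x = h (\<beta> x)" by blast
qed

section \<open>Images of products of two cyclic groups\<close>

abbreviation Zmn :: "nat \<Rightarrow> nat \<Rightarrow> (int \<times> int) monoid" where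
  "Zmn m n \<equiv> integer_mod_group m \<times>\<times> integer_mod_group n"

lemma comm_group_Zmn:
  "comm_group (Zmn m n)"
  by (rule group.group_comm_groupI)
    (auto simp: DirProd_group add.commute)

lemma order_Zmn:
  "0 < m \<Longrightarrow> 0 < n \<Longrightarrow> order (Zmn m n) = m * n"
  by (simp add: order_def carrier_integer_mod_group card_cartesian_product)

lemma int_pow_Zmn:
  assumes "(x, y) \<in> carrier (Zmn m n)" "0 < m" "0 < n"
  shows "(x, y) [^]\<^bsub>Zmn m n\<^esub> (k::int) = (k * x mod int m, k * y mod int n)"
proof -
  interpret Z: group "Zmn m n"
    by (simp add: DirProd_group)
  interpret f: group_hom "Zmn m n" "integer_mod_group m" fst
    by (rule group_hom.intro[OF Z.is_group group_integer_mod_group group_hom_axioms.intro]) (auto simp: hom_def)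
  interpret s: group_hom "Zmn m n" "integer_mod_group n" snd
    by (rule group_hom.intro[OF Z.is_group group_integer_mod_group group_hom_axioms.intro]) (auto simp: hom_def)
  show ?thesis
    using f.hom_int_pow[OF assms(1), of k] s.hom_int_pow[OF assms(1), of k]
    by (simp add: int_pow_integer_mod_group prod_eq_iff)
qed

lemma (in group) subgroup_coprime_pow_mem:
  assumes "subgroup H G" "b \<in> carrier G" "b [^] (m::int) \<in> H" "b [^] (n::int) \<in> H" "coprime m n"
  shows "b \<in> H"
proof -
  obtain s t where st: "s * m + t * n = 1" using bezout_int[of m n] assms(5) by auto
  have "b = b [^] (m * s + n * t)" using st assms(2) by (simp add: mult.commute)
  also have "\<dots> = (b [^] m) [^] s \<otimes> (b [^] n) [^] t"
    using assms(2) by (simp only: int_pow_mult int_pow_pow)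
  finally show ?thesis using assms subgroup_int_pow_closed subgroup.m_closed by metis
qed

context comm_group
begin

definition span2 :: "'a \<Rightarrow> 'a \<Rightarrow> 'a set" where
  "span2 a b = {a [^] i \<otimes> b [^] j | (i::int) (j::int). True}"

lemma subgroup_span2:
  assumes "a \<in> carrier G" "b \<in> carrier G"
  shows "subgroup (span2 a b) G"
proof (rule subgroupI)
  show "span2 a b \<subseteq> carrier G" using assms by (auto simp: span2_def)
  show "span2 a b \<noteq> {}" by (auto simp: span2_def)
next
  fix x assume "x \<in> span2 a b"
  then obtain i j :: int where x: "x = a [^] i \<otimes> b [^] j" by (auto simp: span2_def)
  have "inv x = a [^] (- i) \<otimes> b [^] (- j)" unfolding x using assms by (simp add: int_pow_neg inv_mult)
  then show "inv x \<in> span2 a b" by (auto simp: span2_def)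
next
  fix x y assume "x \<in> span2 a b" "y \<in> span2 a b"
  then obtain i j k l :: int where x: "x = a [^] i \<otimes> b [^] j" and y: "y = a [^] k \<otimes> b [^] l"
    by (auto simp: span2_def)
  have "x \<otimes> y = (a [^] i \<otimes> a [^] k) \<otimes> (b [^] j \<otimes> b [^] l)"
    unfolding x y using assms by (simp add: m_ac)
  also have "\<dots> = a [^] (i + k) \<otimes> b [^] (j + l)" using assms by (simp add: int_pow_mult)
  finally have "x \<otimes> y = a [^] (i + k) \<otimes> b [^] (j + l)" .
  then show "x \<otimes> y \<in> span2 a b" by (auto simp: span2_def)
qed

lemma span2_gens:
  assumes "a \<in> carrier G" "b \<in> carrier G"
  shows "a \<in> span2 a b" "b \<in> span2 a b"
proof -
  have "a = a [^] (1::int) \<otimes> b [^] (0::int)" "b = a [^] (0::int) \<otimes> b [^] (1::int)"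
    using assms by simp_all
  then show "a \<in> span2 a b" "b \<in> span2 a b" unfolding span2_def by blast+
qed

lemma span2_subset: "subgroup H G \<Longrightarrow> a \<in> H \<Longrightarrow> b \<in> H \<Longrightarrow> span2 a b \<subseteq> H"
  by (auto simp: span2_def intro!: subgroup.m_closed subgroup_int_pow_closed)

lemma span2_eqI:
  assumes "a \<in> carrier G" "b \<in> carrier G" "x \<in> span2 a b" "y \<in> span2 a b"
    "a \<in> span2 x y" "b \<in> span2 x y"
  shows "span2 x y = span2 a b"
proof -
  have c: "x \<in> carrier G" "y \<in> carrier G"
    using assms subgroup_span2[of a b] subgroup.mem_carrier by metis+
  show ?thesis
    using span2_subset[OF subgroup_span2[OF c] assms(5,6)]
      span2_subset[OF subgroup_span2[OF assms(1,2)] assms(3,4)] by blast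
qed

lemma hom_of_powers:
  assumes ab: "a \<in> carrier G" "b \<in> carrier G" and m: "0 < m" "0 < n" "ord a dvd m" "ord b dvd n"
  shows "(\<lambda>(i, j). a [^] i \<otimes> b [^] j) \<in> hom (Zmn m n) G" (is ?hom)
    and "(\<lambda>(i, j). a [^] i \<otimes> b [^] j) ` carrier (Zmn m n) = span2 a b" (is ?img)
proof -
  have red: "a [^] (i mod int m) = a [^] i" "b [^] (i mod int n) = b [^] i" for i
    using ab m dvd_trans[of "int (ord a)" "int m" "i - i mod int m"]
      dvd_trans[of "int (ord b)" "int n" "i - i mod int n"]
    by (simp_all add: int_pow_eq)
  show ?hom
  proof (rule homI)
    fix u v :: "int \<times> int"
    obtain i j k l where uv: "u = (i, j)" "v = (k, l)" by fastforce
    have "a [^] (i + k) \<otimes> b [^] (j + l) = (a [^] i \<otimes> a [^] k) \<otimes> (b [^] j \<otimes> b [^] l)"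
      using ab by (simp add: int_pow_mult)
    also have "\<dots> = (a [^] i \<otimes> b [^] j) \<otimes> (a [^] k \<otimes> b [^] l)" using ab by (simp add: m_ac)
    finally have eq: "a [^] (i + k) \<otimes> b [^] (j + l) = (a [^] i \<otimes> b [^] j) \<otimes> (a [^] k \<otimes> b [^] l)" .
    show "(\<lambda>(i, j). a [^] i \<otimes> b [^] j) (u \<otimes>\<^bsub>Zmn m n\<^esub> v)
      = (\<lambda>(i, j). a [^] i \<otimes> b [^] j) u \<otimes> (\<lambda>(i, j). a [^] i \<otimes> b [^] j) v"
      by (simp add: uv red eq)
  qed (use ab in auto)
  show ?img
  proof (intro equalityI subsetI)
    fix x assume "x \<in> span2 a b"
    then obtain i j where x: "x = a [^] (i mod int m) \<otimes> b [^] (j mod int n)"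
      unfolding span2_def red by auto
    have "(i mod int m, j mod int n) \<in> carrier (Zmn m n)"
      using m by (simp add: carrier_integer_mod_group)
    then show "x \<in> (\<lambda>(i, j). a [^] i \<otimes> b [^] j) ` carrier (Zmn m n)"
      unfolding x by force
  qed (auto simp: span2_def)
qed

lemma span2_in_hom_images:
  assumes "a \<in> carrier G" "b \<in> carrier G" "0 < m" "0 < n" "ord a dvd m" "ord b dvd n"
  shows "span2 a b \<in> hom_images (Zmn m n) G"
  using hom_of_powers[OF assms] unfolding hom_images_def by blast

lemma iso_direct_span2:
  assumes ab: "a \<in> carrier G" "b \<in> carrier G" and pos: "0 < ord a" "0 < ord b"
    and direct: "\<And>(i::int) (j::int). a [^] i \<otimes> b [^] j = \<one> \<Longrightarrow> b [^] j = \<one>"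
  shows "(\<lambda>(i, j). a [^] i \<otimes> b [^] j)
    \<in> iso (Zmn (ord a) (ord b)) (G\<lparr>carrier := span2 a b\<rparr>)"
proof -
  let ?Z = "Zmn (ord a) (ord b)"
  let ?h = "\<lambda>(i, j). a [^] i \<otimes> b [^] j"
  note h = hom_of_powers[OF ab pos dvd_refl dvd_refl]
  interpret Z: comm_group ?Z by (rule comm_group_Zmn)
  interpret h: group_hom ?Z G ?h by unfold_locales (rule h(1))
  have "u = \<one>\<^bsub>?Z\<^esub>" if u: "u \<in> carrier ?Z" "?h u = \<one>" for u
  proof -
    obtain i j where ij: "u = (i, j)" by fastforce
    have b: "b [^] j = \<one>" using direct[of i j] u(2) ij by simp
    then have a: "a [^] i = \<one>" using u(2) ij ab by simp
    have "int (ord a) dvd i" "int (ord b) dvd j" using a b ab by (simp_all add: int_pow_eq_id)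
    moreover have "0 \<le> i" "i < int (ord a)" "0 \<le> j" "j < int (ord b)"
      using u(1) pos unfolding ij by (simp_all add: carrier_integer_mod_group)
    ultimately show ?thesis unfolding ij by (auto simp: zdvd_not_zless le_less)
  qed
  then have "inj_on ?h (carrier ?Z)" using h.inj_on_one_iff by blast
  then show ?thesis using h by (auto simp: iso_def hom_def bij_betw_def Pi_iff)
qed

text \<open>Choosing the second generator of least possible order makes the product direct and the
  second order a divisor of the first: a prime \<open>q\<close> violating either condition allows the
  \<open>q\<close>-part of \<open>b\<close> to be dropped or to be moved into \<open>a\<close>.\<close>

lemma span2_normal_form:
  assumes ab: "a \<in> carrier G" "b \<in> carrier G" and N: "0 < N" "d dvd N" "squarefree d"
    and ord: "ord a dvd N" "ord b dvd d"
  obtains x y where "x \<in> carrier G" "y \<in> carrier G" "ord x dvd N" "ord y dvd d"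
    "span2 x y = span2 a b" "ord y dvd ord x"
    "\<And>(i::int) (j::int). x [^] i \<otimes> y [^] j = \<one> \<Longrightarrow> y [^] j = \<one>"
proof -
  define S where "S = {(x, y). x \<in> carrier G \<and> y \<in> carrier G \<and> ord x dvd N \<and> ord y dvd d
    \<and> span2 x y = span2 a b}"
  have "(a, b) \<in> S" using assms by (simp add: S_def)
  then obtain u where u: "u \<in> S" "\<And>v. v \<in> S \<Longrightarrow> ord (snd u) \<le> ord (snd v)"
    using arg_min_nat_lemma[of "\<lambda>u. u \<in> S" "(a, b)" "\<lambda>u. ord (snd u)"] by metis
  obtain x y where xy: "u = (x, y)" by fastforce
  have c: "x \<in> carrier G" "y \<in> carrier G" "ord x dvd N" "ord y dvd d" "span2 x y = span2 a b"
    using u(1) by (auto simp: S_def xy)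
  have d0: "d > 0" using N by (auto intro: Nat.gr0I)
  have e0: "ord y > 0" using c(4) d0 by (auto intro: Nat.gr0I)
  have sqf: "squarefree (ord y)" using N(3) c(4) squarefree_mono by blast
  \<comment> \<open>In both cases \<open>y\<^sup>q\<close>, which has smaller order, could replace \<open>y\<close>.\<close>
  have prime_step: "q dvd ord x \<and> (\<forall>i::int. y [^] (ord y div q) \<noteq> x [^] i)"
    if q: "prime q" "q dvd ord y" for q
  proof -
    define r where "r = ord y div q"
    have qr: "ord y = q * r" using q by (simp add: r_def)
    then have r: "0 < r" "r < ord y" using e0 prime_gt_1_nat[OF q(1)] by auto
    have cop: "coprime (int r) (int q)"
    proof -
      have "\<not> q dvd r"
        using sqf q(1) qr unfolding squarefree_def power2_eq_square
        by (metis mult_dvd_mono dvd_refl not_prime_unit)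
      then show ?thesis using q(1) prime_imp_coprime_nat coprime_commute by (metis coprime_int_iff)
    qed
    have ordq: "ord (y [^] q) = r" using ord_pow[OF c(2) q(2)] q(1) by (simp add: r_def prime_gt_0_nat)
    have ordr: "ord (y [^] r) = q"
      using ord_pow[OF c(2), of r] qr r by simp
    have yN: "ord (y [^] q) dvd d" using ordq qr c(4) dvd_trans by (metis dvd_triv_right)
    have y: "y [^] int q \<in> carrier G" "y [^] int r \<in> carrier G" using c by simp_all
    have smaller: False if "x' \<in> carrier G" "ord x' dvd N" "x' \<in> span2 x y"
      "x \<in> span2 x' (y [^] int q)" "y [^] int r \<in> span2 x' (y [^] int q)" for x'
    proof -
      have H: "subgroup (span2 x' (y [^] int q)) G" by (intro subgroup_span2 that y)
      have "y \<in> span2 x' (y [^] int q)"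
        by (rule subgroup_coprime_pow_mem[OF H c(2) that(5) span2_gens(2)[OF that(1) y(1)] cop])
      moreover have "y [^] int q \<in> span2 x y"
        by (rule subgroup_int_pow_closed[OF subgroup_span2 span2_gens(2)]) (use c in simp_all)
      ultimately have "span2 x' (y [^] int q) = span2 x y"
        by (intro span2_eqI c that(3,4))
      then have "(x', y [^] int q) \<in> S" using that yN c by (simp add: S_def int_pow_int)
      then have "ord y \<le> r" using u(2) ordq by (fastforce simp: xy int_pow_int)
      then show False using r by simp
    qed
    have not_mem: "y [^] r \<noteq> x [^] i" for i :: int
    proof
      assume eq: "y [^] r = x [^] i"
      have "x \<in> span2 x (y [^] int q)" by (intro span2_gens c y)
      moreover from this have "x [^] i \<in> span2 x (y [^] int q)"
        by (intro subgroup_int_pow_closed[OF subgroup_span2] c y)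
      ultimately show False
        using smaller[of x] c eq span2_gens[OF c(1,2)] by (simp add: int_pow_int)
    qed
    have "q dvd ord x"
    proof (rule ccontr)
      assume "\<not> q dvd ord x"
      then have cop': "coprime q (ord x)" using q(1) prime_imp_coprime_nat by blast
      define x' where "x' = x \<otimes> y [^] r"
      have x': "x' \<in> carrier G" using c by (simp add: x'_def)
      let ?H = "span2 x' (y [^] int q)"
      have H: "subgroup ?H G" by (intro subgroup_span2 x' y)
      have "x' [^] int (ord x) = (y [^] int r) [^] int (ord x)"
        unfolding x'_def using c by (simp add: pow_mult_distrib m_comm int_pow_int)
      moreover have "x' [^] int (ord x) \<in> ?H" 
        by (intro subgroup_int_pow_closed[OF H] span2_gens x' y)
      ultimately have 1: "(y [^] int r) [^] int (ord x) \<in> ?H" by simp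
      have "(y [^] int r) [^] int q = \<one>" using pow_ord_eq_1[of "y [^] r"] ordr c by (simp add: int_pow_int)
      then have 2: "(y [^] int r) [^] int q \<in> ?H" using subgroup.one_closed[OF H] by simp
      have yr: "y [^] int r \<in> ?H"
        using subgroup_coprime_pow_mem[OF H y(2) 1 2] cop' by (simp add: coprime_commute)
      have "x = x' \<otimes> inv (y [^] int r)"
        using c by (simp add: x'_def int_pow_int m_assoc)
      then have "x \<in> ?H"
        using subgroup.m_closed[OF H span2_gens(1)[OF x' y(1)] subgroup.m_inv_closed[OF H yr]] by simp
      moreover have "x' \<in> span2 x y"
        unfolding x'_def int_pow_int[symmetric] using c
        by (intro subgroup.m_closed[OF subgroup_span2] subgroup_int_pow_closed[OF subgroup_span2] span2_gens)
      moreover have "ord x' dvd N"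
      proof -
        have "ord x' dvd ord x * q" using abelian_ord_mul_divides[of x "y [^] r"] c ordr by (simp add: x'_def)
        also have "ord x * q dvd N"
          using cop' c(3,4) N(2) q(2) by (metis coprime_commute divides_mult dvd_trans)
        finally show ?thesis .
      qed
      ultimately show False using smaller[OF x'] yr by blast
    qed
    then show ?thesis using not_mem by (simp add: r_def)
  qed
  have "ord y dvd ord x"
  proof (rule ccontr)
    assume n: "\<not> ord y dvd ord x"
    define g where "g = gcd (ord y) (ord x)"
    have "g dvd ord y" by (simp add: g_def)
    then obtain k where k: "ord y = g * k" by (rule dvdE)
    have "g dvd ord x" by (simp add: g_def)
    then have "k \<noteq> 1" using n k by auto
    then obtain q where q: "prime q" "q dvd k" using prime_factor_nat by blast
    have "q dvd ord x" "q dvd ord y" using prime_step[OF q(1)] q(2) k by auto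
    then have "q dvd g" unfolding g_def by (simp del: gcd_greatest_iff add: gcd_greatest)
    then have "q ^ 2 dvd ord y" unfolding k power2_eq_square using q(2) mult_dvd_mono by blast
    then show False using sqf q(1) by (auto simp: squarefree_def)
  qed
  moreover have "y [^] j = \<one>" if "x [^] i \<otimes> y [^] j = \<one>" for i j :: int
  proof (rule ccontr)
    assume n: "y [^] j \<noteq> \<one>"
    define f where "f = gcd (int (ord y)) j"
    obtain s t where st: "s * int (ord y) + t * j = f" using bezout_int f_def by blast
    have f0: "0 < f" using e0 by (simp add: f_def)
    have "int (nat f) dvd int (ord y)" using f0 by (simp add: f_def)
    then have "nat f dvd ord y" by (simp only: int_dvd_int_iff)
    then obtain k where k: "ord y = nat f * k" by (rule dvdE)
    have "k \<noteq> 1"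
    proof
      assume "k = 1"
      then have "int (ord y) = f" using k f0 by simp
      then have "int (ord y) dvd j" by (metis f_def gcd_dvd2)
      then show False using n c by (simp add: int_pow_eq_id)
    qed
    then obtain q where q: "prime q" "q dvd k" using prime_factor_nat by blast
    then obtain k' where k': "k = q * k'" by blast
    have qy: "q dvd ord y" using q k by simp
    have r: "int (ord y div q) = f * int k'" using k k' f0 prime_gt_0_nat[OF q(1)] by simp
    have yj: "y [^] j = x [^] (- i)"
      using that c by (metis int_pow_closed int_pow_neg inv_equality m_comm)
    have "y [^] f = y [^] (int (ord y) * s) \<otimes> y [^] (j * t)"
      using st c by (simp add: mult.commute flip: int_pow_mult)
    also have "\<dots> = (y [^] j) [^] t" using c int_pow_eq_id[of y "int (ord y) * s"] by (simp add: int_pow_pow)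
    also have "\<dots> = x [^] (- i * t)" using c by (simp add: yj int_pow_pow)
    finally have yf: "y [^] f = x [^] (- i * t)" .
    have "y [^] (ord y div q) = y [^] (f * int k')" by (simp add: int_pow_int flip: r)
    also have "\<dots> = (y [^] f) [^] int k'" using c by (simp add: int_pow_pow)
    also have "\<dots> = x [^] (- i * t * int k')" unfolding yf using c by (simp add: int_pow_pow)
    finally show False using prime_step[OF q(1) qy] by blast
  qed
  ultimately show thesis using that[of x y] c by blast
qed

end

section \<open>Images and subgroups of \<open>Z\<^bsub>cd\<^esub> \<times> Z\<^sub>d\<close>\<close>

lemma hom_image_restrict:
  assumes "comm_group Q" "group G" "h \<in> hom Q G"
  shows "comm_group (G\<lparr>carrier := h ` carrier Q\<rparr>)"
    and "h \<in> hom Q (G\<lparr>carrier := h ` carrier Q\<rparr>)"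
proof -
  interpret Q: comm_group Q by fact
  interpret G: group G by fact
  interpret h: group_hom Q G h by unfold_locales fact
  have grp: "group (G\<lparr>carrier := h ` carrier Q\<rparr>)"
    by (rule subgroup.subgroup_is_group[OF h.img_is_subgroup G.is_group])
  show "comm_group (G\<lparr>carrier := h ` carrier Q\<rparr>)"
  proof (rule group.group_comm_groupI[OF grp])
    fix x y assume "x \<in> carrier (G\<lparr>carrier := h ` carrier Q\<rparr>)" "y \<in> carrier (G\<lparr>carrier := h ` carrier Q\<rparr>)"
    then obtain u v where uv: "x = h u" "y = h v" "u \<in> carrier Q" "v \<in> carrier Q" by auto
    then show "x \<otimes>\<^bsub>G\<lparr>carrier := h ` carrier Q\<rparr>\<^esub> y = y \<otimes>\<^bsub>G\<lparr>carrier := h ` carrier Q\<rparr>\<^esub> x"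
      using h.hom_mult[of u v] h.hom_mult[of v u] Q.m_comm[of u v] by simp
  qed
  show "h \<in> hom Q (G\<lparr>carrier := h ` carrier Q\<rparr>)" by (auto simp: hom_def)
qed

lemma hom_images_restrict_iff:
  "subgroup K G \<Longrightarrow> K \<in> hom_images Q (G\<lparr>carrier := K\<rparr>) \<longleftrightarrow> K \<in> hom_images Q G"
proof -
  assume "subgroup K G"
  then have "h \<in> hom Q (G\<lparr>carrier := K\<rparr>) \<longleftrightarrow> h \<in> hom Q G" if "K = h ` carrier Q" for h
    using that subgroup.subset[of K G] unfolding hom_def by auto
  then show ?thesis unfolding hom_images_def by blast
qed

lemma comm_group_hom_image:
  assumes "comm_group Q" "group G" "K \<in> hom_images Q G"
  shows "comm_group (G\<lparr>carrier := K\<rparr>)"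
  using hom_image_restrict(1)[OF assms(1,2)] assms(3) by (auto simp: hom_images_def)

lemma card_hom_image_dvd:
  assumes "comm_group Q" "group G" "K \<in> hom_images Q G"
  shows "card K dvd order Q"
proof -
  interpret Q: comm_group Q by fact
  obtain h where h: "h \<in> hom Q G" "K = h ` carrier Q" using assms(3) by (auto simp: hom_images_def)
  let ?A = "G\<lparr>carrier := h ` carrier Q\<rparr>"
  interpret A: comm_group ?A by (rule hom_image_restrict[OF assms(1,2) h(1)])
  interpret h: group_hom Q ?A h by unfold_locales (rule hom_image_restrict[OF assms(1,2) h(1)])
  have "card (carrier (Q Mod kernel Q ?A h)) = card K"
    using iso_same_card[OF h.FactGroup_iso] h(2) by simp
  then show ?thesis
    using Q.lagrange[OF h.subgroup_kernel] by (metis FactGroup_def dvd_triv_left partial_object.select_convs(1))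
qed

lemma hom_DirProd_eq_powers:
  assumes "group G" and h: "h \<in> hom (Zmn m n) G" and mn: "0 < m" "0 < n"
  defines "a \<equiv> h (1 mod int m, 0)" and "b \<equiv> h (0, 1 mod int n)"
  shows "a \<in> carrier G" "b \<in> carrier G" "group.ord G a dvd m" "group.ord G b dvd n"
    and "(i, j) \<in> carrier (Zmn m n) \<Longrightarrow>
      h (i, j) = a [^]\<^bsub>G\<^esub> i \<otimes>\<^bsub>G\<^esub> b [^]\<^bsub>G\<^esub> j"
proof -
  let ?Z = "Zmn m n"
  interpret G: group G by fact
  interpret Z: comm_group ?Z by (rule comm_group_Zmn)
  interpret h: group_hom ?Z G h by unfold_locales fact
  have e: "(1 mod int m, 0) \<in> carrier ?Z" "(0, 1 mod int n) \<in> carrier ?Z"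
    using mn by (simp_all add: carrier_integer_mod_group)
  show ab: "a \<in> carrier G" "b \<in> carrier G" unfolding a_def b_def using e by (auto intro: h.hom_closed)
  have pow: "a [^]\<^bsub>G\<^esub> k = h (k mod int m, 0)" "b [^]\<^bsub>G\<^esub> k = h (0, k mod int n)" for k :: int
    using h.hom_int_pow[OF e(1), of k] h.hom_int_pow[OF e(2), of k]
      int_pow_Zmn[OF e(1) mn] int_pow_Zmn[OF e(2) mn]
    by (simp_all add: a_def b_def mod_mult_right_eq)
  have "h (0, 0) = \<one>\<^bsub>G\<^esub>" using h.hom_one by simp
  then have "a [^]\<^bsub>G\<^esub> int m = \<one>\<^bsub>G\<^esub>" "b [^]\<^bsub>G\<^esub> int n = \<one>\<^bsub>G\<^esub>" by (simp_all add: pow)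
  then show "G.ord a dvd m" "G.ord b dvd n" using ab by (simp_all add: G.int_pow_eq_id)
  show "h (i, j) = a [^]\<^bsub>G\<^esub> i \<otimes>\<^bsub>G\<^esub> b [^]\<^bsub>G\<^esub> j" if ij: "(i, j) \<in> carrier ?Z"
  proof -
    have "i \<in> {0..<int m}" "j \<in> {0..<int n}" using ij mn by (simp_all add: carrier_integer_mod_group)
    then have "(i, j) = (i mod int m, 0) \<otimes>\<^bsub>?Z\<^esub> (0, j mod int n)" by simp
    also have "h \<dots> = h (i mod int m, 0) \<otimes>\<^bsub>G\<^esub> h (0, j mod int n)"
      by (rule h.hom_mult) (use mn in \<open>simp_all add: carrier_integer_mod_group\<close>)
    finally show ?thesis by (simp add: pow)
  qed
qed

lemma (in comm_group) hom_images_DirProd_iff: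
  assumes "0 < m" "0 < n"
  shows "K \<in> hom_images (Zmn m n) G \<longleftrightarrow>
    (\<exists>a\<in>carrier G. \<exists>b\<in>carrier G. ord a dvd m \<and> ord b dvd n \<and> K = span2 a b)"
proof
  assume "K \<in> hom_images (Zmn m n) G"
  then obtain h where h: "h \<in> hom (Zmn m n) G"
    "K = h ` carrier (Zmn m n)" by (auto simp: hom_images_def)
  define a where "a = h (1 mod int m, 0)"
  define b where "b = h (0, 1 mod int n)"
  note * = hom_DirProd_eq_powers[OF is_group h(1) assms, folded a_def b_def]
  have "h ` carrier (Zmn m n)
    = (\<lambda>(i, j). a [^] i \<otimes> b [^] j) ` carrier (Zmn m n)"
    by (rule image_cong) (use *(5) in auto)
  then have "K = span2 a b" using hom_of_powers(2)[OF *(1,2) assms *(3,4)] h(2) by simp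
  then show "\<exists>a\<in>carrier G. \<exists>b\<in>carrier G. ord a dvd m \<and> ord b dvd n \<and> K = span2 a b"
    using * by blast
qed (use span2_in_hom_images assms in blast)

lemma comm_group_Qgrp: "comm_group (Qgrp c d)"
  by (simp add: Qgrp_def comm_group_Zmn)

lemma finite_Qgrp: "0 < c \<Longrightarrow> 0 < d \<Longrightarrow> finite (carrier (Qgrp c d))"
  by (simp add: Qgrp_def carrier_integer_mod_group)

lemma order_Qgrp: "0 < c \<Longrightarrow> 0 < d \<Longrightarrow> order (Qgrp c d) = c * d * d"
  by (simp add: Qgrp_def order_Zmn)

lemma ord_Qgrp_dvd:
  assumes "0 < c" "0 < d" "z \<in> carrier (Qgrp c d)"
  shows "group.ord (Qgrp c d) z dvd c * d"
proof -
  interpret Q: comm_group "Qgrp c d" by (rule comm_group_Qgrp)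
  obtain x y where z: "z = (x, y)" by fastforce
  have "z [^]\<^bsub>Qgrp c d\<^esub> int (c * d) = (int (c * d) * x mod int (c * d), int (c * d) * y mod int d)"
    using int_pow_Zmn[of x y "c * d" d] assms by (simp add: Qgrp_def z)
  also have "\<dots> = \<one>\<^bsub>Qgrp c d\<^esub>" by (simp add: Qgrp_def)
  finally have "int (Q.ord z) dvd int (c * d)" using Q.int_pow_eq_id[OF assms(3)] by blast
  then show ?thesis by (simp only: int_dvd_int_iff)
qed

text \<open>An integer \<open>u\<close> with \<open>u \<equiv> 1 (mod d)\<close> and \<open>u \<equiv> 0 (mod c)\<close> acts as the projection of \<open>Z\<^bsub>cd\<^esub>\<close>
  to its \<open>d\<close>-part.\<close>

lemma projection_exponent:
  assumes "coprime c (d::nat)"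
  obtains u :: int where "[u = 1] (mod int d)" "int c dvd u" "coprime u (int d)"
proof -
  obtain u where u: "[u = 1] (mod int d)" "[u = 0] (mod int c)"
    using binary_chinese_remainder_int[of "int d" "int c" 1 0] assms by (auto simp: coprime_commute)
  moreover have "coprime u (int d)" using cong_imp_coprime[OF cong_sym[OF u(1)]] by simp
  ultimately show thesis using that by (simp add: cong_0_iff)
qed

lemma ord_pow_Qgrp_dvd:
  assumes "0 < c" "0 < d" "y \<in> carrier (Qgrp c d)" "int c dvd u"
  shows "group.ord (Qgrp c d) (y [^]\<^bsub>Qgrp c d\<^esub> (u::int)) dvd d"
proof -
  interpret Q: comm_group "Qgrp c d" by (rule comm_group_Qgrp)
  have "int (c * d) dvd u * int d" using assms(4) by simp
  then have "int (Q.ord y) dvd u * int d"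
    using ord_Qgrp_dvd[OF assms(1-3)] by (meson dvd_trans int_dvd_int_iff)
  then have "(y [^]\<^bsub>Qgrp c d\<^esub> u) [^]\<^bsub>Qgrp c d\<^esub> int d = \<one>\<^bsub>Qgrp c d\<^esub>"
    using assms(3) by (simp add: Q.int_pow_pow Q.int_pow_eq_id)
  then show ?thesis using Q.int_pow_eq_id[OF Q.int_pow_closed[OF assms(3)], of u "int d"] by simp
qed

lemma self_lifting_Qgrp:
  assumes "0 < c" "0 < d" "coprime c d" "group G"
  shows "self_lifting (Qgrp c d) G"
  unfolding self_lifting_def
proof (intro ballI allI impI)
  fix h k H assume h: "h \<in> hom (Qgrp c d) G" and k: "k \<in> hom (Qgrp c d) G"
    and H: "subgroup H (Qgrp c d)" and kH: "k ` carrier (Qgrp c d) \<subseteq> h ` H"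
  interpret Q: comm_group "Qgrp c d" by (rule comm_group_Qgrp)
  interpret G: group G by fact
  interpret h: group_hom "Qgrp c d" G h by unfold_locales fact
  have pos: "0 < c * d" using assms by simp
  define a where "a = k (1 mod int (c * d), 0)"
  define b where "b = k (0, 1 mod int d)"
  note * = hom_DirProd_eq_powers[OF \<open>group G\<close> k[unfolded Qgrp_def] pos \<open>0 < d\<close>, folded a_def b_def]
  have "a \<in> k ` carrier (Qgrp c d)" "b \<in> k ` carrier (Qgrp c d)"
    using assms by (auto simp: a_def b_def Qgrp_def carrier_integer_mod_group)
  then obtain x y where x: "x \<in> H" "h x = a" and y: "y \<in> H" "h y = b" using kH by (metis imageE subsetD)
  have xy: "x \<in> carrier (Qgrp c d)" "y \<in> carrier (Qgrp c d)" using x y H subgroup.mem_carrier by metis+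
  obtain u where u: "[u = 1] (mod int d)" "int c dvd u" using projection_exponent[OF assms(3)] by blast
  define y' where "y' = y [^]\<^bsub>Qgrp c d\<^esub> u"
  have y'H: "y' \<in> H" unfolding y'_def using Q.subgroup_int_pow_closed H y(1) by blast
  have y': "y' \<in> carrier (Qgrp c d)" using y'H H subgroup.mem_carrier by metis
  have "h y' = b [^]\<^bsub>G\<^esub> u" unfolding y'_def using h.hom_int_pow xy y by simp
  also have "\<dots> = b [^]\<^bsub>G\<^esub> (1::int)"
  proof -
    have "int (G.ord b) dvd int d" using *(4) by simp
    moreover have "int d dvd 1 - u" using u(1) by (metis cong_iff_dvd_diff cong_sym)
    ultimately show ?thesis using G.int_pow_eq[OF *(2)] dvd_trans by blast
  qed
  finally have hy': "h y' = b" using *(2) by simp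
  have "Q.ord y' dvd d" unfolding y'_def by (rule ord_pow_Qgrp_dvd[OF assms(1,2) xy(2) u(2)])
  then have f: "(\<lambda>(i, j). x [^]\<^bsub>Qgrp c d\<^esub> i \<otimes>\<^bsub>Qgrp c d\<^esub> y' [^]\<^bsub>Qgrp c d\<^esub> j) \<in> hom (Qgrp c d) (Qgrp c d)"
    "(\<lambda>(i, j). x [^]\<^bsub>Qgrp c d\<^esub> i \<otimes>\<^bsub>Qgrp c d\<^esub> y' [^]\<^bsub>Qgrp c d\<^esub> j) ` carrier (Qgrp c d) = Q.span2 x y'"
    using Q.hom_of_powers[OF xy(1) y' pos \<open>0 < d\<close> ord_Qgrp_dvd[OF assms(1,2) xy(1)]]
    by (simp_all add: Qgrp_def)
  show "\<exists>f\<in>hom (Qgrp c d) (Qgrp c d). f ` carrier (Qgrp c d) \<subseteq> H \<and> (\<forall>x\<in>carrier (Qgrp c d). h (f x) = k x)"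
  proof (intro bexI[OF _ f(1)] conjI ballI)
    show "(\<lambda>(i, j). x [^]\<^bsub>Qgrp c d\<^esub> i \<otimes>\<^bsub>Qgrp c d\<^esub> y' [^]\<^bsub>Qgrp c d\<^esub> j) ` carrier (Qgrp c d) \<subseteq> H"
      unfolding f(2) using Q.span2_subset H x(1) y'H by blast
    fix z assume z: "z \<in> carrier (Qgrp c d)"
    obtain i j where ij: "z = (i, j)" by fastforce
    have "k z = a [^]\<^bsub>G\<^esub> i \<otimes>\<^bsub>G\<^esub> b [^]\<^bsub>G\<^esub> j" using *(5) z ij by (simp add: Qgrp_def)
    then show "h ((\<lambda>(i, j). x [^]\<^bsub>Qgrp c d\<^esub> i \<otimes>\<^bsub>Qgrp c d\<^esub> y' [^]\<^bsub>Qgrp c d\<^esub> j) z) = k z"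
      using xy y' x(2) hy' by (simp add: ij h.hom_int_pow)
  qed
qed

lemma images_determine_homs_Qgrp:
  assumes "0 < c" "0 < d" "coprime c d" "group G"
  shows "images_determine_homs (Qgrp c d) G"
  using self_lifting_imp_images_determine_homs[OF comm_group_Qgrp finite_Qgrp[OF assms(1,2)] assms(4)]
    self_lifting_Qgrp[OF assms] by blast

text \<open>A common prime divisor of \<open>g\<close> and \<open>cd / n\<close> would divide the square-free number \<open>d\<close> twice.\<close>

lemma gcd_order_normal_form:
  assumes "squarefree d" "coprime c d" "n dvd c * d" "g dvd n" "g dvd (d::nat)" "0 < n"
  shows "gcd (n * g) (c * d) = n"
proof -
  obtain k where k: "c * d = n * k" using assms(3) by blast
  have "coprime g k"
  proof (rule ccontr)
    assume "\<not> coprime g k"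
    then have "gcd g k \<noteq> 1" using coprime_iff_gcd_eq_1 by blast
    then obtain q where "prime q" "q dvd gcd g k" using prime_factor_nat by blast
    then have q: "prime q" "q dvd g" "q dvd k" by simp_all
    then have "q * q dvd c * d" unfolding k using assms(4) by (meson dvd_trans mult_dvd_mono)
    moreover have "coprime (q * q) c"
      using q assms(2,5) by (meson coprime_commute coprime_divisors coprime_mult_left_iff dvd_refl dvd_trans)
    ultimately have "q ^ 2 dvd d" by (simp add: coprime_dvd_mult_right_iff power2_eq_square)
    then show False using assms(1) q(1) by (auto simp: squarefree_def)
  qed
  then show ?thesis unfolding k by (simp add: gcd_mult_distrib_nat[symmetric])
qed

text \<open>In the normal form \<open>n = ord(x)\<close> and \<open>g = ord(y)\<close> satisfy \<open>g dvd n\<close>, so both can be recovered from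
  the order \<open>ng\<close> of the image.\<close>

lemma hom_image_Qgrp_structure:
  assumes "group G" and K: "K \<in> hom_images (Qgrp c d) G"
    and cd: "0 < c" "0 < d" "coprime c d" "squarefree d"
  shows "Zmn (gcd (card K) (c * d)) (card K div gcd (card K) (c * d))
    \<cong> G\<lparr>carrier := K\<rparr>"
proof -
  let ?A = "G\<lparr>carrier := K\<rparr>"
  have sub: "subgroup K G" using hom_images_subgroup comm_group_Qgrp assms(1) K
    by (metis comm_group.axioms(2))
  interpret A: comm_group ?A by (rule comm_group_hom_image[OF comm_group_Qgrp assms(1) K])
  have pos: "0 < c * d" using cd by simp
  have "K \<in> hom_images (Zmn (c * d) d) ?A"
    using hom_images_restrict_iff[OF sub, where Q = "Qgrp c d"] K by (simp add: Qgrp_def)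
  then obtain a b where ab: "a \<in> carrier ?A" "b \<in> carrier ?A" "A.ord a dvd c * d" "A.ord b dvd d" "K = A.span2 a b"
    using A.hom_images_DirProd_iff[OF pos cd(2)] by blast
  obtain x y where xy: "x \<in> carrier ?A" "y \<in> carrier ?A" "A.ord x dvd c * d" "A.ord y dvd d"
    "A.span2 x y = A.span2 a b" "A.ord y dvd A.ord x"
    and direct: "\<And>(i::int) (j::int). x [^]\<^bsub>?A\<^esub> i \<otimes>\<^bsub>?A\<^esub> y [^]\<^bsub>?A\<^esub> j = \<one>\<^bsub>?A\<^esub> \<Longrightarrow> y [^]\<^bsub>?A\<^esub> j = \<one>\<^bsub>?A\<^esub>"
    using A.span2_normal_form[OF ab(1,2) pos dvd_triv_right cd(4) ab(3,4)] by metis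
  have ord0: "0 < A.ord x" "0 < A.ord y" using xy pos cd by (auto intro: Nat.gr0I)
  have span: "A.span2 x y = K" using xy(5) ab(5) by simp
  have iso: "Zmn (A.ord x) (A.ord y) \<cong> ?A\<lparr>carrier := A.span2 x y\<rparr>"
    using A.iso_direct_span2[OF xy(1,2) ord0 direct] by (rule is_isoI)
  then have "card K = A.ord x * A.ord y"
    using iso_same_card[OF iso] order_Zmn[OF ord0] span by (simp add: order_def)
  moreover from this have "gcd (card K) (c * d) = A.ord x"
    using gcd_order_normal_form[OF cd(4,3) xy(3,6,4) ord0(1)] by simp
  ultimately show ?thesis using iso span ord0 by simp
qed

lemma hom_images_Qgrp_iso_iff_card:
  assumes "group G" "K \<in> hom_images (Qgrp c d) G" "group G'" "K' \<in> hom_images (Qgrp c d) G'"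
    and cd: "0 < c" "0 < d" "coprime c d" "squarefree d"
  shows "G\<lparr>carrier := K\<rparr> \<cong> G'\<lparr>carrier := K'\<rparr> \<longleftrightarrow> card K = card K'"
proof
  assume "card K = card K'"
  moreover note hom_image_Qgrp_structure[OF assms(1,2) cd] hom_image_Qgrp_structure[OF assms(3,4) cd]
  ultimately show "G\<lparr>carrier := K\<rparr> \<cong> G'\<lparr>carrier := K'\<rparr>"
    using group.iso_sym[OF DirProd_group[OF group_integer_mod_group group_integer_mod_group]] iso_trans
    by metis
qed (use iso_same_card in fastforce)

lemma int_subgroup_principal:
  fixes D :: "int set"
  assumes "0 \<in> D" and diff: "\<And>i j. i \<in> D \<Longrightarrow> j \<in> D \<Longrightarrow> i - j \<in> D"
  obtains x where "x \<in> D" "\<And>i. i \<in> D \<Longrightarrow> x dvd i"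
proof -
  have neg: "- i \<in> D" if "i \<in> D" for i using diff[OF assms(1) that] by simp
  have mult: "x * int n \<in> D" if "x \<in> D" for x n
  proof (induction n)
    case (Suc n)
    then show ?case using diff[OF Suc neg[OF that]] by (simp add: algebra_simps)
  qed (use assms in simp)
  have multz: "x * k \<in> D" if "x \<in> D" for x k
    using mult[OF that] neg mult[OF neg[OF that]] by (cases k rule: int_cases2) auto
  show thesis
  proof (cases "\<exists>i\<in>D. 0 < i")
    case False
    then have "i = 0" if "i \<in> D" for i using neg[OF that] that by (metis linorder_neqE neg_0_less_iff_less)
    then show ?thesis using that[of 0] assms by auto
  next
    case True
    define x where "x = (LEAST n. 0 < n \<and> int n \<in> D)"
    have "\<exists>n. 0 < n \<and> int n \<in> D" using True by (metis zero_less_imp_eq_int)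
    then have x: "0 < x" "int x \<in> D" unfolding x_def by (metis (mono_tags, lifting) LeastI)+
    have "int x dvd i" if i: "i \<in> D" for i
    proof (rule ccontr)
      assume "\<not> int x dvd i"
      then have "i mod int x \<noteq> 0" by (metis dvd_eq_mod_eq_0)
      moreover have "0 \<le> i mod int x" "i mod int x < int x" using x(1) by simp_all
      ultimately have r: "0 < i mod int x" "i mod int x < int x" by linarith+
      have "i mod int x = i - int x * (i div int x)" by (simp add: minus_mult_div_eq_mod)
      then have "i mod int x \<in> D" using diff[OF i multz[OF x(2)]] by simp
      then have "0 < nat (i mod int x) \<and> int (nat (i mod int x)) \<in> D" using r by simp
      then have "x \<le> nat (i mod int x)" unfolding x_def by (rule Least_le)
      then show False using r by simp
    qed
    then show ?thesis using that x by blast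
  qed
qed

text \<open>A subgroup \<open>H\<close> is generated by a generator of \<open>H \<inter> (Z\<^bsub>cd\<^esub> \<times> 0)\<close> and an element \<open>b\<close> that
  generates \<open>H\<close> modulo this intersection; as \<open>b\<^sup>d\<close> lies in the intersection, \<open>b\<close> may be replaced by
  its \<open>d\<close>-part.\<close>

lemma subgroup_Qgrp_hom_image:
  assumes H: "subgroup H (Qgrp c d)" and cd: "0 < c" "0 < d" "coprime c d"
  shows "H \<in> hom_images (Qgrp c d) (Qgrp c d)"
proof -
  interpret Q: comm_group "Qgrp c d" by (rule comm_group_Qgrp)
  let ?r = "\<lambda>i j :: int. (i mod int (c * d), j mod int d)"
  have rc: "?r i j \<in> carrier (Qgrp c d)" for i j
    using cd by (simp add: Qgrp_def carrier_integer_mod_group)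
  have rm: "?r i j \<otimes>\<^bsub>Qgrp c d\<^esub> ?r k l = ?r (i + k) (j + l)" for i j k l
    by (simp add: Qgrp_def mod_add_eq)
  have rp: "?r i j [^]\<^bsub>Qgrp c d\<^esub> k = ?r (k * i) (k * j)" for i j and k :: int
    using int_pow_Zmn[of "i mod int (c * d)" "j mod int d" "c * d" d k] cd rc[of i j]
    by (simp add: Qgrp_def mod_mult_right_eq)
  have r_surj: "z = ?r (fst z) (snd z)" if "z \<in> carrier (Qgrp c d)" for z
    using that cd by (auto simp: Qgrp_def carrier_integer_mod_group)
  have diff: "?r (i - k) (j - l) \<in> H" if "?r i j \<in> H" "?r k l \<in> H" for i j k l
  proof -
    have "?r k l [^]\<^bsub>Qgrp c d\<^esub> (- 1 :: int) \<in> H" using Q.subgroup_int_pow_closed[OF H that(2)] .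
    then have "?r (- k) (- l) \<in> H" unfolding rp by simp
    from subgroup.m_closed[OF H that(1) this] show ?thesis unfolding rm by simp
  qed
  have zero: "?r 0 0 \<in> H" using subgroup.one_closed[OF H] by (simp add: Qgrp_def)
  define D1 where "D1 = {i. ?r i 0 \<in> H}"
  define D2 where "D2 = {j. \<exists>i. ?r i j \<in> H}"
  obtain x where x: "x \<in> D1" "\<And>i. i \<in> D1 \<Longrightarrow> x dvd i"
    using int_subgroup_principal[of D1] zero diff[of _ 0 _ 0] by (auto simp: D1_def)
  obtain y where y: "y \<in> D2" "\<And>i. i \<in> D2 \<Longrightarrow> y dvd i"
  proof (rule int_subgroup_principal[of D2])
    show "0 \<in> D2" unfolding D2_def using zero by blast
    show "i - j \<in> D2" if ij: "i \<in> D2" "j \<in> D2" for i j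
    proof -
      obtain i' j' where "?r i' i \<in> H" "?r j' j \<in> H" using ij unfolding D2_def by blast
      from diff[OF this] show ?thesis unfolding D2_def by blast
    qed
  qed (use that in blast)
  obtain w where w: "?r w y \<in> H" using y(1) by (auto simp: D2_def)
  define a where "a = ?r x 0"
  define b where "b = ?r w y"
  have aH: "a \<in> H" and bH: "b \<in> H" using x w by (auto simp: a_def b_def D1_def)
  have ac: "a \<in> carrier (Qgrp c d)" and bc: "b \<in> carrier (Qgrp c d)"
    using rc[of x 0] rc[of w y] by (simp_all only: a_def b_def)
  obtain u where u: "[u = 1] (mod int d)" "int c dvd u" "coprime u (int d)"
    using projection_exponent[OF cd(3)] by blast
  define b' where "b' = b [^]\<^bsub>Qgrp c d\<^esub> u"
  have b'c: "b' \<in> carrier (Qgrp c d)" and b'H: "b' \<in> H"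
    unfolding b'_def using bc Q.subgroup_int_pow_closed[OF H bH] by simp_all
  let ?S = "Q.span2 a b'"
  have S: "subgroup ?S (Qgrp c d)" using Q.subgroup_span2 ac b'c by blast
  have a_pow: "?r i 0 \<in> ?S" if i: "i \<in> D1" for i
  proof -
    obtain k where "i = x * k" using x(2)[OF i] by blast
    then have "?r i 0 = a [^]\<^bsub>Qgrp c d\<^esub> k" unfolding a_def rp by (simp add: mult.commute)
    then show ?thesis using Q.subgroup_int_pow_closed[OF S Q.span2_gens(1)[OF ac b'c]] by simp
  qed
  have "b [^]\<^bsub>Qgrp c d\<^esub> int d = ?r (int d * w) 0" unfolding b_def rp by simp
  moreover from this have "int d * w \<in> D1"
    unfolding D1_def using Q.subgroup_int_pow_closed[OF H bH, of "int d"] by simp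
  ultimately have "b [^]\<^bsub>Qgrp c d\<^esub> int d \<in> ?S" by (simp only: a_pow)
  moreover have "b [^]\<^bsub>Qgrp c d\<^esub> u \<in> ?S" using Q.span2_gens(2)[OF ac b'c] by (simp add: b'_def)
  ultimately have bS: "b \<in> ?S" using Q.subgroup_coprime_pow_mem[OF S bc _ _ u(3)] by blast
  have "H \<subseteq> ?S"
  proof
    fix z assume z: "z \<in> H"
    have z_eq: "z = ?r (fst z) (snd z)" using r_surj z H subgroup.mem_carrier by metis
    then have "snd z \<in> D2" using z unfolding D2_def by (metis (no_types, lifting) mem_Collect_eq)
    then obtain k where k: "snd z = y * k" using y(2) by blast
    have bk: "b [^]\<^bsub>Qgrp c d\<^esub> k = ?r (k * w) (snd z)" unfolding b_def rp k by (simp add: mult.commute)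
    then have "?r (k * w) (snd z) \<in> H" using Q.subgroup_int_pow_closed[OF H bH, of k] by simp
    then have "?r (fst z - k * w) (snd z - snd z) \<in> H" using diff z z_eq by metis
    then have "fst z - k * w \<in> D1" by (simp add: D1_def)
    then have "?r (fst z - k * w) 0 \<otimes>\<^bsub>Qgrp c d\<^esub> b [^]\<^bsub>Qgrp c d\<^esub> k \<in> ?S"
      using a_pow Q.subgroup_int_pow_closed[OF S bS] subgroup.m_closed[OF S] by blast
    then show "z \<in> ?S" unfolding bk rm using z_eq by simp
  qed
  moreover have "?S \<subseteq> H" using Q.span2_subset[OF H aH b'H] .
  moreover have "Q.ord b' dvd d" unfolding b'_def by (rule ord_pow_Qgrp_dvd[OF cd(1,2) bc u(2)])
  ultimately show ?thesis
    using Q.span2_in_hom_images[OF ac b'c _ cd(2) ord_Qgrp_dvd[OF cd(1,2) ac]] cd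
    by (simp add: Qgrp_def subset_antisym)
qed

lemma ex_subgroup_Qgrp:
  assumes cd: "0 < c" "0 < d" and "t dvd l * m" "l dvd c * d" "m dvd d"
  shows "\<exists>H. subgroup H (Qgrp c d) \<and> card H = t"
proof -
  interpret Q: comm_group "Qgrp c d" by (rule comm_group_Qgrp)
  obtain t1 t2 where t: "t = t1 * t2" "t1 dvd l" "t2 dvd m" using division_decomp[OF assms(3)] by blast
  obtain k1 k2 where k: "c * d = t1 * k1" "d = t2 * k2" using t assms by (meson dvd_def dvd_trans)
  have pos: "0 < t1" "0 < t2" "0 < k1" "0 < k2" using k cd by (auto intro: Nat.gr0I)
  define a where "a = (int k1 mod int (c * d), 0 :: int)"
  define b where "b = (0 :: int, int k2 mod int d)"
  have ab: "a \<in> carrier (Qgrp c d)" "b \<in> carrier (Qgrp c d)"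
    using cd by (simp_all add: a_def b_def Qgrp_def carrier_integer_mod_group)
  have ap: "a [^]\<^bsub>Qgrp c d\<^esub> i = (i * int k1 mod int (c * d), 0)" for i :: int
    using int_pow_Zmn[of "fst a" 0 "c * d" d i] ab cd
    by (simp add: a_def Qgrp_def mod_mult_right_eq)
  have bp: "b [^]\<^bsub>Qgrp c d\<^esub> i = (0, i * int k2 mod int d)" for i :: int
    using int_pow_Zmn[of 0 "snd b" "c * d" d i] ab cd
    by (simp add: b_def Qgrp_def mod_mult_right_eq)
  have one: "\<one>\<^bsub>Qgrp c d\<^esub> = (0, 0)" by (simp add: Qgrp_def)
  have oa: "Q.ord a = t1"
  proof -
    have "Q.ord a dvd n \<longleftrightarrow> t1 dvd n" for n
    proof -
      have "Q.ord a dvd n \<longleftrightarrow> a [^]\<^bsub>Qgrp c d\<^esub> int n = \<one>\<^bsub>Qgrp c d\<^esub>"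
        using Q.int_pow_eq_id[OF ab(1), of "int n"] by (simp only: int_dvd_int_iff)
      also have "\<dots> \<longleftrightarrow> int (n * k1) mod int (c * d) = 0" unfolding ap one by simp
      also have "\<dots> \<longleftrightarrow> c * d dvd n * k1" by (simp only: dvd_eq_mod_eq_0[symmetric] int_dvd_int_iff)
      also have "\<dots> \<longleftrightarrow> t1 dvd n" unfolding k(1) using pos by simp
      finally show ?thesis .
    qed
    then show ?thesis by (meson dvd_antisym dvd_refl)
  qed
  have ob: "Q.ord b = t2"
  proof -
    have "Q.ord b dvd n \<longleftrightarrow> t2 dvd n" for n
    proof -
      have "Q.ord b dvd n \<longleftrightarrow> b [^]\<^bsub>Qgrp c d\<^esub> int n = \<one>\<^bsub>Qgrp c d\<^esub>"
        using Q.int_pow_eq_id[OF ab(2), of "int n"] by (simp only: int_dvd_int_iff)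
      also have "\<dots> \<longleftrightarrow> int (n * k2) mod int (d) = 0" unfolding bp one by simp
      also have "\<dots> \<longleftrightarrow> d dvd n * k2" by (simp only: dvd_eq_mod_eq_0[symmetric] int_dvd_int_iff)
      also have "\<dots> \<longleftrightarrow> t2 dvd n" unfolding k(2) using pos by simp
      finally show ?thesis .
    qed
    then show ?thesis by (meson dvd_antisym dvd_refl)
  qed
  have "b [^]\<^bsub>Qgrp c d\<^esub> j = \<one>\<^bsub>Qgrp c d\<^esub>" if "a [^]\<^bsub>Qgrp c d\<^esub> i \<otimes>\<^bsub>Qgrp c d\<^esub> b [^]\<^bsub>Qgrp c d\<^esub> j = \<one>\<^bsub>Qgrp c d\<^esub>" for i j :: int
    using that unfolding ap bp one by (simp add: Qgrp_def)
  then have "Zmn t1 t2 \<cong> Qgrp c d\<lparr>carrier := Q.span2 a b\<rparr>"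
    using Q.iso_direct_span2[OF ab] pos oa ob is_isoI by metis
  then have "card (Q.span2 a b) = t"
    using iso_same_card order_Zmn[OF pos(1,2)] t(1) by (fastforce simp: order_def)
  then show ?thesis using Q.subgroup_span2[OF ab] by blast
qed

text \<open>The choice made in \<open>Hgrp\<close> is harmless, since every subgroup of \<open>Q\<close> is itself an image of \<open>Q\<close> and
  images of the same order are isomorphic.\<close>

lemma iso_Hgrp_iff:
  assumes "group G" and K: "subgroup K G" and cd: "0 < c" "0 < d" "coprime c d" "squarefree d"
    and t: "t dvd l * m" "l dvd c * d" "m dvd d"
  shows "G\<lparr>carrier := K\<rparr> \<cong> Hgrp c d t \<longleftrightarrow> K \<in> hom_images (Qgrp c d) G \<and> card K = t"
proof -
  interpret Q: comm_group "Qgrp c d" by (rule comm_group_Qgrp)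
  interpret G: group G by fact
  define H where "H = (SOME H. subgroup H (Qgrp c d) \<and> card H = t)"
  have H: "subgroup H (Qgrp c d)" "card H = t"
    unfolding H_def using someI_ex[OF ex_subgroup_Qgrp[OF cd(1,2) t]] by blast+
  have Hgrp: "Hgrp c d t = Qgrp c d\<lparr>carrier := H\<rparr>" by (simp add: Hgrp_def H_def)
  have Hi: "H \<in> hom_images (Qgrp c d) (Qgrp c d)" using subgroup_Qgrp_hom_image[OF H(1) cd(1-3)] .
  show ?thesis
  proof
    assume iso: "G\<lparr>carrier := K\<rparr> \<cong> Hgrp c d t"
    then have "Hgrp c d t \<cong> G\<lparr>carrier := K\<rparr>"
      using group.iso_sym[OF subgroup.subgroup_is_group[OF K assms(1)]] by blast
    then obtain f where f: "f \<in> iso (Qgrp c d\<lparr>carrier := H\<rparr>) (G\<lparr>carrier := K\<rparr>)"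
      unfolding Hgrp is_iso_def by blast
    obtain h where h: "h \<in> hom (Qgrp c d) (Qgrp c d)" "H = h ` carrier (Qgrp c d)"
      using Hi by (auto simp: hom_images_def)
    have hH: "h \<in> hom (Qgrp c d) (Qgrp c d\<lparr>carrier := H\<rparr>)" using h by (auto simp: hom_def)
    have fh: "f \<circ> h \<in> hom (Qgrp c d) (G\<lparr>carrier := K\<rparr>)"
      by (rule hom_compose[OF hH]) (use f in \<open>simp add: iso_def\<close>)
    have "f ` H = K" using f by (simp add: iso_def bij_betw_def)
    then have "(f \<circ> h) ` carrier (Qgrp c d) = K" by (simp add: h(2) image_comp)
    then have "K \<in> hom_images (Qgrp c d) (G\<lparr>carrier := K\<rparr>)" using fh unfolding hom_images_def by blast
    moreover have "card K = t" using iso_same_card[OF iso] H(2) by (simp add: Hgrp)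
    ultimately show "K \<in> hom_images (Qgrp c d) G \<and> card K = t"
      using hom_images_restrict_iff[OF K, where Q = "Qgrp c d"] by blast
  next
    assume "K \<in> hom_images (Qgrp c d) G \<and> card K = t"
    then have Ki: "K \<in> hom_images (Qgrp c d) G" and "card K = card H" using H(2) by simp_all
    then show "G\<lparr>carrier := K\<rparr> \<cong> Hgrp c d t"
      unfolding Hgrp using hom_images_Qgrp_iso_iff_card[OF assms(1) Ki Q.is_group Hi cd] by blast
  qed
qed

section \<open>Images in cyclic groups and extensions of cyclic groups\<close>

context comm_group
begin

lemma card_direct_span2:
  assumes "a \<in> carrier G" "b \<in> carrier G" "0 < ord a" "0 < ord b"
    "\<And>(i::int) (j::int). a [^] i \<otimes> b [^] j = \<one> \<Longrightarrow> b [^] j = \<one>"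
  shows "card (span2 a b) = ord a * ord b"
  using iso_same_card[OF is_isoI[OF iso_direct_span2[OF assms]]]
    order_Zmn[OF assms(3,4)] by (simp add: order_def)

text \<open>By Lagrange's theorem a subgroup of order \<open>r\<close> consists of solutions of \<open>z\<^sup>r = 1\<close>, and a cyclic group
  whose order is a multiple of \<open>r\<close> has only \<open>r\<close> of them.\<close>

lemma hom_images_cyclic:
  assumes fin: "finite (carrier G)" and g: "g \<in> carrier G" "carrier G = range (\<lambda>i::nat. g [^] i)"
    and cd: "0 < c" "0 < d"
  shows "r dvd gcd (c * d) (order G) \<Longrightarrow>
      {z \<in> carrier G. z [^] r = \<one>} \<in> hom_images (Qgrp c d) G \<and> card {z \<in> carrier G. z [^] r = \<one>} = r"
    and "K \<in> hom_images (Qgrp c d) G \<Longrightarrow>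
      card K dvd gcd (c * d) (order G) \<and> K = {z \<in> carrier G. z [^] card K = \<one>}"
proof -
  define N where "N = order G"
  have N0: "0 < N" using fin order_gt_0_iff_finite by (simp add: N_def)
  have ordg: "ord g = N"
  proof -
    have "carrier G = generate G {g}"
    proof
      show "carrier G \<subseteq> generate G {g}"
        using g generate_pow_nat[OF g(1)] finite_cyclic_subgroup_order
        by (auto simp: generate_pow[OF g(1)] int_pow_int intro!: exI[of _ "int _"])
      show "generate G {g} \<subseteq> carrier G" using generate_incl g by simp
    qed
    then show ?thesis using generate_pow_card[OF g(1)] by (simp add: N_def order_def)
  qed
  have root: "{z \<in> carrier G. z [^] r = \<one>} = span2 (g [^] (N div r)) \<one>" "ord (g [^] (N div r)) = r"
    "card (span2 (g [^] (N div r)) \<one>) = r" if r: "r dvd N" for r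
  proof -
    obtain k where k: "N = r * k" using r by blast
    have pos: "0 < r" "0 < k" using N0 k by auto
    have x: "g [^] k \<in> carrier G" using g by simp
    show ord: "ord (g [^] (N div r)) = r" using ord_pow[OF g(1), of k] ordg k pos by simp
    show "{z \<in> carrier G. z [^] r = \<one>} = span2 (g [^] (N div r)) \<one>"
    proof (intro equalityI subsetI)
      fix z assume z: "z \<in> {z \<in> carrier G. z [^] r = \<one>}"
      then have "z \<in> carrier G" by simp
      then obtain i :: nat where i: "z = g [^] i" unfolding g(2) by blast
      have "g [^] (i * r) = \<one>" using z g i by (simp add: nat_pow_pow)
      then have "r * k dvd i * r" using pow_eq_id[OF g(1)] ordg k by simp
      then have "k dvd i" using pos by (simp add: mult.commute)
      then obtain j where "i = k * j" by blast
      then have "z = (g [^] k) [^] int j \<otimes> \<one> [^] (0::int)"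
        using i g by (simp add: nat_pow_pow int_pow_int)
      then show "z \<in> span2 (g [^] (N div r)) \<one>" unfolding span2_def using k pos by auto
    next
      fix z assume "z \<in> span2 (g [^] (N div r)) \<one>"
      then obtain i :: int where z: "z = (g [^] k) [^] i" unfolding span2_def using k pos x by auto
      have "z [^] int r = (g [^] k) [^] (int r * i)" unfolding z using x by (simp add: int_pow_pow mult.commute)
      also have "\<dots> = \<one>" using int_pow_eq_id[OF x] ord k pos by simp
      finally show "z \<in> {z \<in> carrier G. z [^] r = \<one>}" using z x by (simp add: int_pow_int)
    qed
    have "card (span2 (g [^] k) \<one>) = ord (g [^] k) * ord \<one>"
      by (rule card_direct_span2) (use x ord k pos in auto)
    then show "card (span2 (g [^] (N div r)) \<one>) = r" using ord k pos by simp
  qed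
  show "{z \<in> carrier G. z [^] r = \<one>} \<in> hom_images (Qgrp c d) G \<and> card {z \<in> carrier G. z [^] r = \<one>} = r"
    if "r dvd gcd (c * d) (order G)"
  proof -
    have r: "r dvd c * d" "r dvd N" using that by (simp_all add: N_def)
    have "span2 (g [^] (N div r)) \<one> \<in> hom_images (Qgrp c d) G"
      unfolding Qgrp_def by (rule span2_in_hom_images) (use r root(2)[OF r(2)] g cd in auto)
    then show ?thesis using root[OF r(2)] by simp
  qed
  show "card K dvd gcd (c * d) (order G) \<and> K = {z \<in> carrier G. z [^] card K = \<one>}"
    if K: "K \<in> hom_images (Qgrp c d) G"
  proof -
    define r where "r = card K"
    have sub: "subgroup K G"
      using hom_images_subgroup[OF comm_group.axioms(2)[OF comm_group_Qgrp] is_group K] .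
    have rN: "r dvd N" using lagrange[OF sub] unfolding N_def r_def by (metis dvd_triv_right)
    have "K \<subseteq> {z \<in> carrier G. z [^] r = \<one>}"
    proof
      fix z assume z: "z \<in> K"
      interpret K: group "G\<lparr>carrier := K\<rparr>" by (rule subgroup.subgroup_is_group[OF sub is_group])
      have "z [^]\<^bsub>G\<lparr>carrier := K\<rparr>\<^esub> order (G\<lparr>carrier := K\<rparr>) = \<one>" using K.pow_order_eq_1[of z] z by simp
      then show "z \<in> {z \<in> carrier G. z [^] r = \<one>}"
        using z subgroup.mem_carrier[OF sub] by (simp add: order_def r_def nat_pow_consistent[symmetric])
    qed
    moreover have "card {z \<in> carrier G. z [^] r = \<one>} = card K" using root[OF rN] by (simp add: r_def)
    ultimately have eq: "K = {z \<in> carrier G. z [^] r = \<one>}"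
      using fin by (intro card_subset_eq) auto
    obtain a b where ab: "a \<in> carrier G" "b \<in> carrier G" "ord a dvd c * d" "ord b dvd d" "K = span2 a b"
      using hom_images_DirProd_iff[of "c * d" d K] K cd by (auto simp: Qgrp_def)
    have x: "g [^] (N div r) \<in> K" unfolding eq root(1)[OF rN] by (rule span2_gens(1)[OF nat_pow_closed[OF g(1)] one_closed])
    then obtain i j :: int where ij: "g [^] (N div r) = a [^] i \<otimes> b [^] j"
      unfolding ab(5) span2_def by auto
    have "a [^] (int (c * d) * i) = \<one>" "b [^] (int (c * d) * j) = \<one>"
    proof -
      have "int (ord a) dvd int (c * d)" "int (ord b) dvd int (c * d)"
        using ab(3,4) dvd_mult by (simp_all only: int_dvd_int_iff)
      then show "a [^] (int (c * d) * i) = \<one>" "b [^] (int (c * d) * j) = \<one>"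
        
        unfolding int_pow_eq_id[OF ab(1)] int_pow_eq_id[OF ab(2)] by (simp_all only: dvd_mult2)
    qed
    then have "(g [^] (N div r)) [^] int (c * d) = \<one>"
      unfolding ij using ab by (simp add: int_pow_distrib int_pow_pow mult.commute)
    then have "int r dvd int (c * d)" using int_pow_eq_id root(2)[OF rN] g by (metis nat_pow_closed)
    then have "r dvd c * d" by (simp only: int_dvd_int_iff)
    then have "r dvd gcd (c * d) (order G)" using rN[unfolded N_def] by (rule gcd_greatest)
    then show ?thesis using eq unfolding r_def by blast
  qed
qed

lemma card_hom_images_cyclic:
  assumes "finite (carrier G)" "g \<in> carrier G" "carrier G = range (\<lambda>i::nat. g [^] i)" "0 < c" "0 < d"
  shows "card (hom_images (Qgrp c d) G) = tau (gcd (c * d) (order G))"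
proof -
  note * = hom_images_cyclic[OF assms]
  have "bij_betw card (hom_images (Qgrp c d) G) {r. r dvd gcd (c * d) (order G)}"
  proof (intro bij_betw_imageI inj_onI)
    fix K K' assume K: "K \<in> hom_images (Qgrp c d) G" "K' \<in> hom_images (Qgrp c d) G" "card K = card K'"
    show "K = K'" using *(2)[OF K(1)] *(2)[OF K(2)] K(3) by metis
  next
    have "r \<in> card ` hom_images (Qgrp c d) G" if "r dvd gcd (c * d) (order G)" for r
      using *(1)[OF that] by force
    then show "card ` hom_images (Qgrp c d) G = {r. r dvd gcd (c * d) (order G)}" using *(2) by blast
  qed
  then show ?thesis by (simp add: tau_def bij_betw_same_card)
qed

lemma card_conj_classes_hom_images:
  assumes "group Q"
  shows "card (hom_images Q G // conj_rel G) = card (hom_images Q G)"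
proof -
  have "hom_images Q G // conj_rel G = (\<lambda>K. conj_rel G `` {K}) ` hom_images Q G"
    by (auto simp: quotient_def)
  moreover have "inj_on (\<lambda>K. conj_rel G `` {K}) (hom_images Q G)"
  proof (rule inj_onI)
    fix K K' assume K: "K \<in> hom_images Q G" "K' \<in> hom_images Q G"
      "conj_rel G `` {K} = conj_rel G `` {K'}"
    note sub = hom_images_subgroup[OF assms is_group K(1)] hom_images_subgroup[OF assms is_group K(2)]
    obtain g where g: "g \<in> carrier G" "K' = conjugation G g ` K"
      using K(3) conj_class_eq_iff[OF sub] conj_rel_iff[OF sub(1)] by blast
    have "conjugation G g ` K = id ` K"
    proof (rule image_cong)
      fix k assume "k \<in> K"
      then have "k \<in> carrier G" using subgroup.mem_carrier[OF sub(1)] by simp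
      then show "g \<otimes> k \<otimes> inv g = id k" using g(1) by (simp add: m_comm[of g k] m_assoc)
    qed simp
    then show "K = K'" using g(2) by simp
  qed
  ultimately show ?thesis by (simp add: card_image)
qed

end

text \<open>The hypotheses make \<open>M\<close> a copy of the endomorphism monoid of \<open>P\<close>. This serves for the residues
  modulo \<open>n\<close> acting on a cyclic group and for the matrices modulo \<open>p\<close> acting on \<open>Z\<^sub>p \<times> Z\<^sub>p\<close>.\<close>

lemma units_of_iso_AutoGroup:
  assumes "monoid M" "group P"
    and act: "\<And>x. x \<in> carrier M \<Longrightarrow> act x \<in> hom P P"
    and mult: "\<And>x y z. x \<in> carrier M \<Longrightarrow> y \<in> carrier M \<Longrightarrow> z \<in> carrier P \<Longrightarrow>
      act (x \<otimes>\<^bsub>M\<^esub> y) z = act x (act y z)"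
    and one: "\<And>z. z \<in> carrier P \<Longrightarrow> act \<one>\<^bsub>M\<^esub> z = z"
    and faithful: "\<And>x y. x \<in> carrier M \<Longrightarrow> y \<in> carrier M \<Longrightarrow>
      (\<And>z. z \<in> carrier P \<Longrightarrow> act x z = act y z) \<Longrightarrow> x = y"
    and onto: "\<And>\<phi>. \<phi> \<in> hom P P \<Longrightarrow> \<exists>x\<in>carrier M. \<forall>z\<in>carrier P. \<phi> z = act x z"
  shows "(\<lambda>x. \<lambda>z\<in>carrier P. act x z) \<in> iso (units_of M) (AutoGroup P)"
proof -
  interpret M: monoid M by fact
  interpret P: group P by fact
  interpret Aut: group "AutoGroup P" by (rule P.AutoGroup)
  let ?U = "units_of M" and ?\<Psi> = "\<lambda>x. \<lambda>z\<in>carrier P. act x z"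
  have closed: "act x z \<in> carrier P" if "x \<in> carrier M" "z \<in> carrier P" for x z
    using hom_in_carrier[OF act] that by blast
  have auto: "?\<Psi> x \<in> auto P" if x: "x \<in> Units M" for x
  proof -
    obtain y where y: "y \<in> carrier M" "y \<otimes>\<^bsub>M\<^esub> x = \<one>\<^bsub>M\<^esub>" "x \<otimes>\<^bsub>M\<^esub> y = \<one>\<^bsub>M\<^esub>"
      using x unfolding Units_def by blast
    have xM: "x \<in> carrier M" using x by (rule M.Units_closed)
    have "act y (act x z) = z" "act x (act y z) = z" if "z \<in> carrier P" for z
      using mult[OF y(1) xM that] mult[OF xM y(1) that] one[OF that] y by simp_all
    then have "bij_betw (act x) (carrier P) (carrier P)"
      by (intro bij_betwI[where g = "act y"]) (use closed xM y(1) in blast)+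
    moreover have "?\<Psi> x \<in> hom P P" using act[OF xM] by (auto simp: hom_def)
    ultimately show ?thesis by (simp add: auto_def Bij_def)
  qed
  have cU: "carrier ?U = Units M" by (rule units_of_carrier)
  have hom: "?\<Psi> \<in> hom ?U (AutoGroup P)"
  proof (rule homI)
    fix x y assume "x \<in> carrier ?U" "y \<in> carrier ?U"
    then have xy: "x \<in> Units M" "y \<in> Units M" by (simp_all add: cU)
    have "?\<Psi> (x \<otimes>\<^bsub>?U\<^esub> y) = compose (carrier P) (?\<Psi> x) (?\<Psi> y)"
      unfolding compose_def by (rule restrict_ext) (use xy mult closed M.Units_closed in \<open>simp add: units_of_mult\<close>)
    then show "?\<Psi> (x \<otimes>\<^bsub>?U\<^esub> y) = ?\<Psi> x \<otimes>\<^bsub>AutoGroup P\<^esub> ?\<Psi> y"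
      using auto_compose_eq[OF auto[OF xy(1)] auto[OF xy(2)]] by simp
  qed (use auto in \<open>simp add: AutoGroup_def cU\<close>)
  have "inj_on ?\<Psi> (carrier ?U)"
  proof (rule inj_onI)
    fix x y assume xy: "x \<in> carrier ?U" "y \<in> carrier ?U" "?\<Psi> x = ?\<Psi> y"
    have "act x z = act y z" if "z \<in> carrier P" for z
      using fun_cong[OF xy(3), of z] that by simp
    then show "x = y" using faithful xy(1,2) M.Units_closed unfolding cU by blast
  qed
  moreover have "carrier (AutoGroup P) \<subseteq> ?\<Psi> ` carrier ?U"
  proof
    fix \<phi> assume \<phi>: "\<phi> \<in> carrier (AutoGroup P)"
    define \<psi> where "\<psi> = inv\<^bsub>AutoGroup P\<^esub> \<phi>"
    have \<psi>: "\<psi> \<in> carrier (AutoGroup P)" using \<phi> by (simp add: \<psi>_def)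
    have au: "\<phi> \<in> auto P" "\<psi> \<in> auto P" using \<phi> \<psi> by (simp_all add: AutoGroup_def)
    have comp: "compose (carrier P) \<phi> \<psi> = (\<lambda>z\<in>carrier P. z)" "compose (carrier P) \<psi> \<phi> = (\<lambda>z\<in>carrier P. z)"
      using Aut.r_inv[OF \<phi>] Aut.l_inv[OF \<phi>] auto_compose_eq[OF au] auto_compose_eq[OF au(2,1)]
      by (simp_all add: \<psi>_def) (simp_all add: AutoGroup_def BijGroup_def)
    have "\<phi> \<in> hom P P" "\<psi> \<in> hom P P" using au by (simp_all add: auto_def)
    then obtain x y where x: "x \<in> carrier M" "\<And>z. z \<in> carrier P \<Longrightarrow> \<phi> z = act x z"
      and y: "y \<in> carrier M" "\<And>z. z \<in> carrier P \<Longrightarrow> \<psi> z = act y z" using onto by metis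
    have "act x (act y z) = z" "act y (act x z) = z" if z: "z \<in> carrier P" for z
      using fun_cong[OF comp(1), of z] fun_cong[OF comp(2), of z] z x(2) y(2) closed[OF x(1) z] closed[OF y(1) z]
      by (simp_all add: compose_def)
    then have "x \<otimes>\<^bsub>M\<^esub> y = \<one>\<^bsub>M\<^esub>" "y \<otimes>\<^bsub>M\<^esub> x = \<one>\<^bsub>M\<^esub>"
      using mult[OF x(1) y(1)] mult[OF y(1) x(1)] one x(1) y(1) by (auto intro!: faithful)
    then have "x \<in> carrier ?U" using x(1) y(1) unfolding cU Units_def by blast
    moreover have "\<phi> = ?\<Psi> x"
      by (rule extensionalityI[where A = "carrier P"]) (use au x(2) in \<open>auto simp: auto_def Bij_def\<close>)
    ultimately show "\<phi> \<in> ?\<Psi> ` carrier ?U" by blast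
  qed
  ultimately show ?thesis using hom hom_carrier[OF hom] by (simp add: iso_def bij_betw_def subset_antisym)
qed

lemma units_residue_ring:
  assumes "1 < n"
  shows "comm_group (units_of (residue_ring (int n)))"
    and "carrier (units_of (residue_ring (int n))) = {x. 0 < x \<and> x < int n \<and> coprime x (int n)}"
proof -
  interpret R: residues "int n" "residue_ring (int n)" using assms by unfold_locales simp_all
  interpret R: cring "residue_ring (int n)" by (rule R.cring)
  show "comm_group (units_of (residue_ring (int n)))" by (rule R.units_comm_group)
  show "carrier (units_of (residue_ring (int n))) = {x. 0 < x \<and> x < int n \<and> coprime x (int n)}"
    by (simp add: units_of_carrier R.res_units_eq)
qed

lemma units_residue_ring_simps [simp]:
  "x \<otimes>\<^bsub>units_of (residue_ring n)\<^esub> y = x * y mod n"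
  "\<one>\<^bsub>units_of (residue_ring n)\<^esub> = 1"
  by (simp_all add: units_of_def residue_ring_def)

lemma order_units_residue_ring:
  assumes "1 < n"
  shows "order (units_of (residue_ring (int n))) = totient n" "finite (carrier (units_of (residue_ring (int n))))"
proof -
  have eq: "carrier (units_of (residue_ring (int n))) = int ` totatives n"
  proof (intro equalityI subsetI)
    fix x assume "x \<in> carrier (units_of (residue_ring (int n)))"
    then have "0 < x" "x < int n" "coprime x (int n)" using units_residue_ring(2)[OF assms] by auto
    then have "nat x \<in> totatives n" "x = int (nat x)"
      by (auto simp: totatives_def nat_le_iff simp flip: coprime_int_iff)
    then show "x \<in> int ` totatives n" by blast
  next
    fix x assume "x \<in> int ` totatives n"
    then show "x \<in> carrier (units_of (residue_ring (int n)))"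
      using units_residue_ring(2)[OF assms] totatives_less[of _ n] assms by (auto simp: totatives_def)
  qed
  show "finite (carrier (units_of (residue_ring (int n))))" unfolding eq by simp
  show "order (units_of (residue_ring (int n))) = totient n"
    unfolding order_def eq by (simp add: card_image totient_def)
qed

lemma units_residue_ring_iso_AutoGroup:
  assumes "1 < n"
  shows "(\<lambda>u. \<lambda>x\<in>carrier (integer_mod_group n). u * x mod int n)
    \<in> iso (units_of (residue_ring (int n))) (AutoGroup (integer_mod_group n))"
proof (rule units_of_iso_AutoGroup)
  let ?Z = "integer_mod_group n"
  interpret R: residues "int n" "residue_ring (int n)" using assms by unfold_locales simp_all
  have cZ: "carrier ?Z = {0..<int n}" using assms by (simp add: carrier_integer_mod_group)
  have one: "(1::int) \<in> carrier ?Z" using assms by (simp add: cZ)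
  show "monoid (residue_ring (int n))" using R.comm_monoid by (rule comm_monoid.axioms(1))
  show "(\<lambda>x. u * x mod int n) \<in> hom ?Z ?Z" for u
    by (rule homI) (use assms in \<open>auto simp: cZ distrib_left mod_add_eq mod_mult_right_eq\<close>)
  show "(u \<otimes>\<^bsub>residue_ring (int n)\<^esub> v) * x mod int n = u * (v * x mod int n) mod int n" for u v x
    by (simp add: R.res_mult_eq mod_mult_left_eq mod_mult_right_eq mult.assoc)
  show "\<one>\<^bsub>residue_ring (int n)\<^esub> * x mod int n = x" if "x \<in> carrier ?Z" for x
    using that by (simp add: R.res_one_eq cZ)
  show "u = v" if "u \<in> carrier (residue_ring (int n))" "v \<in> carrier (residue_ring (int n))"
    "\<And>x. x \<in> carrier ?Z \<Longrightarrow> u * x mod int n = v * x mod int n" for u v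
    using that(3)[OF one] that(1,2) by (simp add: R.res_carrier_eq)
  show "\<exists>u\<in>carrier (residue_ring (int n)). \<forall>x\<in>carrier ?Z. \<phi> x = u * x mod int n" if \<phi>: "\<phi> \<in> hom ?Z ?Z" for \<phi>
  proof (intro bexI ballI)
    interpret \<phi>: group_hom ?Z ?Z \<phi> by (simp add: group_hom_def group_hom_axioms_def \<phi>)
    show "\<phi> 1 \<in> carrier (residue_ring (int n))" using \<phi>.hom_closed[OF one] by (simp add: cZ R.res_carrier_eq)
    fix x assume "x \<in> carrier ?Z"
    then have "x = 1 [^]\<^bsub>?Z\<^esub> x" by (simp add: cZ int_pow_integer_mod_group)
    then have "\<phi> x = \<phi> 1 [^]\<^bsub>?Z\<^esub> x" using \<phi>.hom_int_pow[OF one, of x] by simp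
    then show "\<phi> x = \<phi> 1 * x mod int n" by (simp add: int_pow_integer_mod_group mult.commute)
  qed
qed simp

text \<open>For odd \<open>p\<close> a primitive root generates the group of units. For \<open>p = 2\<close> the group of units is a
  \<open>2\<close>-group, whereas images of \<open>Q\<close> have odd order.\<close>

lemma card_hom_images_units_prime_power:
  assumes p: "prime p" and \<alpha>: "0 < \<alpha>" and cd: "0 < c" "0 < d" "odd c" "odd d" "\<not> p dvd c * d"
  shows "card (hom_images (Qgrp c d) (units_of (residue_ring (int (p ^ \<alpha>))))) = tau (gcd (c * d) (p - 1))"
proof -
  define n where "n = p ^ \<alpha>"
  have n1: "1 < n" unfolding n_def using p \<alpha> prime_gt_1_nat one_less_power by blast
  let ?U = "units_of (residue_ring (int n))"
  interpret U: comm_group ?U by (rule units_residue_ring[OF n1])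
  have ordU: "order ?U = p ^ (\<alpha> - 1) * (p - 1)"
    using order_units_residue_ring[OF n1] totient_prime_power[OF p \<alpha>] by (simp add: n_def)
  have cop: "coprime (c * d) (p ^ (\<alpha> - 1))"
    using prime_imp_coprime[OF p cd(5)] by (simp add: coprime_commute)
  have gcd: "gcd (c * d) (order ?U) = gcd (c * d) (p - 1)"
    unfolding ordU by (rule gcd_mult_right_left_cancel[OF cop])
  have "card (hom_images (Qgrp c d) ?U) = tau (gcd (c * d) (p - 1))"
  proof (cases "odd p")
    case True
    obtain g where g: "residue_primroot n g"
      using residue_primroot_odd_prime_power_exists[OF p True] \<alpha> unfolding n_def by blast
    have bij: "bij_betw (\<lambda>i. g ^ i mod n) {..<totient n} (totatives n)"
      by (rule residue_primroot_is_generator[OF n1 g])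
    define h where "h = int (g mod n)"
    have "coprime n g" using g by (simp add: residue_primroot_def)
    then have h: "h \<in> carrier ?U"
    proof -
      have c1: "coprime (g mod n) n"
        using \<open>coprime n g\<close> n1 by (metis coprime_commute coprime_mod_left_iff not_less_zero)
      then have "coprime (int (g mod n)) (int n)" by (simp only: coprime_int_iff)
      moreover have "g mod n \<noteq> 0"
      proof
        assume "g mod n = 0"
        then have "coprime 0 n" using c1 by simp
        then show False using n1 by simp
      qed
      ultimately show ?thesis using units_residue_ring(2)[OF n1] n1 by (simp add: h_def)
    qed
    have pow: "h [^]\<^bsub>?U\<^esub> i = int (g ^ i mod n)" for i :: nat
    proof (induction i)
      case (Suc i)
      then show ?case by (simp add: h_def flip: of_nat_mult of_nat_mod) (simp add: mod_simps mult.commute)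
    qed (use n1 in simp)
    have "carrier ?U \<subseteq> range (\<lambda>i::nat. h [^]\<^bsub>?U\<^esub> i)"
    proof
      fix x assume "x \<in> carrier ?U"
      then have x: "0 < x" "x < int n" "coprime x (int n)" using units_residue_ring(2)[OF n1] by auto
      then have "nat x \<in> totatives n" by (auto simp: totatives_def nat_le_iff simp flip: coprime_int_iff)
      then obtain i where "nat x = g ^ i mod n" using bij by (auto simp: bij_betw_def image_iff)
      then have "x = h [^]\<^bsub>?U\<^esub> i" using x pow by simp
      then show "x \<in> range (\<lambda>i::nat. h [^]\<^bsub>?U\<^esub> i)" by blast
    qed
    moreover have "range (\<lambda>i::nat. h [^]\<^bsub>?U\<^esub> i) \<subseteq> carrier ?U" using h by auto
    ultimately show ?thesis
      using U.card_hom_images_cyclic[OF order_units_residue_ring(2)[OF n1] h _ cd(1,2)] gcd by simp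
  next
    case False
    then have p2: "p = 2" using p primes_dvd_imp_eq two_is_prime_nat by blast
    have "K = {\<one>\<^bsub>?U\<^esub>}" if K: "K \<in> hom_images (Qgrp c d) ?U" for K
    proof -
      have sub: "subgroup K ?U"
        using hom_images_subgroup[OF comm_group.axioms(2)[OF comm_group_Qgrp] U.is_group K] .
      have "card K dvd c * d * d"
        using card_hom_image_dvd[OF comm_group_Qgrp U.is_group K] order_Qgrp cd by simp
      moreover have "card K dvd 2 ^ (\<alpha> - 1)" using U.lagrange[OF sub] ordU p2 by (metis dvd_triv_right diff_add_inverse2 mult.right_neutral one_add_one)
      moreover have "coprime (c * d * d) (2 ^ (\<alpha> - 1))" using cd by simp
      ultimately have "card K = 1" by (metis coprime_common_divisor_nat)
      then obtain x where "K = {x}" using card_1_singletonE by blast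
      then show ?thesis using subgroup.one_closed[OF sub] by simp
    qed
    moreover have "{\<one>\<^bsub>?U\<^esub>} \<in> hom_images (Qgrp c d) ?U"
    proof -
      interpret Q: comm_group "Qgrp c d" by (rule comm_group_Qgrp)
      have "(\<lambda>_. \<one>\<^bsub>?U\<^esub>) \<in> hom (Qgrp c d) ?U" using U.one_closed U.l_one by (intro homI) auto
      moreover have "(\<lambda>_. \<one>\<^bsub>?U\<^esub>) ` carrier (Qgrp c d) = {\<one>\<^bsub>?U\<^esub>}" using Q.one_closed by auto
      ultimately show ?thesis unfolding hom_images_def by (metis (mono_tags, lifting) mem_Collect_eq)
    qed
    ultimately have "hom_images (Qgrp c d) ?U = {{\<one>\<^bsub>?U\<^esub>}}" by blast
    then show ?thesis using p2 by (simp add: tau_def)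
  qed
  then show ?thesis by (simp add: n_def)
qed

lemma order_integer_mod_group: "0 < n \<Longrightarrow> order (integer_mod_group n) = n"
  by (simp add: order_def carrier_integer_mod_group)

theorem num_iso_classes_cyclic_by_Qgrp:
  assumes p: "prime p" and \<alpha>: "0 < \<alpha>" and cd: "0 < c" "0 < d" "odd c" "odd d" "\<not> p dvd c * d" "coprime c d"
  shows "num_iso_classes (split_extensions (integer_mod_group (p ^ \<alpha>)) (Qgrp c d)) = tau (gcd (c * d) (p - 1))"
proof -
  have n1: "1 < p ^ \<alpha>" using p \<alpha> prime_gt_1_nat one_less_power by blast
  interpret U: comm_group "units_of (residue_ring (int (p ^ \<alpha>)))" by (rule units_residue_ring[OF n1])
  have "coprime (order (integer_mod_group (p ^ \<alpha>))) (order (Qgrp c d))"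
  proof -
    have "coprime p (c * d * d)"
      using prime_imp_coprime[OF p cd(5)] by (simp add: coprime_mult_right_iff)
    then have "coprime (p ^ \<alpha>) (c * d * d)" by simp
    moreover have "0 < p ^ \<alpha>" using prime_gt_0_nat[OF p] by simp
    ultimately show ?thesis using cd by (simp only: order_Qgrp order_integer_mod_group)
  qed
  moreover have "finite (carrier (integer_mod_group (p ^ \<alpha>)))"
    using prime_gt_0_nat[OF p] by (simp add: carrier_integer_mod_group)
  moreover have "group (AutoGroup (integer_mod_group (p ^ \<alpha>)))" by (simp add: group.AutoGroup)
  ultimately have "num_iso_classes (split_extensions (integer_mod_group (p ^ \<alpha>)) (Qgrp c d))
    = card (hom_images (Qgrp c d) (units_of (residue_ring (int (p ^ \<alpha>))))
        // conj_rel (units_of (residue_ring (int (p ^ \<alpha>)))))"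
    using num_iso_classes_split_extensions[OF abelian_integer_mod_group comm_group_Qgrp _ finite_Qgrp[OF cd(1,2)] _
      images_determine_homs_Qgrp[OF cd(1,2,6)] U.is_group units_residue_ring_iso_AutoGroup[OF n1]]
    by blast
  then show ?thesis
    using U.card_conj_classes_hom_images[OF comm_group.axioms(2)[OF comm_group_Qgrp]]
      card_hom_images_units_prime_power[OF p \<alpha> cd(1-5)] by simp
qed

section \<open>The group \<open>GL(2,p)\<close>\<close>

definition smat :: "int \<Rightarrow> int \<Rightarrow> int \<Rightarrow> int \<Rightarrow> int ^ 2 ^ 2" where
  "smat a b c d = (\<chi> i j. if i = 1 then (if j = 1 then a else b) else (if j = 1 then c else d))"

lemma smat_entries [simp]:
  "smat a b c d $ 1 $ 1 = a" "smat a b c d $ 1 $ 2 = b"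
  "smat a b c d $ 2 $ 1 = c" "smat a b c d $ 2 $ 2 = d"
  by (simp_all add: smat_def)

lemma smat_collapse: "smat (A $ 1 $ 1) (A $ 1 $ 2) (A $ 2 $ 1) (A $ 2 $ 2) = A"
  by (simp add: vec_eq_iff forall_2)

lemma smat_eq_iff [simp]:
  "smat a b c d = smat a' b' c' d' \<longleftrightarrow> a = a' \<and> b = b' \<and> c = c' \<and> d = d'"
  by (auto simp: vec_eq_iff forall_2)

lemma smat_cases: obtains a b c d where "A = smat a b c d"
  using smat_collapse by metis

lemma smat_mult: "smat a b c d ** smat a' b' c' d' =
    smat (a * a' + b * c') (a * b' + b * d') (c * a' + d * c') (c * b' + d * d')"
  by (simp add: vec_eq_iff forall_2 matrix_matrix_mult_def sum_2)

lemma smat_vec: "(smat a b c d *v v) $ 1 = a * v $ 1 + b * v $ 2" "(smat a b c d *v v) $ 2 = c * v $ 1 + d * v $ 2"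
  by (simp_all add: matrix_vector_mult_def sum_2)

lemma smat_one: "mat 1 = smat 1 0 0 1"
  by (simp add: vec_eq_iff forall_2 mat_def)

lemma mat_red_smat: "mat_red p (smat a b c d) = smat (a mod int p) (b mod int p) (c mod int p) (d mod int p)"
  by (simp add: vec_eq_iff forall_2 mat_red_def)

lemma smat_in_mat2 [simp]: "smat a b c d \<in> carrier (mat2 p) \<longleftrightarrow>
    a \<in> {0..<int p} \<and> b \<in> {0..<int p} \<and> c \<in> {0..<int p} \<and> d \<in> {0..<int p}"
  by (auto simp: mat2_def forall_2)

lemma mat_red_eq_iff: "mat_red p (smat a b c d) = mat_red p (smat a' b' c' d') \<longleftrightarrow>
    int p dvd a - a' \<and> int p dvd b - b' \<and> int p dvd c - c' \<and> int p dvd d - d'"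
  by (simp add: mat_red_smat mod_eq_dvd_iff)

lemma mod_linear:
  fixes a b x y n :: int
  shows "(a mod n * x + b mod n * y) mod n = (a * x + b * y) mod n"
    and "(x * (a mod n) + y * (b mod n)) mod n = (x * a + y * b) mod n"
  by (metis mod_add_eq mod_mult_left_eq, metis mod_add_eq mod_mult_right_eq)

lemma mat_red_mult:
  "mat_red p (mat_red p A ** B) = mat_red p (A ** B)"
  "mat_red p (A ** mat_red p B) = mat_red p (A ** B)"
proof -
  obtain a b c d where A: "A = smat a b c d" by (rule smat_cases)
  obtain a' b' c' d' where B: "B = smat a' b' c' d'" by (rule smat_cases)
  show "mat_red p (mat_red p A ** B) = mat_red p (A ** B)" "mat_red p (A ** mat_red p B) = mat_red p (A ** B)"
    by (simp_all only: A B smat_mult mat_red_smat mod_linear)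
qed

lemma mat2_mult: "A \<otimes>\<^bsub>mat2 p\<^esub> B = mat_red p (A ** B)"
  by (simp add: mat2_def)

lemma mat2_one: "\<one>\<^bsub>mat2 p\<^esub> = smat 1 0 0 1"
  by (simp add: mat2_def smat_one)

lemma mat_red_id: "A \<in> carrier (mat2 p) \<Longrightarrow> mat_red p A = A"
  by (cases A rule: smat_cases) (auto simp: mat_red_smat)

locale prime_modulus =
  fixes p :: nat
  assumes p: "prime p"
begin

lemma p_gt_1: "1 < int p"
  using prime_gt_1_nat[OF p] by simp

lemma p_pos [simp]: "0 < p"
  using p by (rule prime_gt_0_nat)

lemma p_ne_0 [simp]: "p \<noteq> 0"
  using p_pos by simp

lemma prime_int_p: "prime (int p)"
  using p by simp

lemma dvd_mult_iff: "int p dvd a * b \<longleftrightarrow> int p dvd a \<or> int p dvd b"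
  using prime_int_p by (rule prime_dvd_mult_iff)

lemma inverse_mod:
  assumes "\<not> int p dvd a"
  obtains b where "int p dvd a * b - 1"
proof -
  have "coprime a (int p)" using prime_imp_coprime[OF prime_int_p assms] by (simp add: coprime_commute)
  then obtain b where "[a * b = 1] (mod int p)" using coprime_iff_invertible_int by blast
  then show thesis using that by (simp add: cong_iff_dvd_diff)
qed

lemma mat_red_in_mat2 [simp]: "mat_red p A \<in> carrier (mat2 p)"
  by (cases A rule: smat_cases) (simp add: mat_red_smat)

lemma monoid_mat2: "monoid (mat2 p)"
proof (rule monoidI)
  fix A B C assume "A \<in> carrier (mat2 p)" "B \<in> carrier (mat2 p)" "C \<in> carrier (mat2 p)"
  show "A \<otimes>\<^bsub>mat2 p\<^esub> B \<otimes>\<^bsub>mat2 p\<^esub> C = A \<otimes>\<^bsub>mat2 p\<^esub> (B \<otimes>\<^bsub>mat2 p\<^esub> C)"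
    by (simp add: mat2_mult mat_red_mult matrix_mul_assoc)
next
  fix A assume A: "A \<in> carrier (mat2 p)"
  show "\<one>\<^bsub>mat2 p\<^esub> \<otimes>\<^bsub>mat2 p\<^esub> A = A" "A \<otimes>\<^bsub>mat2 p\<^esub> \<one>\<^bsub>mat2 p\<^esub> = A"
    using mat_red_id[OF A] by (simp_all add: mat2_mult mat2_one smat_one[symmetric])
qed (use p_gt_1 in \<open>simp_all add: mat2_mult mat2_one\<close>)

sublocale M: monoid "mat2 p" by (rule monoid_mat2)

lemma group_GL2: "group (GL2 p)"
  unfolding GL2_def by (rule M.units_group)

sublocale GL: group "GL2 p" by (rule group_GL2)

abbreviation mult_GL2 (infixl "\<cdot>" 70) where
  "A \<cdot> B \<equiv> A \<otimes>\<^bsub>GL2 p\<^esub> B"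

lemma GL2_simps:
  "A \<otimes>\<^bsub>GL2 p\<^esub> B = mat_red p (A ** B)" "\<one>\<^bsub>GL2 p\<^esub> = smat 1 0 0 1"
  by (simp_all add: GL2_def units_of_def mat2_mult mat2_one)

lemma GL2_mult_smat: "smat a b c d \<otimes>\<^bsub>GL2 p\<^esub> smat a' b' c' d' =
    mat_red p (smat (a * a' + b * c') (a * b' + b * d') (c * a' + d * c') (c * b' + d * d'))"
  by (simp add: GL2_simps smat_mult)

lemma GL2_carrier_mat2: "A \<in> carrier (GL2 p) \<Longrightarrow> A \<in> carrier (mat2 p)"
  by (auto simp: GL2_def units_of_def Units_def)

lemma finite_mat2: "finite (carrier (mat2 p))"
proof (rule finite_surj)
  let ?I = "{0..<int p}"
  show "finite (?I \<times> ?I \<times> ?I \<times> ?I)" by simp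
  show "carrier (mat2 p) \<subseteq> (\<lambda>(a, b, c, d). smat a b c d) ` (?I \<times> ?I \<times> ?I \<times> ?I)"
  proof
    fix A assume A: "A \<in> carrier (mat2 p)"
    obtain a b c d where "A = smat a b c d" by (rule smat_cases)
    then show "A \<in> (\<lambda>(a, b, c, d). smat a b c d) ` (?I \<times> ?I \<times> ?I \<times> ?I)"
      using A by (intro image_eqI[of _ _ "(a, b, c, d)"]) auto
  qed
qed

lemma finite_GL2: "finite (carrier (GL2 p))"
  using finite_subset[OF _ finite_mat2] GL2_carrier_mat2 by blast

lemma smat_in_GL2_iff:
  "mat_red p (smat a b c d) \<in> carrier (GL2 p) \<longleftrightarrow> \<not> int p dvd a * d - b * c"
proof
  assume "mat_red p (smat a b c d) \<in> carrier (GL2 p)"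
  then obtain B where B: "mat_red p (smat a b c d) \<cdot> B = \<one>\<^bsub>GL2 p\<^esub>"
    using GL.r_inv by blast
  obtain e f g h where [simp]: "B = smat e f g h" by (rule smat_cases)
  have "mat_red p (smat (a * e + b * g) (a * f + b * h) (c * e + d * g) (c * f + d * h)) = mat_red p (smat 1 0 0 1)"
    using B p_gt_1 by (simp add: GL2_simps mat_red_mult smat_mult) (simp add: mat_red_smat)
  then have 1: "int p dvd a * e + b * g - 1" "int p dvd a * f + b * h" "int p dvd c * e + d * g" "int p dvd c * f + d * h - 1"
    by (simp_all add: mat_red_eq_iff)
  show "\<not> int p dvd a * d - b * c"
  proof
    assume "int p dvd a * d - b * c"
    then have "int p dvd (a * d - b * c) * (e * h - f * g) - (a * e + b * g - 1) * (c * f + d * h)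
        - (c * f + d * h - 1) + (a * f + b * h) * (c * e + d * g)"
      using dvd_add[OF dvd_diff[OF dvd_diff[OF dvd_mult2 dvd_mult2[OF 1(1)]] 1(4)] dvd_mult2[OF 1(2)]] by blast
    moreover have "(a * d - b * c) * (e * h - f * g) - (a * e + b * g - 1) * (c * f + d * h)
        - (c * f + d * h - 1) + (a * f + b * h) * (c * e + d * g) = 1"
      by (simp add: algebra_simps)
    ultimately have "int p dvd 1" by metis
    then show False using p_gt_1 by simp
  qed
next
  assume "\<not> int p dvd a * d - b * c"
  then obtain k where k: "int p dvd (a * d - b * c) * k - 1" by (rule inverse_mod)
  let ?A = "mat_red p (smat a b c d)"
  let ?B = "mat_red p (smat (d * k) (- b * k) (- c * k) (a * k))"
  have "?A \<otimes>\<^bsub>mat2 p\<^esub> ?B = mat_red p (smat 1 0 0 1)" "?B \<otimes>\<^bsub>mat2 p\<^esub> ?A = mat_red p (smat 1 0 0 1)"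
    using k by (simp_all add: mat2_mult mat_red_mult smat_mult mat_red_eq_iff algebra_simps)
  then have "?A \<otimes>\<^bsub>mat2 p\<^esub> ?B = \<one>\<^bsub>mat2 p\<^esub>" "?B \<otimes>\<^bsub>mat2 p\<^esub> ?A = \<one>\<^bsub>mat2 p\<^esub>"
    using mat_red_id[OF M.one_closed] by (simp_all add: mat2_one)
  then have "?A \<in> Units (mat2 p)" unfolding Units_def using mat_red_in_mat2 by blast
  then show "?A \<in> carrier (GL2 p)" by (simp add: GL2_def units_of_def)
qed

lemma GL2_cases:
  assumes "A \<in> carrier (GL2 p)"
  obtains a b c d where "A = smat a b c d" "A = mat_red p (smat a b c d)" "\<not> int p dvd a * d - b * c"
proof -
  obtain a b c d where A: "A = smat a b c d" by (rule smat_cases)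
  have red: "mat_red p A = A" using mat_red_id GL2_carrier_mat2 assms by blast
  then have "\<not> int p dvd a * d - b * c" using smat_in_GL2_iff[of a b c d] assms A by simp
  then show thesis using that A red by simp
qed

abbreviation Zp2 :: "(int \<times> int) monoid" where
  "Zp2 \<equiv> Zmn p p"

lemma carrier_Zp2: "carrier Zp2 = {0..<int p} \<times> {0..<int p}"
  by (simp add: carrier_integer_mod_group)

definition act :: "int ^ 2 ^ 2 \<Rightarrow> int \<times> int \<Rightarrow> int \<times> int" where
  "act A = (\<lambda>(x, y). ((A $ 1 $ 1 * x + A $ 1 $ 2 * y) mod int p, (A $ 2 $ 1 * x + A $ 2 $ 2 * y) mod int p))"

lemma act_mult: "act (A \<otimes>\<^bsub>mat2 p\<^esub> B) z = act A (act B z)"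
proof -
  obtain a b c d where [simp]: "A = smat a b c d" by (rule smat_cases)
  obtain a' b' c' d' where [simp]: "B = smat a' b' c' d'" by (rule smat_cases)
  obtain x y where [simp]: "z = (x, y)" by fastforce
  show ?thesis
    by (simp add: act_def mat2_mult smat_mult mat_red_smat mod_linear) (simp add: algebra_simps)
qed

lemma act_one: "z \<in> carrier Zp2 \<Longrightarrow> act \<one>\<^bsub>mat2 p\<^esub> z = z"
  unfolding carrier_Zp2 by (auto simp: act_def mat2_one)

lemma act_hom: "act A \<in> hom Zp2 Zp2"
proof (rule homI)
  fix z w assume "z \<in> carrier Zp2" "w \<in> carrier Zp2"
  obtain x y x' y' where [simp]: "z = (x, y)" "w = (x', y')" by fastforce
  show "act A (z \<otimes>\<^bsub>Zp2\<^esub> w) = act A z \<otimes>\<^bsub>Zp2\<^esub> act A w"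
    by (simp add: act_def mod_linear mod_add_eq) (simp add: algebra_simps)
qed (simp add: act_def carrier_integer_mod_group split: prod.split)

lemma act_eqD:
  assumes "A \<in> carrier (mat2 p)" "B \<in> carrier (mat2 p)" "\<And>z. z \<in> carrier Zp2 \<Longrightarrow> act A z = act B z"
  shows "A = B"
proof -
  obtain a b c d where A: "A = smat a b c d" by (rule smat_cases)
  obtain a' b' c' d' where B: "B = smat a' b' c' d'" by (rule smat_cases)
  have "(1, 0) \<in> carrier Zp2" "(0, 1) \<in> carrier Zp2" using p_gt_1 by (simp_all add: carrier_integer_mod_group)
  then have "act A (1, 0) = act B (1, 0)" "act A (0, 1) = act B (0, 1)" using assms(3) by blast+
  then show ?thesis using assms(1,2) by (simp add: A B act_def)
qed

lemma hom_Zp2_act: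
  assumes \<phi>: "\<phi> \<in> hom Zp2 Zp2"
  obtains A where "A \<in> carrier (mat2 p)" "\<And>z. z \<in> carrier Zp2 \<Longrightarrow> \<phi> z = act A z"
proof -
  define u where "u = \<phi> (1 mod int p, 0)"
  define v where "v = \<phi> (0, 1 mod int p)"
  note * = hom_DirProd_eq_powers[OF DirProd_group[OF group_integer_mod_group group_integer_mod_group]
      \<phi> p_pos p_pos, folded u_def v_def]
  obtain u1 u2 v1 v2 where uv: "u = (u1, u2)" "v = (v1, v2)" by fastforce
  have c: "(u1, u2) \<in> carrier Zp2" "(v1, v2) \<in> carrier Zp2" using *(1,2) uv by simp_all
  have "\<phi> z = act (smat u1 v1 u2 v2) z" if z: "z \<in> carrier Zp2" for z
  proof -
    obtain x y where xy: "z = (x, y)" by fastforce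
    have "\<phi> (x, y) = u [^]\<^bsub>Zp2\<^esub> x \<otimes>\<^bsub>Zp2\<^esub> v [^]\<^bsub>Zp2\<^esub> y" using *(5) z xy by blast
    also have "\<dots> = ((x * u1 mod int p + y * v1 mod int p) mod int p, (x * u2 mod int p + y * v2 mod int p) mod int p)"
      using int_pow_Zmn[OF c(1) p_pos p_pos, of x]
        int_pow_Zmn[OF c(2) p_pos p_pos, of y] by (simp add: uv)
    also have "\<dots> = act (smat u1 v1 u2 v2) (x, y)"
      by (simp add: act_def mod_add_eq) (simp add: mult.commute)
    finally show ?thesis by (simp add: xy)
  qed
  moreover have "smat u1 v1 u2 v2 \<in> carrier (mat2 p)" using c by (simp add: carrier_integer_mod_group)
  ultimately show thesis using that by blast
qed

lemma GL2_iso_AutoGroup: "(\<lambda>A. \<lambda>z\<in>carrier Zp2. act A z) \<in> iso (GL2 p) (AutoGroup Zp2)"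
  unfolding GL2_def
proof (rule units_of_iso_AutoGroup[where act = act])
  show "monoid (mat2 p)" by (rule monoid_mat2)
  show "group Zp2" by (rule comm_group.axioms(2)[OF comm_group_Zmn])
  show "act A \<in> hom Zp2 Zp2" for A by (rule act_hom)
  show "act (A \<otimes>\<^bsub>mat2 p\<^esub> B) z = act A (act B z)" for A B z by (rule act_mult)
  show "act \<one>\<^bsub>mat2 p\<^esub> z = z" if "z \<in> carrier Zp2" for z using that by (rule act_one)
  show "A = B" if "A \<in> carrier (mat2 p)" "B \<in> carrier (mat2 p)" "\<And>z. z \<in> carrier Zp2 \<Longrightarrow> act A z = act B z" for A B
    using that by (rule act_eqD)
  show "\<exists>A\<in>carrier (mat2 p). \<forall>z\<in>carrier Zp2. \<phi> z = act A z" if "\<phi> \<in> hom Zp2 Zp2" for \<phi>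
    using hom_Zp2_act[OF that] by metis
qed

end

section \<open>Reducible images\<close>

text \<open>Congruences modulo \<open>p\<close> between matrix entries are deduced from given ones by naming the
  coefficients of a linear combination.\<close>

lemma dvd_combination2: "n dvd u \<Longrightarrow> n dvd v \<Longrightarrow> X = a * u + b * v \<Longrightarrow> n dvd X"
  for n :: int by simp

lemma dvd_combination4:
  "n dvd u \<Longrightarrow> n dvd v \<Longrightarrow> n dvd w \<Longrightarrow> n dvd z \<Longrightarrow> X = a * u + b * v + c * w + d * z \<Longrightarrow> n dvd X"
  for n :: int by simp

context prime_modulus
begin

definition nonzero_mod :: "int \<Rightarrow> int \<Rightarrow> bool" where
  "nonzero_mod x y \<longleftrightarrow> \<not> (int p dvd x \<and> int p dvd y)"

definition eigvec :: "int ^ 2 ^ 2 \<Rightarrow> int \<Rightarrow> int \<Rightarrow> bool" where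
  "eigvec A x y \<longleftrightarrow> (\<exists>k. int p dvd A $ 1 $ 1 * x + A $ 1 $ 2 * y - k * x \<and> int p dvd A $ 2 $ 1 * x + A $ 2 $ 2 * y - k * y)"

lemma vec_red_eq_iff: "vec_red p u = vec_red p w \<longleftrightarrow> int p dvd u $ 1 - w $ 1 \<and> int p dvd u $ 2 - w $ 2"
  by (simp add: vec_red_def vec_eq_iff forall_2 mod_eq_dvd_iff)

lemma line_eq:
  "(\<lambda>k. vec_red p (k *s v)) ` {0..<int p} = range (\<lambda>k. vec_red p (k *s v))"
proof
  show "range (\<lambda>k. vec_red p (k *s v)) \<subseteq> (\<lambda>k. vec_red p (k *s v)) ` {0..<int p}"
  proof
    fix u assume "u \<in> range (\<lambda>k. vec_red p (k *s v))"
    then obtain k where u: "u = vec_red p (k *s v)" by blast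
    have "vec_red p (k *s v) = vec_red p ((k mod int p) *s v)"
      unfolding vec_red_eq_iff by (simp add: mod_eq_dvd_iff[symmetric] mod_mult_left_eq)
    then show "u \<in> (\<lambda>k. vec_red p (k *s v)) ` {0..<int p}" unfolding u by (rule image_eqI) simp
  qed
qed blast

lemma mat_vec_red: "vec_red p (A *v vec_red p u) = vec_red p (A *v u)"
proof -
  obtain a b c d where A: "A = smat a b c d" by (rule smat_cases)
  show ?thesis by (simp add: A vec_eq_iff forall_2 vec_red_def smat_vec mod_linear)
qed

text \<open>An invertible matrix has nonzero eigenvalues, so it maps the line through an eigenvector onto itself,
  as the definition of \<open>reducible\<close> demands.\<close>

lemma reducible_iff:
  assumes K: "K \<subseteq> carrier (GL2 p)"
  shows "reducible p K \<longleftrightarrow> (\<exists>x y. nonzero_mod x y \<and> (\<forall>A\<in>K. eigvec A x y))"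
proof
  assume "reducible p K"
  then obtain v where v: "v \<in> vecs p" "v \<noteq> 0" and inv: "\<And>A. A \<in> K \<Longrightarrow>
    (\<lambda>u. vec_red p (A *v u)) ` range (\<lambda>k. vec_red p (k *s v)) = range (\<lambda>k. vec_red p (k *s v))"
    unfolding reducible_def one_dim_subspace_def line_eq by blast
  have "nonzero_mod (v $ 1) (v $ 2)"
  proof -
    have "x = 0" if "x \<in> {0..<int p}" "int p dvd x" for x
      using that by (metis atLeastLessThan_iff dvd_imp_mod_0 mod_pos_pos_trivial)
    then show ?thesis using v by (auto simp: nonzero_mod_def vecs_def vec_eq_iff forall_2)
  qed
  moreover have "eigvec A (v $ 1) (v $ 2)" if A: "A \<in> K" for A
  proof -
    have "vec_red p (A *v vec_red p (1 *s v)) \<in> range (\<lambda>k. vec_red p (k *s v))"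
      using inv[OF A] by blast
    then obtain k where "vec_red p (A *v v) = vec_red p (k *s v)" by (auto simp: mat_vec_red)
    moreover obtain a b c d where "A = smat a b c d" by (rule smat_cases)
    ultimately show ?thesis unfolding eigvec_def vec_red_eq_iff by (auto simp: smat_vec)
  qed
  ultimately show "\<exists>x y. nonzero_mod x y \<and> (\<forall>A\<in>K. eigvec A x y)" by blast
next
  assume "\<exists>x y. nonzero_mod x y \<and> (\<forall>A\<in>K. eigvec A x y)"
  then obtain x y where xy: "nonzero_mod x y" and eig: "\<And>A. A \<in> K \<Longrightarrow> eigvec A x y" by blast
  define v :: "int ^ 2" where "v = vec_red p (\<chi> i. if i = 1 then x else y)"
  have v: "v $ 1 = x mod int p" "v $ 2 = y mod int p" by (simp_all add: v_def vec_red_def)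
  have vp: "v \<in> vecs p" unfolding v_def by (simp add: vecs_def vec_red_def)
  have "v \<noteq> 0"
  proof
    assume "v = 0"
    then have "x mod int p = 0" "y mod int p = 0" using v by simp_all
    then show False using xy by (auto simp: nonzero_mod_def)
  qed
  moreover have "(\<lambda>u. vec_red p (A *v u)) ` range (\<lambda>k. vec_red p (k *s v)) = range (\<lambda>k. vec_red p (k *s v))"
    if A: "A \<in> K" for A
  proof -
    obtain a b c d where A': "A = smat a b c d" and det: "\<not> int p dvd a * d - b * c"
      using K A by (metis GL2_cases subsetD)
    obtain k where k: "int p dvd a * x + b * y - k * x" "int p dvd c * x + d * y - k * y"
      using eig[OF A] by (auto simp: eigvec_def A')
    have Av: "vec_red p (A *v (j *s v)) = vec_red p ((k * j) *s v)" for j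
    proof -
      have "(a * (j * (x mod int p)) + b * (j * (y mod int p))) mod int p = (k * j * (x mod int p)) mod int p"
      proof -
        have "a * (j * (x mod int p)) + b * (j * (y mod int p)) = (j * a) * (x mod int p) + (j * b) * (y mod int p)"
          by (simp add: algebra_simps)
        then have "(a * (j * (x mod int p)) + b * (j * (y mod int p))) mod int p = ((j * a) * x + (j * b) * y) mod int p"
          by (simp only: mod_linear)
        also have "\<dots> = (k * j * x) mod int p"
          unfolding mod_eq_dvd_iff by (rule dvd_combination2[OF k, of _ j 0]) (simp add: algebra_simps)
        finally show ?thesis by (simp add: mod_mult_right_eq)
      qed
      moreover have "(c * (j * (x mod int p)) + d * (j * (y mod int p))) mod int p = (k * j * (y mod int p)) mod int p"
      proof -
        have "c * (j * (x mod int p)) + d * (j * (y mod int p)) = (j * c) * (x mod int p) + (j * d) * (y mod int p)"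
          by (simp add: algebra_simps)
        then have "(c * (j * (x mod int p)) + d * (j * (y mod int p))) mod int p = ((j * c) * x + (j * d) * y) mod int p"
          by (simp only: mod_linear)
        also have "\<dots> = (k * j * y) mod int p"
          unfolding mod_eq_dvd_iff by (rule dvd_combination2[OF k, of _ 0 j]) (simp add: algebra_simps)
        finally show ?thesis by (simp add: mod_mult_right_eq)
      qed
      ultimately show ?thesis by (simp add: vec_red_def vec_eq_iff forall_2 A' smat_vec v)
    qed
    have "\<not> int p dvd k"
    proof
      assume pk: "int p dvd k"
      have 1: "int p dvd a * x + b * y" by (rule dvd_combination2[OF k(1) pk, of _ 1 x]) simp
      have 2: "int p dvd c * x + d * y" by (rule dvd_combination2[OF k(2) pk, of _ 1 y]) simp
      have "int p dvd (a * d - b * c) * x" by (rule dvd_combination2[OF 1 2, of _ d "- b"]) (simp add: algebra_simps)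
      moreover have "int p dvd (a * d - b * c) * y" by (rule dvd_combination2[OF 1 2, of _ "- c" a]) (simp add: algebra_simps)
      ultimately show False using det xy by (auto simp: dvd_mult_iff nonzero_mod_def)
    qed
    then obtain k' where k': "int p dvd k * k' - 1" by (rule inverse_mod)
    show ?thesis
    proof (intro equalityI subsetI)
      fix u assume "u \<in> (\<lambda>u. vec_red p (A *v u)) ` range (\<lambda>k. vec_red p (k *s v))"
      then show "u \<in> range (\<lambda>k. vec_red p (k *s v))" by (auto simp: mat_vec_red Av)
    next
      fix u assume "u \<in> range (\<lambda>k. vec_red p (k *s v))"
      then obtain j where u: "u = vec_red p (j *s v)" by blast
      have "vec_red p ((k * (k' * j)) *s v) = vec_red p (j *s v)"
        unfolding vec_red_eq_iff
        by (intro conjI dvd_combination2[OF k' k', of _ "j * v $ _" 0]) (simp_all add: algebra_simps)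
      then have "u = vec_red p (A *v vec_red p ((k' * j) *s v))" by (simp add: u mat_vec_red Av)
      then show "u \<in> (\<lambda>u. vec_red p (A *v u)) ` range (\<lambda>k. vec_red p (k *s v))" by blast
    qed
  qed
  ultimately have "\<forall>A\<in>K. (\<lambda>u. vec_red p (A *v u)) ` range (\<lambda>k. vec_red p (k *s v)) = range (\<lambda>k. vec_red p (k *s v))"
    and "one_dim_subspace p (range (\<lambda>k. vec_red p (k *s v)))"
    unfolding one_dim_subspace_def line_eq using vp by auto
  then show "reducible p K" unfolding reducible_def by (intro exI conjI)
qed

lemma nonzero_mod_image:
  assumes "g = smat a b c d" "\<not> int p dvd a * d - b * c" "nonzero_mod x y"
  shows "nonzero_mod (a * x + b * y) (c * x + d * y)"
proof -
  have False if h: "int p dvd a * x + b * y" "int p dvd c * x + d * y"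
  proof -
    have "int p dvd (a * d - b * c) * x" by (rule dvd_combination2[OF h, of _ d "- b"]) (simp add: algebra_simps)
    moreover have "int p dvd (a * d - b * c) * y" by (rule dvd_combination2[OF h, of _ "- c" a]) (simp add: algebra_simps)
    ultimately show False using assms by (auto simp: dvd_mult_iff nonzero_mod_def)
  qed
  then show ?thesis by (auto simp: nonzero_mod_def)
qed

text \<open>From \<open>A v = k v\<close> follows \<open>B (g v) = g (A v) = k (g v)\<close>.\<close>

lemma intertwine:
  assumes "smat b1 b2 b3 b4 \<cdot> smat g1 g2 g3 g4 = smat g1 g2 g3 g4 \<cdot> smat a1 a2 a3 a4"
    and "eigvec (smat a1 a2 a3 a4) x y"
  shows "eigvec (smat b1 b2 b3 b4) (g1 * x + g2 * y) (g3 * x + g4 * y)"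
proof -
  obtain k where e: "int p dvd a1 * x + a2 * y - k * x" "int p dvd a3 * x + a4 * y - k * y"
    using assms(2) by (auto simp: eigvec_def)
  have h: "int p dvd b1 * g1 + b2 * g3 - (g1 * a1 + g2 * a3)" "int p dvd b1 * g2 + b2 * g4 - (g1 * a2 + g2 * a4)"
    "int p dvd b3 * g1 + b4 * g3 - (g3 * a1 + g4 * a3)" "int p dvd b3 * g2 + b4 * g4 - (g3 * a2 + g4 * a4)"
    using assms(1) by (simp_all add: GL2_mult_smat mat_red_eq_iff)
  have "int p dvd b1 * (g1 * x + g2 * y) + b2 * (g3 * x + g4 * y) - k * (g1 * x + g2 * y)"
    by (rule dvd_combination4[OF h(1,2) e, of _ x y g1 g2]) (simp add: algebra_simps)
  moreover have "int p dvd b3 * (g1 * x + g2 * y) + b4 * (g3 * x + g4 * y) - k * (g3 * x + g4 * y)"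
    by (rule dvd_combination4[OF h(3,4) e, of _ x y g3 g4]) (simp add: algebra_simps)
  ultimately show ?thesis by (auto simp: eigvec_def)
qed

lemma reducible_conj_rel:
  assumes "(K, K') \<in> conj_rel (GL2 p)" "reducible p K"
  shows "reducible p K'"
proof -
  have K: "subgroup K (GL2 p)" using assms(1) by (simp add: conj_rel_def)
  then obtain g where g: "g \<in> carrier (GL2 p)" "K' = conjugation (GL2 p) g ` K"
    using assms(1) GL.conj_rel_iff by blast
  have KG: "K \<subseteq> carrier (GL2 p)" using subgroup.subset[OF K] .
  have K'G: "K' \<subseteq> carrier (GL2 p)" using subgroup.subset[OF GL.subgroup_conj[OF K g(1)]] g(2) by simp
  obtain x y where xy: "nonzero_mod x y" "\<And>A. A \<in> K \<Longrightarrow> eigvec A x y"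
    using assms(2) reducible_iff[OF KG] by blast
  obtain g1 g2 g3 g4 where g': "g = smat g1 g2 g3 g4" "\<not> int p dvd g1 * g4 - g2 * g3"
    using GL2_cases[OF g(1)] by metis
  have "eigvec B (g1 * x + g2 * y) (g3 * x + g4 * y)" if B: "B \<in> K'" for B
  proof -
    obtain A where A: "A \<in> K" "B = g \<cdot> A \<cdot> inv\<^bsub>GL2 p\<^esub> g" using B g(2) by blast
    have AG: "A \<in> carrier (GL2 p)" using A(1) KG by blast
    have BG: "B \<in> carrier (GL2 p)" using B K'G by blast
    have "B \<cdot> g = g \<cdot> A" using A(2) AG g(1) by (simp add: GL.m_assoc)
    moreover obtain a1 a2 a3 a4 where "A = smat a1 a2 a3 a4" by (rule smat_cases)
    moreover obtain b1 b2 b3 b4 where "B = smat b1 b2 b3 b4" by (rule smat_cases)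
    ultimately show ?thesis using intertwine xy(2)[OF A(1)] g'(1) by metis
  qed
  moreover have "nonzero_mod (g1 * x + g2 * y) (g3 * x + g4 * y)" using nonzero_mod_image g' xy(1) by blast
  ultimately show ?thesis using reducible_iff[OF K'G] by blast
qed

lemma upper_triangular_pow:
  "\<exists>\<beta>. mat_red p (smat a b 0 d) [^]\<^bsub>GL2 p\<^esub> (n::nat) = mat_red p (smat (a ^ n) \<beta> 0 (d ^ n))"
proof (induction n)
  case 0
  have "mat_red p (smat 1 0 0 1) = smat 1 0 0 1" using p_gt_1 by (simp add: mat_red_smat)
  then show ?case by (metis GL2_simps(2) GL.nat_pow_0 power_0)
next
  case (Suc n)
  then obtain \<beta> where "mat_red p (smat a b 0 d) [^]\<^bsub>GL2 p\<^esub> n = mat_red p (smat (a ^ n) \<beta> 0 (d ^ n))" by blast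
  then have "mat_red p (smat a b 0 d) [^]\<^bsub>GL2 p\<^esub> Suc n
    = mat_red p (smat (a ^ Suc n) (a ^ n * b + \<beta> * d) 0 (d ^ Suc n))"
    by (simp add: GL2_simps mat_red_mult smat_mult mult.commute)
  then show ?case by blast
qed

lemma unipotent_pow:
  "mat_red p (smat 1 \<beta> 0 1) [^]\<^bsub>GL2 p\<^esub> (n::nat) = mat_red p (smat 1 (int n * \<beta>) 0 1)"
proof (induction n)
  case 0
  show ?case using p_gt_1 by (simp add: mat_red_smat GL2_simps)
next
  case (Suc n)
  then show ?case by (simp add: GL2_simps mat_red_mult smat_mult algebra_simps)
qed

end

lemma (in group) conj_pow:
  assumes "x \<in> carrier G" "g \<in> carrier G"
  shows "(g \<otimes> x \<otimes> inv g) [^] (n::nat) = g \<otimes> x [^] n \<otimes> inv g"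
proof (induction n)
  case (Suc n)
  have "inv g \<otimes> (g \<otimes> (x \<otimes> inv g)) = x \<otimes> inv g"
    using assms by (simp add: m_assoc[symmetric])
  then have "(g \<otimes> x [^] n \<otimes> inv g) \<otimes> (g \<otimes> x \<otimes> inv g) = g \<otimes> (x [^] n \<otimes> x) \<otimes> inv g"
    using assms by (simp add: m_assoc)
  then show ?case using Suc by simp
qed (use assms in simp)

context prime_modulus
begin

text \<open>With an eigenvector as first basis vector \<open>A\<close> is upper triangular, so \<open>A\<^bsup>p - 1\<^esup>\<close> is unipotent
  and hence of order \<open>1\<close> or \<open>p\<close>; the order \<open>p\<close> is excluded by \<open>A\<^sup>n = 1\<close>.\<close>

lemma eigvec_pow_eq_one:
  assumes A: "A \<in> carrier (GL2 p)" and xy: "nonzero_mod x y" "eigvec A x y"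
    and n: "A [^]\<^bsub>GL2 p\<^esub> (n::nat) = \<one>\<^bsub>GL2 p\<^esub>" "\<not> p dvd n"
  shows "A [^]\<^bsub>GL2 p\<^esub> (p - 1) = \<one>\<^bsub>GL2 p\<^esub>"
proof -
  obtain z w where zw: "\<not> int p dvd x * w - z * y"
  proof (cases "int p dvd x")
    case True
    then show ?thesis using that[of 0 1] xy(1) by (simp add: nonzero_mod_def)
  next
    case False
    then show ?thesis using that[of 1 0] by simp
  qed
  define g where "g = mat_red p (smat x z y w)"
  have g: "g \<in> carrier (GL2 p)" using smat_in_GL2_iff zw by (simp add: g_def)
  define h where "h = inv\<^bsub>GL2 p\<^esub> g"
  have h: "h \<in> carrier (GL2 p)" using g by (simp add: h_def)
  define B where "B = h \<cdot> A \<cdot> inv\<^bsub>GL2 p\<^esub> h"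
  have B: "B \<in> carrier (GL2 p)" using A h by (simp add: B_def)
  have BA: "B \<cdot> h = h \<cdot> A" using A h by (simp add: B_def GL.m_assoc)
  obtain h1 h2 h3 h4 where h': "h = smat h1 h2 h3 h4" by (rule smat_cases)
  obtain a1 a2 a3 a4 where A': "A = smat a1 a2 a3 a4" by (rule smat_cases)
  obtain b1 b2 b3 b4 where B': "B = smat b1 b2 b3 b4" "B = mat_red p (smat b1 b2 b3 b4)"
    "\<not> int p dvd b1 * b4 - b2 * b3" using GL2_cases[OF B] by metis
  have "h \<cdot> g = \<one>\<^bsub>GL2 p\<^esub>" using g by (simp add: h_def)
  then have "mat_red p (smat (h1 * x + h2 * y) (h1 * z + h2 * w) (h3 * x + h4 * y) (h3 * z + h4 * w)) = mat_red p (smat 1 0 0 1)"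
    using p_gt_1 by (simp add: GL2_simps g_def h' mat_red_mult smat_mult) (simp add: mat_red_smat)
  then have e1: "int p dvd h1 * x + h2 * y - 1" "int p dvd h3 * x + h4 * y" by (simp_all add: mat_red_eq_iff)
  have "eigvec B (h1 * x + h2 * y) (h3 * x + h4 * y)"
    using intertwine BA xy(2) unfolding h' A' B'(1) by blast
  then obtain k where k: "int p dvd b3 * (h1 * x + h2 * y) + b4 * (h3 * x + h4 * y) - k * (h3 * x + h4 * y)"
    by (auto simp: eigvec_def B'(1))
  have b3: "int p dvd b3"
    by (rule dvd_combination4[OF k e1(1) e1(2) e1(2), of _ 1 "- b3" "- b4" k]) (simp add: algebra_simps)
  have Bt: "B = mat_red p (smat b1 b2 0 b4)" using B'(2) b3 by (simp add: mat_red_eq_iff)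
  have "\<not> int p dvd b1" "\<not> int p dvd b4"
  proof -
    have "\<not> int p dvd b1 * b4"
    proof
      assume "int p dvd b1 * b4"
      then have "int p dvd b1 * b4 - b2 * b3" using b3 by simp
      then show False using B'(3) by simp
    qed
    then show "\<not> int p dvd b1" "\<not> int p dvd b4" by (simp_all add: dvd_mult_iff)
  qed
  then have fermat: "int p dvd b1 ^ (p - 1) - 1" "int p dvd b4 ^ (p - 1) - 1"
  proof -
    have "int p dvd b ^ (p - 1) - 1" if "\<not> int p dvd b" for b
    proof -
      have "\<not> p dvd nat (b mod int p)"
        using that by (metis dvd_mod_iff dvd_refl int_dvd_int_iff int_nat_eq p_gt_1 pos_mod_sign zero_less_one order_less_trans)
      then have "[nat (b mod int p) ^ (p - 1) = 1] (mod p)" using fermat_theorem p by blast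
      then have "[(b mod int p) ^ (p - 1) = 1] (mod int p)"
        using p_gt_1 by (simp flip: cong_int_iff)
      then have "[b ^ (p - 1) = 1] (mod int p)" by (metis cong_def power_mod)
      then show ?thesis by (simp add: cong_iff_dvd_diff)
    qed
    then show "int p dvd b1 ^ (p - 1) - 1" "int p dvd b4 ^ (p - 1) - 1"
      using \<open>\<not> int p dvd b1\<close> \<open>\<not> int p dvd b4\<close> by blast+
  qed
  obtain \<beta> where "B [^]\<^bsub>GL2 p\<^esub> (p - 1) = mat_red p (smat (b1 ^ (p - 1)) \<beta> 0 (b4 ^ (p - 1)))"
    using upper_triangular_pow unfolding Bt by blast
  also have "\<dots> = mat_red p (smat 1 \<beta> 0 1)" using fermat by (simp add: mat_red_eq_iff)
  finally have Bp: "B [^]\<^bsub>GL2 p\<^esub> (p - 1) = mat_red p (smat 1 \<beta> 0 1)" .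
  have one: "\<one>\<^bsub>GL2 p\<^esub> = mat_red p (smat 1 0 0 1)" using p_gt_1 by (simp add: GL2_simps mat_red_smat)
  have "B [^]\<^bsub>GL2 p\<^esub> n = \<one>\<^bsub>GL2 p\<^esub>"
    using GL.conj_pow[OF A h, of n] n(1) h by (simp add: B_def)
  then have "(B [^]\<^bsub>GL2 p\<^esub> (p - 1)) [^]\<^bsub>GL2 p\<^esub> n = \<one>\<^bsub>GL2 p\<^esub>"
    using B by (metis GL.nat_pow_one GL.nat_pow_pow mult.commute)
  then have "int p dvd int n * \<beta>" unfolding Bp unipotent_pow one by (simp add: mat_red_eq_iff)
  then have "int p dvd \<beta>" using n(2) by (simp add: dvd_mult_iff)
  then have "B [^]\<^bsub>GL2 p\<^esub> (p - 1) = \<one>\<^bsub>GL2 p\<^esub>" unfolding Bp one by (simp add: mat_red_eq_iff)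
  then have "h \<cdot> A [^]\<^bsub>GL2 p\<^esub> (p - 1) \<cdot> inv\<^bsub>GL2 p\<^esub> h = \<one>\<^bsub>GL2 p\<^esub>"
    using GL.conj_pow[OF A h] by (simp add: B_def)
  then have "h \<cdot> A [^]\<^bsub>GL2 p\<^esub> (p - 1) = h"
    using A h by (metis GL.inv_closed GL.inv_equality GL.inv_inv GL.m_closed GL.nat_pow_closed)
  then show ?thesis using A h by (metis GL.l_cancel_one GL.nat_pow_closed)
qed

definition scalar :: "int ^ 2 ^ 2 \<Rightarrow> bool" where
  "scalar A \<longleftrightarrow> int p dvd A $ 1 $ 2 \<and> int p dvd A $ 2 $ 1 \<and> int p dvd A $ 1 $ 1 - A $ 2 $ 2"

lemma scalar_eigvec:
  assumes "scalar A"
  shows "eigvec A x y"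
proof -
  obtain a b c d where A: "A = smat a b c d" by (rule smat_cases)
  then have s: "int p dvd b" "int p dvd c" "int p dvd a - d" using assms by (simp_all add: scalar_def)
  have "int p dvd a * x + b * y - a * x" "int p dvd c * x + d * y - a * y"
  proof -
    show "int p dvd a * x + b * y - a * x" using s by simp
    show "int p dvd c * x + d * y - a * y" by (rule dvd_combination2[OF s(2,3), of _ x "- y"]) (simp add: algebra_simps)
  qed
  then show ?thesis unfolding eigvec_def A smat_entries by blast
qed

text \<open>The eigenspaces of a nonscalar \<open>2 \<times> 2\<close> matrix are lines, and \<open>B\<close> preserves the eigenspaces of \<open>A\<close>.\<close>

lemma commuting_eigvec:
  assumes comm: "A \<cdot> B = B \<cdot> A" and "\<not> scalar A" "nonzero_mod x y" "eigvec A x y"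
  shows "eigvec B x y"
proof -
  obtain a b c d where A: "A = smat a b c d" by (rule smat_cases)
  obtain b1 b2 b3 b4 where B: "B = smat b1 b2 b3 b4" by (rule smat_cases)
  obtain k where k: "int p dvd a * x + b * y - k * x" "int p dvd c * x + d * y - k * y"
    using assms(4) by (auto simp: eigvec_def A)
  define u where "u = b1 * x + b2 * y"
  define v where "v = b3 * x + b4 * y"
  have h: "int p dvd a * b1 + b * b3 - (b1 * a + b2 * c)" "int p dvd a * b2 + b * b4 - (b1 * b + b2 * d)"
    "int p dvd c * b1 + d * b3 - (b3 * a + b4 * c)" "int p dvd c * b2 + d * b4 - (b3 * b + b4 * d)"
    using comm by (simp_all add: A B GL2_mult_smat mat_red_eq_iff)
  have k': "int p dvd a * u + b * v - k * u" "int p dvd c * u + d * v - k * v"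
    unfolding u_def v_def
    by (rule dvd_combination4[OF h(1,2) k, of _ x y b1 b2], simp add: algebra_simps)
      (rule dvd_combination4[OF h(3,4) k, of _ x y b3 b4], simp add: algebra_simps)
  have det: "int p dvd x * v - y * u"
  proof (rule ccontr)
    assume n: "\<not> int p dvd x * v - y * u"
    have "int p dvd (a - k) * (x * v - y * u)" by (rule dvd_combination2[OF k(1) k'(1), of _ v "- y"]) (simp add: algebra_simps)
    moreover have "int p dvd b * (x * v - y * u)" by (rule dvd_combination2[OF k(1) k'(1), of _ "- u" x]) (simp add: algebra_simps)
    moreover have "int p dvd c * (x * v - y * u)" by (rule dvd_combination2[OF k(2) k'(2), of _ v "- y"]) (simp add: algebra_simps)
    moreover have "int p dvd (d - k) * (x * v - y * u)" by (rule dvd_combination2[OF k(2) k'(2), of _ "- u" x]) (simp add: algebra_simps)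
    ultimately have s: "int p dvd a - k" "int p dvd b" "int p dvd c" "int p dvd d - k"
      using n by (simp_all add: dvd_mult_iff)
    have "int p dvd a - d" by (rule dvd_combination2[OF s(1,4), of _ 1 "- 1"]) simp
    then show False using s assms(2) by (simp add: scalar_def A)
  qed
  show ?thesis
  proof (cases "int p dvd x")
    case False
    then obtain i where i: "int p dvd x * i - 1" by (rule inverse_mod)
    have "int p dvd u - (u * i) * x" by (rule dvd_combination2[OF i i, of _ "- u" 0]) (simp add: algebra_simps)
    moreover have "int p dvd v - (u * i) * y"
      by (rule dvd_combination2[OF i det, of _ "- v" i]) (simp add: algebra_simps)
    ultimately show ?thesis by (auto simp: eigvec_def B u_def v_def)
  next
    case True
    then have "\<not> int p dvd y" using assms(3) by (simp add: nonzero_mod_def)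
    then obtain i where i: "int p dvd y * i - 1" by (rule inverse_mod)
    have "int p dvd u - (v * i) * x"
      by (rule dvd_combination2[OF i det, of _ "- u" "- i"]) (simp add: algebra_simps)
    moreover have "int p dvd v - (v * i) * y" by (rule dvd_combination2[OF i i, of _ "- v" 0]) (simp add: algebra_simps)
    ultimately show ?thesis by (auto simp: eigvec_def B u_def v_def)
  qed
qed

text \<open>An eigenvector of one nonscalar element would be a common eigenvector of all elements.\<close>

lemma irreducible_ex_no_eigvec:
  assumes K: "subgroup K (GL2 p)" and comm: "\<And>A B. A \<in> K \<Longrightarrow> B \<in> K \<Longrightarrow> A \<cdot> B = B \<cdot> A"
    and irr: "\<not> reducible p K"
  obtains A where "A \<in> K" "\<And>x y. nonzero_mod x y \<Longrightarrow> \<not> eigvec A x y"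
proof (cases "\<forall>A\<in>K. scalar A")
  case True
  have "nonzero_mod 1 0" using p_gt_1 by (simp add: nonzero_mod_def)
  then have "reducible p K"
    using reducible_iff[OF subgroup.subset[OF K]] True scalar_eigvec by blast
  then show ?thesis using irr by simp
next
  case False
  then obtain A where A: "A \<in> K" "\<not> scalar A" by blast
  show ?thesis
  proof (rule that[OF A(1)])
    fix x y assume xy: "nonzero_mod x y"
    show "\<not> eigvec A x y"
    proof
      assume "eigvec A x y"
      then have "\<forall>B\<in>K. eigvec B x y" using commuting_eigvec[OF comm[OF A(1)] A(2) xy] by blast
      then show False using irr xy reducible_iff[OF subgroup.subset[OF K]] by blast
    qed
  qed
qed

text \<open>The generators of a reducible image satisfy \<open>x\<^bsup>p - 1\<^esup> = 1\<close>, so it is an image of \<open>Z\<^sub>l \<times> Z\<^sub>m\<close>,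
  where \<open>l = gcd(cd, p - 1)\<close> and \<open>m = gcd(d, p - 1)\<close>.\<close>

lemma card_reducible_image_dvd:
  assumes K: "K \<in> hom_images (Qgrp c d) (GL2 p)" and red: "reducible p K"
    and cd: "0 < c" "0 < d" "\<not> p dvd c * d"
  shows "card K dvd gcd (c * d) (p - 1) * gcd d (p - 1)"
    and "A \<in> K \<Longrightarrow> A [^]\<^bsub>GL2 p\<^esub> (p - 1) = \<one>\<^bsub>GL2 p\<^esub>"
proof -
  let ?A = "(GL2 p)\<lparr>carrier := K\<rparr>"
  have sub: "subgroup K (GL2 p)"
    using hom_images_subgroup[OF comm_group.axioms(2)[OF comm_group_Qgrp] group_GL2 K] .
  interpret A: comm_group ?A by (rule comm_group_hom_image[OF comm_group_Qgrp group_GL2 K])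
  have pos: "0 < c * d" using cd by simp
  have "K \<in> hom_images (Zmn (c * d) d) ?A"
    using hom_images_restrict_iff[OF sub, where Q = "Qgrp c d"] K by (simp add: Qgrp_def)
  then obtain a b where ab: "a \<in> carrier ?A" "b \<in> carrier ?A" "A.ord a dvd c * d" "A.ord b dvd d" "K = A.span2 a b"
    using A.hom_images_DirProd_iff[OF pos cd(2)] by blast
  obtain h where h: "h \<in> hom (Qgrp c d) (GL2 p)" "K = h ` carrier (Qgrp c d)" using K by (auto simp: hom_images_def)
  interpret Q: comm_group "Qgrp c d" by (rule comm_group_Qgrp)
  interpret h: group_hom "Qgrp c d" "GL2 p" h by unfold_locales (rule h(1))
  obtain x y where xy: "nonzero_mod x y" "\<And>B. B \<in> K \<Longrightarrow> eigvec B x y"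
    using red reducible_iff[OF subgroup.subset[OF sub]] by blast
  show pow: "B [^]\<^bsub>GL2 p\<^esub> (p - 1) = \<one>\<^bsub>GL2 p\<^esub>" if B: "B \<in> K" for B
  proof -
    obtain z where z: "z \<in> carrier (Qgrp c d)" "B = h z" using B h(2) by blast
    have "z [^]\<^bsub>Qgrp c d\<^esub> (c * d) = \<one>\<^bsub>Qgrp c d\<^esub>"
      using ord_Qgrp_dvd[OF cd(1,2) z(1)] Q.pow_eq_id z(1) by blast
    then have "B [^]\<^bsub>GL2 p\<^esub> (c * d) = \<one>\<^bsub>GL2 p\<^esub>"
      using h.hom_nat_pow[OF z(1), of "c * d"] z(2) h.hom_one by simp
    then show ?thesis using eigvec_pow_eq_one[OF _ xy(1) xy(2)[OF B]] B subgroup.mem_carrier[OF sub] cd(3) by blast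
  qed
  have "A.ord z dvd p - 1" if z: "z \<in> carrier ?A" for z
    using pow[of z] z A.pow_eq_id[OF z] by (simp add: GL.nat_pow_consistent[symmetric])
  then have "A.ord a dvd gcd (c * d) (p - 1)" "A.ord b dvd gcd d (p - 1)" using ab by simp_all
  moreover have "0 < gcd (c * d) (p - 1)" "0 < gcd d (p - 1)" using cd by simp_all
  ultimately have "K \<in> hom_images (Zmn (gcd (c * d) (p - 1)) (gcd d (p - 1))) ?A"
    using A.span2_in_hom_images[OF ab(1,2)] ab(5) by simp
  then have "card K dvd order (Zmn (gcd (c * d) (p - 1)) (gcd d (p - 1)))"
    using card_hom_image_dvd[OF comm_group_Zmn A.is_group] by blast
  then show "card K dvd gcd (c * d) (p - 1) * gcd d (p - 1)"
    using order_Zmn[of "gcd (c * d) (p - 1)" "gcd d (p - 1)"] cd by simp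
qed

end

section \<open>Irreducible images\<close>

lemma QuadRes_mult_nonresidues:
  assumes "prime p" "2 < p" "\<not> QuadRes (int p) a" "\<not> QuadRes (int p) b"
  shows "QuadRes (int p) (a * b)"
proof -
  have leg: "Legendre x (int p) = -1" "\<not> int p dvd x" if "\<not> QuadRes (int p) x" for x
  proof -
    have "\<not> [x = 0] (mod int p)"
    proof
      assume "[x = 0] (mod int p)"
      then have "[0 ^ 2 = x] (mod int p)" by (simp add: cong_sym)
      then show False using that unfolding QuadRes_def by blast
    qed
    then show "Legendre x (int p) = -1" "\<not> int p dvd x" using that by (simp_all add: Legendre_def cong_0_iff)
  qed
  have "[Legendre (a * b) (int p) = (a * b) ^ ((p - 1) div 2)] (mod int p)"
    using euler_criterion[OF assms(1,2)] .
  moreover have "[a ^ ((p - 1) div 2) * b ^ ((p - 1) div 2) = (- 1) * (- 1)] (mod int p)"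
    using euler_criterion[OF assms(1,2), of a] euler_criterion[OF assms(1,2), of b] leg assms(3,4)
    by (intro cong_mult) (auto simp: cong_sym)
  ultimately have "[Legendre (a * b) (int p) = 1] (mod int p)"
    by (metis cong_trans mult_minus1_right minus_minus power_mult_distrib)
  then have "int p dvd Legendre (a * b) (int p) - 1" by (simp add: cong_iff_dvd_diff)
  moreover have "\<not> int p dvd 2" using assms(2) by (auto dest: zdvd_imp_le)
  ultimately have "Legendre (a * b) (int p) \<noteq> - 1" by auto
  then show ?thesis using leg(1)[of "a * b"] by blast
qed

context prime_modulus
begin

text \<open>The map \<open>x \<mapsto> x\<^sup>2 - x\<close> identifies \<open>0\<close> and \<open>1\<close>, so it is not onto \<open>F\<^sub>p\<close>; this works for
  every prime, including \<open>2\<close>.\<close>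

lemma ex_irreducible_quadratic: "\<exists>D. \<forall>r. \<not> int p dvd r * r - r + D"
proof (rule ccontr)
  assume "\<nexists>D. \<forall>r. \<not> int p dvd r * r - r + D"
  then have *: "\<exists>r. int p dvd r * r - r + D" for D by blast
  define f where "f r = (r * r - r) mod int p" for r
  have f_mod: "f (r mod int p) = f r" for r
    unfolding f_def by (metis mod_diff_left_eq mod_diff_right_eq mod_mult_eq)
  have "f ` {0..<int p} = {0..<int p}"
  proof (intro equalityI subsetI)
    fix z assume z: "z \<in> {0..<int p}"
    obtain r where "int p dvd r * r - r + (- z)" using * by blast
    then have "f r = z mod int p" unfolding f_def by (simp add: mod_eq_dvd_iff)
    then have "f (r mod int p) = z" using z f_mod by simp
    moreover have "r mod int p \<in> {0..<int p}" by simp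
    ultimately show "z \<in> f ` {0..<int p}" by blast
  qed (auto simp: f_def)
  then have "inj_on f {0..<int p}" by (intro eq_card_imp_inj_on) simp_all
  moreover have "f 0 = f 1" by (simp add: f_def)
  ultimately have "(0::int) = 1" by (rule inj_onD) (use p_gt_1 in auto)
  then show False by simp
qed

end

text \<open>The quadratic extension of \<open>F\<^sub>p\<close>: the pair \<open>(x, y)\<close> stands for \<open>x + y w\<close> with
  \<open>w\<^sup>2 = w - D\<close>.\<close>

locale quadratic_extension = prime_modulus +
  fixes D :: int
  assumes no_root: "\<And>r. \<not> int p dvd r * r - r + D"
begin

lemma residue_dvd_imp_0: "z \<in> {0..<int p} \<Longrightarrow> int p dvd z \<Longrightarrow> z = 0"
  by (metis atLeastLessThan_iff dvd_imp_mod_0 mod_pos_pos_trivial)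

definition Fq :: "(int \<times> int) ring" where
  "Fq = \<lparr>carrier = {0..<int p} \<times> {0..<int p},
     monoid.mult = (\<lambda>(x, y) (x', y'). ((x * x' - D * y * y') mod int p, (x * y' + y * x' + y * y') mod int p)),
     one = (1, 0), zero = (0, 0),
     add = (\<lambda>(x, y) (x', y'). ((x + x') mod int p, (y + y') mod int p))\<rparr>"

text \<open>Multiplication by \<open>x + y w\<close> in the basis \<open>1, w\<close>.\<close>

definition emb :: "int \<times> int \<Rightarrow> int ^ 2 ^ 2" where
  "emb = (\<lambda>(x, y). mat_red p (smat x (- D * y) y (x + y)))"

lemma Fq_simps:
  "carrier Fq = {0..<int p} \<times> {0..<int p}" "\<one>\<^bsub>Fq\<^esub> = (1, 0)" "\<zero>\<^bsub>Fq\<^esub> = (0, 0)"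
  "(x, y) \<otimes>\<^bsub>Fq\<^esub> (x', y') = ((x * x' - D * y * y') mod int p, (x * y' + y * x' + y * y') mod int p)"
  "(x, y) \<oplus>\<^bsub>Fq\<^esub> (x', y') = ((x + x') mod int p, (y + y') mod int p)"
  by (simp_all add: Fq_def)

lemma emb_mod: "emb (x mod int p, y mod int p) = mat_red p (smat x (- D * y) y (x + y))"
proof -
  have "int p dvd x mod int p - x" "int p dvd y mod int p - y" by (simp_all add: mod_eq_dvd_iff[symmetric])
  note h = this
  have "int p dvd - D * (y mod int p) - (- D * y)" by (rule dvd_combination2[OF h, of _ 0 "- D"]) (simp add: algebra_simps)
  moreover have "int p dvd (x mod int p + y mod int p) - (x + y)" by (rule dvd_combination2[OF h, of _ 1 1]) simp
  ultimately show ?thesis using h by (simp add: emb_def mat_red_eq_iff)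
qed

lemma emb_mult: "emb (u \<otimes>\<^bsub>Fq\<^esub> v) = emb u \<cdot> emb v"
proof -
  obtain x y x' y' where uv: "u = (x, y)" "v = (x', y')" by fastforce
  have "emb (u \<otimes>\<^bsub>Fq\<^esub> v) = mat_red p (smat (x * x' - D * y * y') (- D * (x * y' + y * x' + y * y'))
      (x * y' + y * x' + y * y') ((x * x' - D * y * y') + (x * y' + y * x' + y * y')))"
    unfolding uv Fq_simps emb_mod ..
  also have "\<dots> = emb u \<cdot> emb v"
    by (simp add: uv emb_def GL2_simps mat_red_mult smat_mult algebra_simps)
  finally show ?thesis .
qed

lemma emb_inj: "inj_on emb (carrier Fq)"
  by (auto simp: inj_on_def emb_def mat_red_smat Fq_simps)

lemma Fq_mult_closed: "u \<in> carrier Fq \<Longrightarrow> v \<in> carrier Fq \<Longrightarrow> u \<otimes>\<^bsub>Fq\<^esub> v \<in> carrier Fq"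
  by (auto simp: Fq_simps)

lemma norm_nonzero:
  assumes "nonzero_mod x y"
  shows "\<not> int p dvd x * x + x * y + D * y * y"
proof
  assume h: "int p dvd x * x + x * y + D * y * y"
  show False
  proof (cases "int p dvd y")
    case True
    have "int p dvd x * x" by (rule dvd_combination2[OF h True, of _ 1 "- x - D * y"]) (simp add: algebra_simps)
    then show False using True assms by (simp add: dvd_mult_iff nonzero_mod_def)
  next
    case False
    then obtain i where i: "int p dvd y * i - 1" by (rule inverse_mod)
    define r where "r = - (x * i)"
    have "int p dvd r * r - r + D"
      by (rule dvd_combination2[OF h i, of _ "i * i" "- (x * i) - D * (y * i) - D"])
        (simp add: r_def algebra_simps)
    then show False using no_root by blast
  qed
qed

lemma field_Fq: "field Fq"
proof -
  have "abelian_group Fq"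
  proof (rule abelian_groupI)
    fix u assume "u \<in> carrier Fq"
    then obtain x y where "u = (x, y)" by fastforce
    then have "((- x) mod int p, (- y) mod int p) \<oplus>\<^bsub>Fq\<^esub> u = \<zero>\<^bsub>Fq\<^esub>"
      by (simp add: Fq_simps mod_add_left_eq)
    moreover have "((- x) mod int p, (- y) mod int p) \<in> carrier Fq" by (simp add: Fq_simps)
    ultimately show "\<exists>v\<in>carrier Fq. v \<oplus>\<^bsub>Fq\<^esub> u = \<zero>\<^bsub>Fq\<^esub>" by blast
  qed (auto simp: Fq_simps mod_add_left_eq mod_add_right_eq algebra_simps)
  moreover have cm: "comm_monoid Fq"
  proof (rule comm_monoidI)
    fix u v w assume u: "u \<in> carrier Fq" "v \<in> carrier Fq" "w \<in> carrier Fq"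
    have "emb (u \<otimes>\<^bsub>Fq\<^esub> v \<otimes>\<^bsub>Fq\<^esub> w) = emb (u \<otimes>\<^bsub>Fq\<^esub> (v \<otimes>\<^bsub>Fq\<^esub> w))"
      by (simp add: emb_mult GL2_simps mat_red_mult matrix_mul_assoc)
    then show "u \<otimes>\<^bsub>Fq\<^esub> v \<otimes>\<^bsub>Fq\<^esub> w = u \<otimes>\<^bsub>Fq\<^esub> (v \<otimes>\<^bsub>Fq\<^esub> w)"
      using emb_inj u Fq_mult_closed by (metis inj_onD)
  qed (use p_gt_1 in \<open>auto simp: Fq_simps algebra_simps\<close>)
  moreover have "(u \<oplus>\<^bsub>Fq\<^esub> v) \<otimes>\<^bsub>Fq\<^esub> w = u \<otimes>\<^bsub>Fq\<^esub> w \<oplus>\<^bsub>Fq\<^esub> v \<otimes>\<^bsub>Fq\<^esub> w" for u v w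
  proof -
    obtain x y x' y' z t where uv: "u = (x, y)" "v = (x', y')" "w = (z, t)" by fastforce
    let ?X = "(x + x') mod int p" and ?Y = "(y + y') mod int p"
    have h: "int p dvd ?X - (x + x')" "int p dvd ?Y - (y + y')" by (simp_all add: mod_eq_dvd_iff[symmetric])
    have "(?X * z - D * ?Y * t) mod int p = ((x * z - D * y * t) + (x' * z - D * y' * t)) mod int p"
      unfolding mod_eq_dvd_iff by (rule dvd_combination2[OF h, of _ z "- D * t"]) (simp add: algebra_simps)
    moreover have "(?X * t + ?Y * z + ?Y * t) mod int p = ((x * t + y * z + y * t) + (x' * t + y' * z + y' * t)) mod int p"
      unfolding mod_eq_dvd_iff by (rule dvd_combination2[OF h, of _ t "z + t"]) (simp add: algebra_simps)
    ultimately show ?thesis by (simp add: uv Fq_simps mod_add_eq)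
  qed
  ultimately have "cring Fq" by (rule cringI)
  then interpret cring Fq .
  show ?thesis
  proof (rule cring_fieldI2)
    show "\<zero>\<^bsub>Fq\<^esub> \<noteq> \<one>\<^bsub>Fq\<^esub>" by (simp add: Fq_simps)
    fix u assume u: "u \<in> carrier Fq" "u \<noteq> \<zero>\<^bsub>Fq\<^esub>"
    obtain x y where xy: "u = (x, y)" by fastforce
    have "nonzero_mod x y" using u xy residue_dvd_imp_0[of x] residue_dvd_imp_0[of y] by (auto simp: nonzero_mod_def Fq_simps)
    then obtain k where k: "int p dvd (x * x + x * y + D * y * y) * k - 1"
      using norm_nonzero inverse_mod by metis
    let ?X = "((x + y) * k) mod int p" and ?Y = "(- y * k) mod int p"
    have h: "int p dvd ?X - (x + y) * k" "int p dvd ?Y - (- y * k)" by (simp_all only: mod_eq_dvd_iff[symmetric] mod_mod_trivial)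
    have "(x * ?X - D * y * ?Y) mod int p = 1 mod int p"
      unfolding mod_eq_dvd_iff
      by (rule dvd_combination4[OF h k k, of _ x "- D * y" 1 0]) (simp add: algebra_simps)
    moreover have "(x * ?Y + y * ?X + y * ?Y) mod int p = 0 mod int p"
      unfolding mod_eq_dvd_iff
      by (rule dvd_combination2[OF h, of _ y "x + y"]) (simp add: algebra_simps)
    ultimately have "u \<otimes>\<^bsub>Fq\<^esub> (?X, ?Y) = \<one>\<^bsub>Fq\<^esub>" using p_gt_1 unfolding xy Fq_simps by simp
    moreover have "(?X, ?Y) \<in> carrier Fq" by (simp add: Fq_simps)
    ultimately show "\<exists>v\<in>carrier Fq. u \<otimes>\<^bsub>Fq\<^esub> v = \<one>\<^bsub>Fq\<^esub>" by blast
  qed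
qed

abbreviation "E \<equiv> mult_of Fq"

lemma carrier_E: "carrier E = {(x, y). x \<in> {0..<int p} \<and> y \<in> {0..<int p} \<and> (x, y) \<noteq> (0, 0)}"
  by (auto simp: Fq_simps)

lemma comm_group_E: "comm_group E"
proof -
  interpret field Fq by (rule field_Fq)
  show ?thesis using units_comm_group mult_of_is_Units by simp
qed

sublocale E: comm_group E by (rule comm_group_E)

lemma finite_E: "finite (carrier E)"
  by (rule finite_subset[of _ "{0..<int p} \<times> {0..<int p}"]) (auto simp: Fq_simps)

lemma order_E: "order E = (p - 1) * (p + 1)"
proof -
  have "order E = p * p - 1"
    by (simp add: order_def Fq_simps card_cartesian_product)
  then show ?thesis by (simp add: algebra_simps)
qed

lemma E_cyclic: obtains g where "g \<in> carrier E" "carrier E = range (\<lambda>i::nat. g [^]\<^bsub>E\<^esub> i)"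
proof -
  interpret field Fq by (rule field_Fq)
  have "finite (carrier Fq)" by (simp add: Fq_simps)
  then obtain g where g: "g \<in> carrier E" "carrier E = {g [^]\<^bsub>Fq\<^esub> i | i::nat. i \<in> UNIV}"
    using finite_field_mult_group_has_gen by blast
  have "carrier E = range (\<lambda>i::nat. g [^]\<^bsub>E\<^esub> i)"
    unfolding g(2) nat_pow_mult_of by blast
  then show thesis using that g(1) by blast
qed

lemma emb_hom: "emb \<in> hom E (GL2 p)"
proof (rule homI)
  fix u assume u: "u \<in> carrier E"
  then obtain x y where xy: "u = (x, y)" by fastforce
  then have "nonzero_mod x y" using u residue_dvd_imp_0 unfolding carrier_E nonzero_mod_def by auto
  moreover have "x * (x + y) - (- D * y) * y = x * x + x * y + D * y * y" by (simp add: algebra_simps)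
  ultimately have "\<not> int p dvd x * (x + y) - (- D * y) * y" using norm_nonzero by simp
  then show "emb u \<in> carrier (GL2 p)" using smat_in_GL2_iff xy by (simp add: emb_def)
qed (simp add: emb_mult)

sublocale emb: group_hom E "GL2 p" emb
  by unfold_locales (rule emb_hom)

lemma emb_inj_E: "inj_on emb (carrier E)"
  using emb_inj by (rule inj_on_subset) auto

end

lemma (in group) inv_mult_cancel: "x \<in> carrier G \<Longrightarrow> y \<in> carrier G \<Longrightarrow> inv x \<otimes> (x \<otimes> y) = y"
  by (simp add: m_assoc[symmetric])

context prime_modulus
begin

lemma mat_red_eq_combination:
  assumes "int p dvd a - a'" "int p dvd b - b'" "int p dvd c - c'" "int p dvd d - d'"
  shows "mat_red p (smat a b c d) = mat_red p (smat a' b' c' d')"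
  using assms by (simp add: mat_red_eq_iff)

text \<open>In the basis formed by the first unit vector \<open>e\<close> and \<open>A e\<close> the matrix \<open>A\<close> becomes the companion
  matrix of its characteristic polynomial, which only depends on trace and determinant.\<close>

lemma companion_conj:
  assumes "\<not> int p dvd c"
  obtains g where "g \<in> carrier (GL2 p)"
    "mat_red p (smat a b c d) \<cdot> g = g \<cdot> mat_red p (smat 0 (- (a * d - b * c)) 1 (a + d))"
proof
  let ?g = "mat_red p (smat 1 a 0 c)"
  show "?g \<in> carrier (GL2 p)" using assms by (simp add: smat_in_GL2_iff)
  show "mat_red p (smat a b c d) \<cdot> ?g = ?g \<cdot> mat_red p (smat 0 (- (a * d - b * c)) 1 (a + d))"
    by (simp add: GL2_simps mat_red_mult smat_mult algebra_simps)
qed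

lemma same_char_poly_conj:
  assumes c: "\<not> int p dvd c" "\<not> int p dvd c'" and det: "\<not> int p dvd a * d - b * c"
    and same: "int p dvd (a + d) - (a' + d')" "int p dvd (a * d - b * c) - (a' * d' - b' * c')"
  obtains h where "h \<in> carrier (GL2 p)"
    "mat_red p (smat a' b' c' d') = h \<cdot> mat_red p (smat a b c d) \<cdot> inv\<^bsub>GL2 p\<^esub> h"
proof -
  define A where "A = mat_red p (smat a b c d)"
  define A' where "A' = mat_red p (smat a' b' c' d')"
  define C where "C = mat_red p (smat 0 (- (a * d - b * c)) 1 (a + d))"
  have C': "C = mat_red p (smat 0 (- (a' * d' - b' * c')) 1 (a' + d'))"
    unfolding C_def
  proof (rule mat_red_eq_combination)
    have "- (a * d - b * c) - - (a' * d' - b' * c') = - ((a * d - b * c) - (a' * d' - b' * c'))" by simp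
    then show "int p dvd - (a * d - b * c) - - (a' * d' - b' * c')" using same(2) by (simp only: dvd_minus_iff)
  qed (use same in simp_all)
  have A: "A \<in> carrier (GL2 p)" unfolding A_def using det by (simp add: smat_in_GL2_iff)
  have "\<not> int p dvd a' * d' - b' * c'"
  proof
    assume "int p dvd a' * d' - b' * c'"
    then have "int p dvd ((a * d - b * c) - (a' * d' - b' * c')) + (a' * d' - b' * c')" using same(2) dvd_add by blast
    then show False using det by simp
  qed
  then have A': "A' \<in> carrier (GL2 p)" unfolding A'_def by (simp add: smat_in_GL2_iff)
  have CG: "C \<in> carrier (GL2 p)" unfolding C_def using det by (simp add: smat_in_GL2_iff)
  obtain g where g: "g \<in> carrier (GL2 p)" "A \<cdot> g = g \<cdot> C"
    using companion_conj[OF c(1), of a b d] unfolding A_def C_def by blast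
  obtain g' where g': "g' \<in> carrier (GL2 p)" "A' \<cdot> g' = g' \<cdot> C"
    using companion_conj[OF c(2), of a' b' d'] unfolding A'_def C' by blast
  have gC: "C = inv\<^bsub>GL2 p\<^esub> g \<cdot> A \<cdot> g"
    using g A CG by (simp add: GL.m_assoc GL.inv_solve_left)
  have "A' = g' \<cdot> C \<cdot> inv\<^bsub>GL2 p\<^esub> g'"
    using g' A' CG by (simp add: GL.inv_solve_right)
  also have "\<dots> = (g' \<cdot> inv\<^bsub>GL2 p\<^esub> g) \<cdot> A \<cdot> inv\<^bsub>GL2 p\<^esub> (g' \<cdot> inv\<^bsub>GL2 p\<^esub> g)"
    unfolding gC using g(1) g'(1) A by (simp add: GL.m_assoc GL.inv_mult_group)
  finally show thesis using that[of "g' \<cdot> inv\<^bsub>GL2 p\<^esub> g"] g(1) g'(1) unfolding A_def A'_def by blast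
qed

lemma no_eigvec_char_poly:
  assumes no: "\<And>x y. nonzero_mod x y \<Longrightarrow> \<not> eigvec (smat a b c d) x y"
  shows "\<not> int p dvd c" and "\<not> int p dvd r * r - (a + d) * r + (a * d - b * c)"
proof -
  show c: "\<not> int p dvd c"
  proof
    assume "int p dvd c"
    then have "int p dvd a * 1 + b * 0 - a * 1" "int p dvd c * 1 + d * 0 - a * 0" by simp_all
    then have "eigvec (smat a b c d) 1 0" unfolding eigvec_def smat_entries by blast
    moreover have "nonzero_mod 1 0" using p_gt_1 by (simp add: nonzero_mod_def)
    ultimately show False using no by blast
  qed
  show "\<not> int p dvd r * r - (a + d) * r + (a * d - b * c)"
  proof
    assume h: "int p dvd r * r - (a + d) * r + (a * d - b * c)"
    have "int p dvd a * (r - d) + b * c - r * (r - d)"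
      by (rule dvd_combination2[OF h h, of _ "- 1" 0]) (simp add: algebra_simps)
    moreover have "int p dvd c * (r - d) + d * c - r * c" by (simp add: algebra_simps)
    ultimately have "eigvec (smat a b c d) (r - d) c" unfolding eigvec_def smat_entries by blast
    moreover have "nonzero_mod (r - d) c" using c by (simp add: nonzero_mod_def)
    ultimately show False using no by blast
  qed
qed

lemma QuadRes_discriminant_imp_root:
  assumes "2 < p" "QuadRes (int p) (T * T - 4 * \<Delta>)"
  shows "\<exists>r. int p dvd r * r - T * r + \<Delta>"
proof -
  obtain z where "[z ^ 2 = T * T - 4 * \<Delta>] (mod int p)" using assms(2) by (auto simp: QuadRes_def)
  then have z: "int p dvd z * z - (T * T - 4 * \<Delta>)" by (simp add: cong_iff_dvd_diff power2_eq_square)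
  have n2: "\<not> int p dvd 2" using assms(1) by (auto dest: zdvd_imp_le)
  then obtain i where i: "int p dvd 2 * i - 1" by (rule inverse_mod)
  define r where "r = (T + z) * i"
  have "int p dvd 2 * (2 * (r * r - T * r + \<Delta>))"
    by (rule dvd_combination2[OF z i, of _ 1 "(T + z) * (2 * z + (T + z) * (2 * i - 1))"])
      (simp add: r_def algebra_simps)
  then have "int p dvd r * r - T * r + \<Delta>" using n2 by (simp only: dvd_mult_iff) simp
  then show ?thesis by blast
qed

end

lemma hom_images_conj_rel:
  assumes "group G" "(K, K') \<in> conj_rel G" "K \<in> hom_images Q G"
  shows "K' \<in> hom_images Q G"
proof -
  interpret group G by fact
  have K: "subgroup K G" using assms(2) by (simp add: conj_rel_def)
  obtain g where g: "g \<in> carrier G" "K' = conjugation G g ` K"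
    using assms(2) conj_rel_iff[OF K] by blast
  obtain h where h: "h \<in> hom Q G" "K = h ` carrier Q" using assms(3) by (auto simp: hom_images_def)
  have "(conjugation G g) \<in> hom G G"
    using g(1) by (auto simp: hom_def m_assoc inv_solve_left)
  then have "(conjugation G g) \<circ> h \<in> hom Q G" by (rule Group.hom_compose[OF h(1)])
  moreover have "((conjugation G g) \<circ> h) ` carrier Q = K'"
    unfolding g(2) h(2) by (simp add: image_comp)
  ultimately show ?thesis unfolding hom_images_def by blast
qed

context quadratic_extension
begin

text \<open>For odd \<open>p\<close> the discriminant of a quadratic polynomial without roots and the discriminant
  \<open>1 - 4 D\<close> of \<open>w\<close> are both nonresidues, so they differ by a square factor \<open>y\<^sup>2\<close>. For \<open>p = 2\<close> there is
  only one monic quadratic polynomial without roots.\<close>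

lemma ex_same_char_poly:
  assumes nr: "\<And>r. \<not> int p dvd r * r - T * r + \<Delta>"
  obtains x y where "\<not> int p dvd y" "int p dvd (2 * x + y) - T" "int p dvd (x * x + x * y + D * y * y) - \<Delta>"
proof -
  have "\<exists>x y. int p dvd (2 * x + y) - T \<and> int p dvd (x * x + x * y + D * y * y) - \<Delta>"
  proof (cases "p = 2")
    case True
    have "odd \<Delta>" "odd (1 - T + \<Delta>)" "odd D" using nr[of 0] nr[of 1] no_root[of 0] True by simp_all
    then have "int p dvd (2 * 0 + 1) - T" "int p dvd (0 * 0 + 0 * 1 + D * 1 * 1) - \<Delta>" using True by simp_all
    then show ?thesis by blast
  next
    case False
    then have p2: "2 < p" using prime_ge_2_nat[OF p] by simp
    have n2: "\<not> int p dvd 2" using p2 by (auto dest: zdvd_imp_le)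
    then obtain i where i: "int p dvd 2 * i - 1" by (rule inverse_mod)
    let ?a = "T * T - 4 * \<Delta>" and ?b = "1 - 4 * D"
    have na: "\<not> QuadRes (int p) ?a" using QuadRes_discriminant_imp_root[OF p2] nr by blast
    have nb: "\<not> QuadRes (int p) ?b"
    proof
      assume "QuadRes (int p) ?b"
      then have "QuadRes (int p) (1 * 1 - 4 * D)" by simp
      from QuadRes_discriminant_imp_root[OF p2 this] obtain r where "int p dvd r * r - 1 * r + D" by blast
      then show False using no_root[of r] by simp
    qed
    have "\<not> int p dvd ?b"
    proof
      assume "int p dvd ?b"
      then have "[0 ^ 2 = ?b] (mod int p)" by (simp add: cong_iff_dvd_diff dvd_diff_commute)
      then show False using nb unfolding QuadRes_def by blast
    qed
    then obtain j where j: "int p dvd ?b * j - 1" by (rule inverse_mod)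
    obtain z where "[z ^ 2 = ?a * ?b] (mod int p)"
      using QuadRes_mult_nonresidues[OF p p2 na nb] by (auto simp: QuadRes_def)
    then have z: "int p dvd z * z - ?a * ?b" by (simp add: cong_iff_dvd_diff power2_eq_square)
    define y where "y = z * j"
    define x where "x = (T - y) * i"
    have "int p dvd (2 * x + y) - T"
      by (rule dvd_combination2[OF i i, of _ "T - y" 0]) (simp add: x_def algebra_simps)
    moreover have "int p dvd 2 * (2 * ((x * x + x * y + D * y * y) - \<Delta>))"
    proof -
      \<comment> \<open>The error terms \<open>q\<close>, \<open>f\<close> and \<open>e\<close> of the three congruences are divisible by \<open>p\<close>.\<close>
      define q where "q = 2 * i - 1"
      define f where "f = ?b * j - 1"
      define e where "e = z * z - ?a * ?b"
      have 1: "2 * x = (T - y) + (T - y) * q" by (simp add: x_def q_def algebra_simps)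
      have "2 * (2 * ((x * x + x * y + D * y * y) - \<Delta>)) = (2 * x) * (2 * x) + 2 * (2 * x) * y + 4 * D * y * y - 4 * \<Delta>"
        by (simp add: algebra_simps)
      also have "\<dots> = (?a - ?b * (y * y)) + (T - y) * (2 * T + (T - y) * q) * q"
        unfolding 1 by (simp add: algebra_simps)
      also have "?b * (y * y) = (z * z) * (?b * j) * j" by (simp add: y_def algebra_simps)
      also have "z * z = ?a * ?b + e" by (simp add: e_def)
      also have "(?a * ?b + e) * (?b * j) * j = ?a * ((?b * j) * (?b * j)) + e * (?b * j) * j"
        by (simp add: algebra_simps)
      also have "?b * j = 1 + f" by (simp add: f_def)
      finally have "2 * (2 * ((x * x + x * y + D * y * y) - \<Delta>)) =
        (- ?a * (2 + f)) * f + (- (1 + f) * j) * e + (T - y) * (2 * T + (T - y) * q) * q"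
        by (simp add: algebra_simps)
      moreover have "int p dvd f" "int p dvd e" "int p dvd q" using i j z by (simp_all add: f_def e_def q_def)
      ultimately show ?thesis by simp
    qed
    then have "int p dvd (x * x + x * y + D * y * y) - \<Delta>" using n2 by (simp only: dvd_mult_iff) simp
    ultimately show ?thesis by blast
  qed
  then obtain x y where xy: "int p dvd (2 * x + y) - T" "int p dvd (x * x + x * y + D * y * y) - \<Delta>" by blast
  \<comment> \<open>For \<open>y \<equiv> 0\<close> the number \<open>x\<close> would be a root.\<close>
  have "\<not> int p dvd y"
  proof
    assume y: "int p dvd y"
    have "int p dvd x * x - T * x + \<Delta>"
      by (rule dvd_combination4[OF xy(2,1) y y, of _ "- 1" x "D * y" 0]) (simp add: algebra_simps)
    then show False using nr by blast
  qed
  then show thesis using that xy by blast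
qed

text \<open>Since \<open>y\<close> is invertible, comparing the entries of both products expresses \<open>B\<close> as a combination of
  the matrices of \<open>1\<close> and \<open>w\<close>.\<close>

lemma commuting_imp_in_emb:
  assumes y: "\<not> int p dvd y" and B: "B \<in> carrier (GL2 p)"
    and comm: "mat_red p (smat x (- D * y) y (x + y)) \<cdot> B = B \<cdot> mat_red p (smat x (- D * y) y (x + y))"
  shows "B \<in> emb ` carrier E"
proof -
  obtain a b c d where B': "B = smat a b c d" "B = mat_red p (smat a b c d)" "\<not> int p dvd a * d - b * c"
    using GL2_cases[OF B] by metis
  have "mat_red p (smat x (- D * y) y (x + y) ** smat a b c d) = mat_red p (smat a b c d ** smat x (- D * y) y (x + y))"
    using comm unfolding B'(1) GL2_simps mat_red_mult .
  then have h: "int p dvd (x * a + - D * y * c) - (a * x + b * y)" "int p dvd (y * a + (x + y) * c) - (c * x + d * y)"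
    unfolding smat_mult mat_red_eq_iff by simp_all
  have "int p dvd y * (b - - D * c)" by (rule dvd_combination2[OF h, of _ "- 1" 0]) (simp add: algebra_simps)
  moreover have "int p dvd y * (d - (a + c))" by (rule dvd_combination2[OF h, of _ 0 "- 1"]) (simp add: algebra_simps)
  ultimately have bd: "int p dvd b - - D * c" "int p dvd d - (a + c)" using y by (simp_all only: dvd_mult_iff) simp_all
  have "B = mat_red p (smat a (- D * c) c (a + c))"
    unfolding B'(2) by (rule mat_red_eq_combination) (use bd in simp_all)
  then have "B = emb (a, c)" by (simp add: emb_def)
  moreover have "(a, c) \<in> carrier E"
  proof -
    have "a \<in> {0..<int p}" "c \<in> {0..<int p}" using GL2_carrier_mat2[OF B] unfolding B'(1) by simp_all
    moreover have "(a, c) \<noteq> (0, 0)" using B'(3) by auto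
    ultimately show ?thesis unfolding carrier_E by simp
  qed
  ultimately show ?thesis by blast
qed

lemma irreducible_conj_into_E:
  assumes K: "subgroup K (GL2 p)" and comm: "\<And>A B. A \<in> K \<Longrightarrow> B \<in> K \<Longrightarrow> A \<cdot> B = B \<cdot> A"
    and irr: "\<not> reducible p K"
  obtains K0 where "K0 \<subseteq> carrier E" "(K, emb ` K0) \<in> conj_rel (GL2 p)"
proof -
  obtain A where A: "A \<in> K" "\<And>x y. nonzero_mod x y \<Longrightarrow> \<not> eigvec A x y"
    using irreducible_ex_no_eigvec[OF K comm irr] by blast
  have AG: "A \<in> carrier (GL2 p)" using A(1) subgroup.mem_carrier[OF K] by blast
  obtain a b c d where A': "A = smat a b c d" "A = mat_red p (smat a b c d)" "\<not> int p dvd a * d - b * c"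
    using GL2_cases[OF AG] by metis
  have no: "\<not> eigvec (smat a b c d) x y" if "nonzero_mod x y" for x y
    using A(2)[OF that] A'(1) by simp
  note ch = no_eigvec_char_poly[of a b c d, OF no]
  obtain x y where xy: "\<not> int p dvd y" "int p dvd (2 * x + y) - (a + d)"
    "int p dvd (x * x + x * y + D * y * y) - (a * d - b * c)"
  proof (rule ex_same_char_poly[of "a + d" "a * d - b * c"])
    show "\<not> int p dvd r * r - (a + d) * r + (a * d - b * c)" for r by (rule ch(2))
  qed (rule that)
  define A0 where "A0 = mat_red p (smat x (- D * y) y (x + y))"
  have same: "int p dvd (a + d) - (x + (x + y))" "int p dvd (a * d - b * c) - (x * (x + y) - (- D * y) * y)"
    by (rule dvd_combination2[OF xy(2,3), of _ "- 1" 0], simp add: algebra_simps)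
      (rule dvd_combination2[OF xy(2,3), of _ 0 "- 1"], simp add: algebra_simps)
  obtain h where h: "h \<in> carrier (GL2 p)" "A0 = h \<cdot> A \<cdot> inv\<^bsub>GL2 p\<^esub> h"
    using same_char_poly_conj[OF ch(1) xy(1) A'(3) same] A'(2) unfolding A0_def by metis
  define K' where "K' = conjugation (GL2 p) h ` K"
  have conj: "(K, K') \<in> conj_rel (GL2 p)" using GL.conj_rel_iff[OF K] h(1) K'_def by blast
  have "K' \<subseteq> emb ` carrier E"
  proof
    fix B assume "B \<in> K'"
    then obtain B0 where B0: "B0 \<in> K" "B = h \<cdot> B0 \<cdot> inv\<^bsub>GL2 p\<^esub> h" unfolding K'_def by blast
    have B0G: "B0 \<in> carrier (GL2 p)" using B0(1) subgroup.mem_carrier[OF K] by blast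
    have mult: "(h \<cdot> X \<cdot> inv\<^bsub>GL2 p\<^esub> h) \<cdot> (h \<cdot> Y \<cdot> inv\<^bsub>GL2 p\<^esub> h)
        = h \<cdot> (X \<cdot> Y) \<cdot> inv\<^bsub>GL2 p\<^esub> h"
      if "X \<in> carrier (GL2 p)" "Y \<in> carrier (GL2 p)" for X Y
      using that h(1) by (simp add: GL.m_assoc GL.inv_mult_cancel)
    have "A0 \<cdot> B = B \<cdot> A0"
      unfolding h(2) B0(2) mult[OF AG B0G] mult[OF B0G AG] using comm[OF A(1) B0(1)] by simp
    moreover have "B \<in> carrier (GL2 p)" using B0 B0G h(1) by simp
    ultimately show "B \<in> emb ` carrier E" using commuting_imp_in_emb[OF xy(1)] unfolding A0_def by blast
  qed
  then obtain K0 where "K0 \<subseteq> carrier E" "K' = emb ` K0" using subset_imageE by metis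
  then show thesis using that conj by blast
qed

lemma hom_images_emb_iff:
  assumes "group Q" "K0 \<subseteq> carrier E"
  shows "emb ` K0 \<in> hom_images Q (GL2 p) \<longleftrightarrow> K0 \<in> hom_images Q E"
proof
  assume "K0 \<in> hom_images Q E"
  then obtain h where h: "h \<in> hom Q E" "K0 = h ` carrier Q" by (auto simp: hom_images_def)
  have "emb \<circ> h \<in> hom Q (GL2 p)" by (rule hom_compose[OF h(1) emb_hom])
  moreover have "(emb \<circ> h) ` carrier Q = emb ` K0" unfolding h(2) by (simp add: image_comp)
  ultimately show "emb ` K0 \<in> hom_images Q (GL2 p)" unfolding hom_images_def by blast
next
  interpret Q: group Q by fact
  assume "emb ` K0 \<in> hom_images Q (GL2 p)"
  then obtain h where h: "h \<in> hom Q (GL2 p)" "emb ` K0 = h ` carrier Q" by (auto simp: hom_images_def)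
  define f where "f x = inv_into (carrier E) emb (h x)" for x
  have f: "f x \<in> carrier E" "emb (f x) = h x" if "x \<in> carrier Q" for x
  proof -
    have "h x \<in> emb ` carrier E" using h(2) assms(2) that by blast
    then show "f x \<in> carrier E" "emb (f x) = h x"
      unfolding f_def by (rule inv_into_into, rule f_inv_into_f)
  qed
  have "f \<in> hom Q E"
  proof (rule homI)
    fix x y assume xy: "x \<in> carrier Q" "y \<in> carrier Q"
    have "emb (f (x \<otimes>\<^bsub>Q\<^esub> y)) = h x \<cdot> h y" using h(1) f(2) xy by (simp add: hom_mult)
    also have "\<dots> = emb (f x \<otimes>\<^bsub>E\<^esub> f y)" using f xy emb.hom_mult by simp
    finally show "f (x \<otimes>\<^bsub>Q\<^esub> y) = f x \<otimes>\<^bsub>E\<^esub> f y"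
      by (rule inj_onD[OF emb_inj_E]) (use f xy in blast)+
  qed (use f in blast)
  moreover have "f ` carrier Q = K0"
  proof -
    have "emb ` f ` carrier Q = emb ` K0" unfolding h(2) image_image using f(2) by (rule image_cong[OF refl])
    moreover have "f ` carrier Q \<subseteq> carrier E" using f(1) by blast
    ultimately show ?thesis using inj_on_image_eq_iff[OF emb_inj_E _ assms(2)] by simp
  qed
  ultimately show "K0 \<in> hom_images Q E" unfolding hom_images_def by blast
qed

definition roots :: "nat \<Rightarrow> (int \<times> int) set" where
  "roots r = {z \<in> carrier E. z [^]\<^bsub>E\<^esub> r = \<one>\<^bsub>E\<^esub>}"

lemma roots_hom_image:
  assumes "0 < c" "0 < d" "r dvd gcd (c * d) (order E)"
  shows "roots r \<in> hom_images (Qgrp c d) E" "card (roots r) = r"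
proof -
  obtain g where g: "g \<in> carrier E" "carrier E = range (\<lambda>i::nat. g [^]\<^bsub>E\<^esub> i)" by (rule E_cyclic)
  show "roots r \<in> hom_images (Qgrp c d) E" "card (roots r) = r"
    unfolding roots_def using E.hom_images_cyclic(1)[OF finite_E g assms] by simp_all
qed

lemma hom_image_E_eq_roots:
  assumes "0 < c" "0 < d" "K \<in> hom_images (Qgrp c d) E"
  shows "card K dvd gcd (c * d) (order E)" "K = roots (card K)"
proof -
  obtain g where g: "g \<in> carrier E" "carrier E = range (\<lambda>i::nat. g [^]\<^bsub>E\<^esub> i)" by (rule E_cyclic)
  show "card K dvd gcd (c * d) (order E)" "K = roots (card K)"
    unfolding roots_def using E.hom_images_cyclic(2)[OF finite_E g assms] by blast+
qed

text \<open>The \<open>p - 1\<close> nonzero elements of \<open>F\<^sub>p\<close> satisfy \<open>z\<^bsup>p - 1\<^esup> = 1\<close>, and this equation has only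
  \<open>p - 1\<close> solutions in \<open>E\<close>.\<close>

lemma roots_scalar:
  assumes "z \<in> roots (p - 1)"
  shows "snd z = 0"
proof -
  define S where "S = (\<lambda>x. (x, 0::int)) ` {1..<int p}"
  have SE: "S \<subseteq> carrier E" unfolding S_def carrier_E by auto
  have n: "\<not> p dvd order E"
  proof
    assume "p dvd order E"
    then have "int p dvd int (p - 1) * int (p + 1)" unfolding order_E by (simp only: int_dvd_int_iff of_nat_mult[symmetric])
    then have "int p dvd int p - 1 \<or> int p dvd int p + 1" using p_gt_1 by (simp only: dvd_mult_iff) (simp add: of_nat_diff)
    then show False
    proof
      assume "int p dvd int p - 1"
      then have "int p dvd int p - (int p - 1)" by (rule dvd_diff[OF dvd_refl])
      then show False using p_gt_1 by simp
    next
      assume "int p dvd int p + 1"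
      then have "int p dvd (int p + 1) - int p" by (rule dvd_diff[OF _ dvd_refl])
      then show False using p_gt_1 by simp
    qed
  qed
  have "S \<subseteq> roots (p - 1)"
  proof
    fix z assume z: "z \<in> S"
    then have zE: "z \<in> carrier E" using SE by blast
    obtain x where x: "z = (x, 0)" using z by (auto simp: S_def)
    have "eigvec (emb z) 1 0" by (rule scalar_eigvec) (simp add: scalar_def x emb_def mat_red_smat)
    moreover have "nonzero_mod 1 0" using p_gt_1 by (simp add: nonzero_mod_def)
    moreover have "emb z [^]\<^bsub>GL2 p\<^esub> order E = \<one>\<^bsub>GL2 p\<^esub>"
      using emb.hom_nat_pow[OF zE, of "order E"] E.pow_order_eq_1[OF zE] emb.hom_one by simp
    ultimately have "emb z [^]\<^bsub>GL2 p\<^esub> (p - 1) = \<one>\<^bsub>GL2 p\<^esub>"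
      using eigvec_pow_eq_one emb.hom_closed[OF zE] n by blast
    then have "emb (z [^]\<^bsub>E\<^esub> (p - 1)) = emb \<one>\<^bsub>E\<^esub>"
      using emb.hom_nat_pow[OF zE, of "p - 1"] emb.hom_one by simp
    then have "z [^]\<^bsub>E\<^esub> (p - 1) = \<one>\<^bsub>E\<^esub>"
      by (rule inj_onD[OF emb_inj_E _ E.nat_pow_closed[OF zE] E.one_closed])
    then show "z \<in> roots (p - 1)" using zE by (simp add: roots_def)
  qed
  moreover have "card S = p - 1" unfolding S_def by (simp add: card_image inj_on_def)
  moreover have "p - 1 dvd gcd ((p - 1) * 1) (order E)"
    unfolding order_E by (rule gcd_greatest) (simp_all only: mult_1_right dvd_refl dvd_triv_left)
  then have "card (roots (p - 1)) = p - 1"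
    by (rule roots_hom_image(2)[rotated 2]) (use prime_gt_1_nat[OF p] in simp_all)
  moreover have "finite (roots (p - 1))" using finite_E by (simp add: roots_def)
  ultimately have "S = roots (p - 1)" by (metis card_subset_eq)
  then have "z \<in> S" using assms by simp
  then show ?thesis by (auto simp: S_def)
qed

text \<open>If the order \<open>r\<close> of an image in \<open>E\<close> divided \<open>p - 1\<close>, the image would consist of scalar matrices.\<close>

lemma irreducible_image_conj_roots:
  assumes cd: "0 < c" "0 < d" and K: "K \<in> hom_images (Qgrp c d) (GL2 p)" and irr: "\<not> reducible p K"
  shows "card K dvd gcd (c * d) (order E)" "\<not> card K dvd p - 1" "(K, emb ` roots (card K)) \<in> conj_rel (GL2 p)"
proof -
  have Q: "group (Qgrp c d)" using comm_group_Qgrp by (rule comm_group.axioms(2))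
  have sub: "subgroup K (GL2 p)" using hom_images_subgroup[OF Q group_GL2 K] .
  interpret KC: comm_group "(GL2 p)\<lparr>carrier := K\<rparr>" by (rule comm_group_hom_image[OF comm_group_Qgrp group_GL2 K])
  have comm: "A \<cdot> B = B \<cdot> A" if "A \<in> K" "B \<in> K" for A B using KC.m_comm[of A B] that by simp
  obtain K0 where K0: "K0 \<subseteq> carrier E" "(K, emb ` K0) \<in> conj_rel (GL2 p)"
    using irreducible_conj_into_E[OF sub comm irr] by blast
  have "emb ` K0 \<in> hom_images (Qgrp c d) (GL2 p)" by (rule hom_images_conj_rel[OF group_GL2 K0(2) K])
  then have K0i: "K0 \<in> hom_images (Qgrp c d) E" using hom_images_emb_iff[OF Q K0(1)] by blast
  have card: "card K0 = card K"
    using GL.card_conj_rel[OF K0(2)] card_image[OF inj_on_subset[OF emb_inj_E K0(1)]] by simp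
  note r = hom_image_E_eq_roots[OF cd K0i, unfolded card]
  show "card K dvd gcd (c * d) (order E)" by (rule r(1))
  show conj: "(K, emb ` roots (card K)) \<in> conj_rel (GL2 p)" using K0(2) r(2) by simp
  show "\<not> card K dvd p - 1"
  proof
    assume dvd: "card K dvd p - 1"
    have K'G: "emb ` roots (card K) \<subseteq> carrier (GL2 p)" using emb.hom_closed by (auto simp: roots_def)
    have "eigvec (emb z) 1 0" if z: "z \<in> roots (card K)" for z
    proof -
      have zE: "z \<in> carrier E" "z [^]\<^bsub>E\<^esub> card K = \<one>\<^bsub>E\<^esub>" using z by (auto simp: roots_def)
      then have "E.ord z dvd p - 1" using E.pow_eq_id dvd dvd_trans by blast
      then have "z \<in> roots (p - 1)" using E.pow_eq_id zE(1) by (auto simp: roots_def)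
      then have "snd z = 0" by (rule roots_scalar)
      then obtain x where x: "z = (x, 0)" by (metis prod.collapse)
      show ?thesis by (rule scalar_eigvec) (simp add: scalar_def x emb_def mat_red_smat)
    qed
    moreover have "nonzero_mod 1 0" using p_gt_1 by (simp add: nonzero_mod_def)
    ultimately have "reducible p (emb ` roots (card K))" using reducible_iff[OF K'G] by blast
    moreover have "(emb ` roots (card K), K) \<in> conj_rel (GL2 p)"
      using conj GL.equiv_conj_rel by (meson equivE symE)
    ultimately show False using reducible_conj_rel irr by blast
  qed
qed

text \<open>If this image were reducible, its elements would satisfy \<open>z\<^bsup>p - 1\<^esup> = 1\<close> besides \<open>z\<^sup>r = 1\<close>, and there
  are only \<open>gcd(r, p - 1)\<close> such elements.\<close>

lemma irreducible_image_of_order: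
  assumes cd: "0 < c" "0 < d" "\<not> p dvd c * d" and r: "r dvd gcd (c * d) (order E)" "\<not> r dvd p - 1"
  shows "emb ` roots r \<in> hom_images (Qgrp c d) (GL2 p)" "\<not> reducible p (emb ` roots r)" "card (emb ` roots r) = r"
proof -
  have Q: "group (Qgrp c d)" using comm_group_Qgrp by (rule comm_group.axioms(2))
  note R = roots_hom_image[OF cd(1,2) r(1)]
  have RE: "roots r \<subseteq> carrier E" by (auto simp: roots_def)
  show img: "emb ` roots r \<in> hom_images (Qgrp c d) (GL2 p)" using hom_images_emb_iff[OF Q RE] R(1) by blast
  show "card (emb ` roots r) = r" using card_image[OF inj_on_subset[OF emb_inj_E RE]] R(2) by simp
  show "\<not> reducible p (emb ` roots r)"
  proof
    assume red: "reducible p (emb ` roots r)"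
    have "roots r \<subseteq> roots (gcd r (p - 1))"
    proof
      fix z assume z: "z \<in> roots r"
      have zE: "z \<in> carrier E" "z [^]\<^bsub>E\<^esub> r = \<one>\<^bsub>E\<^esub>" using z by (auto simp: roots_def)
      have "emb z [^]\<^bsub>GL2 p\<^esub> (p - 1) = \<one>\<^bsub>GL2 p\<^esub>"
        using card_reducible_image_dvd(2)[OF img red cd] z by blast
      then have "emb (z [^]\<^bsub>E\<^esub> (p - 1)) = emb \<one>\<^bsub>E\<^esub>"
        using emb.hom_nat_pow[OF zE(1), of "p - 1"] emb.hom_one by simp
      then have "z [^]\<^bsub>E\<^esub> (p - 1) = \<one>\<^bsub>E\<^esub>"
        by (rule inj_onD[OF emb_inj_E _ E.nat_pow_closed[OF zE(1)] E.one_closed])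
      then have "E.ord z dvd gcd r (p - 1)" using E.pow_eq_id zE by (meson gcd_greatest)
      then show "z \<in> roots (gcd r (p - 1))" using E.pow_eq_id zE(1) by (auto simp: roots_def)
    qed
    moreover have "finite (roots (gcd r (p - 1)))" using finite_E by (simp add: roots_def)
    moreover have "card (roots (gcd r (p - 1))) = gcd r (p - 1)"
      using roots_hom_image(2)[OF cd(1,2)] r(1) by (meson dvd_trans gcd_dvd1)
    ultimately have "r \<le> gcd r (p - 1)" using card_mono R(2) by metis
    moreover have "0 < r" using r(1) cd by (auto intro: Nat.gr0I)
    ultimately have "gcd r (p - 1) = r" by (meson dvd_imp_le gcd_dvd1 le_antisym)
    then show False using r(2) by (metis gcd_dvd2)
  qed
qed

lemma card_irreducible_classes:
  assumes cd: "0 < c" "0 < d" "\<not> p dvd c * d"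
  shows "card ({K \<in> hom_images (Qgrp c d) (GL2 p). \<not> reducible p K} // conj_rel (GL2 p))
    = card {r. r dvd gcd (c * d) ((p - 1) * (p + 1)) \<and> \<not> r dvd p - 1}"
proof -
  let ?I = "{K \<in> hom_images (Qgrp c d) (GL2 p). \<not> reducible p K}"
  let ?C = "conj_rel (GL2 p)"
  have Q: "group (Qgrp c d)" using comm_group_Qgrp by (rule comm_group.axioms(2))
  have "?I // ?C = (\<lambda>K. ?C `` {K}) ` ?I" by (auto simp: quotient_def)
  also have "card \<dots> = card (card ` ?I)"
  proof (rule card_image_cong_classes)
    fix K K' assume K: "K \<in> ?I" "K' \<in> ?I"
    have sub: "subgroup K (GL2 p)" "subgroup K' (GL2 p)" using K hom_images_subgroup[OF Q group_GL2] by blast+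
    have "(K, K') \<in> ?C \<longleftrightarrow> card K = card K'"
    proof
      assume eq: "card K = card K'"
      have "(K, emb ` roots (card K)) \<in> ?C" "(K', emb ` roots (card K')) \<in> ?C"
        using irreducible_image_conj_roots(3)[OF cd(1,2)] K by blast+
      then have "(K, emb ` roots (card K)) \<in> ?C" "(K', emb ` roots (card K)) \<in> ?C" by (simp_all only: eq)
      then show "(K, K') \<in> ?C" using GL.equiv_conj_rel by (meson equivE symE transE)
    qed (use GL.card_conj_rel in simp)
    then show "?C `` {K} = ?C `` {K'} \<longleftrightarrow> card K = card K'" using GL.conj_class_eq_iff[OF sub] by simp
  qed
  also have "card ` ?I = {r. r dvd gcd (c * d) (order E) \<and> \<not> r dvd p - 1}"
  proof (intro equalityI subsetI)
    fix r assume "r \<in> {r. r dvd gcd (c * d) (order E) \<and> \<not> r dvd p - 1}"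
    then have r: "r dvd gcd (c * d) (order E)" "\<not> r dvd p - 1" by blast+
    note * = irreducible_image_of_order[OF cd r]
    show "r \<in> card ` ?I" by (rule image_eqI[of r card "emb ` roots r"]) (use * in simp_all)
  next
    fix r assume "r \<in> card ` ?I"
    then obtain K where K: "K \<in> hom_images (Qgrp c d) (GL2 p)" "\<not> reducible p K" "r = card K" by blast
    show "r \<in> {r. r dvd gcd (c * d) (order E) \<and> \<not> r dvd p - 1}"
      unfolding K(3) using irreducible_image_conj_roots(1,2)[OF cd(1,2) K(1,2)] by blast
  qed
  finally show ?thesis by (simp add: order_E)
qed

end

section \<open>Counting divisors and classes\<close>

lemma tau_mult_coprime:
  assumes "coprime a b" "0 < a" "0 < b"
  shows "tau (a * b) = tau a * tau b"
proof -
  have "bij_betw (\<lambda>(x, y). x * y) ({x. x dvd a} \<times> {y. y dvd b}) {k. k dvd a * b}"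
  proof (rule bij_betw_imageI)
    have recover: "gcd (x * y) a = x" "gcd (x * y) b = y" if "x dvd a" "y dvd b" for x y
    proof -
      have "coprime a y" using assms(1) that(2) by (meson coprime_divisors dvd_refl)
      then show "gcd (x * y) a = x" using that(1) by (simp add: gcd_mult_left_right_cancel gcd_nat.absorb1)
      have "coprime b x" using assms(1) that(1) by (meson coprime_commute coprime_divisors dvd_refl)
      then show "gcd (x * y) b = y" using that(2) by (simp add: gcd_mult_left_left_cancel gcd_nat.absorb1)
    qed
    show "inj_on (\<lambda>(x, y). x * y) ({x. x dvd a} \<times> {y. y dvd b})"
    proof (rule inj_onI)
      fix u v assume u: "u \<in> {x. x dvd a} \<times> {y. y dvd b}" "v \<in> {x. x dvd a} \<times> {y. y dvd b}"
        "(\<lambda>(x, y). x * y) u = (\<lambda>(x, y). x * y) v"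
      obtain x y x' y' where [simp]: "u = (x, y)" "v = (x', y')" by fastforce
      show "u = v" using u recover[of x y] recover[of x' y'] by simp
    qed
    show "(\<lambda>(x, y). x * y) ` ({x. x dvd a} \<times> {y. y dvd b}) = {k. k dvd a * b}"
    proof (intro equalityI subsetI)
      fix k assume "k \<in> {k. k dvd a * b}"
      then obtain x y where "k = x * y" "x dvd a" "y dvd b" using division_decomp by blast
      then show "k \<in> (\<lambda>(x, y). x * y) ` ({x. x dvd a} \<times> {y. y dvd b})" by force
    qed (auto intro: mult_dvd_mono)
  qed
  then show ?thesis by (simp add: tau_def bij_betw_same_card[symmetric] card_cartesian_product)
qed

lemma gcd_odd_mult_neighbours:
  assumes "odd (n::nat)" "0 < p"
  shows "coprime (gcd n (p - 1)) (gcd n (p + 1))"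
    and "gcd n ((p - 1) * (p + 1)) = gcd n (p - 1) * gcd n (p + 1)"
proof -
  show cop: "coprime (gcd n (p - 1)) (gcd n (p + 1))"
  proof (rule coprimeI)
    fix k assume k: "k dvd gcd n (p - 1)" "k dvd gcd n (p + 1)"
    have "k dvd p + 1" "k dvd p - 1" by (rule dvd_trans[OF k(2) gcd_dvd2], rule dvd_trans[OF k(1) gcd_dvd2])
    then have "k dvd (p + 1) - (p - 1)" by (rule dvd_diff_nat)
    moreover have "(p + 1) - (p - 1) = 2" using assms(2) by linarith
    ultimately have "k dvd 2" by simp
    moreover have "coprime n 2" using assms(1) by simp
    ultimately show "is_unit k" using k(1) by (meson coprime_common_divisor gcd_dvd1 dvd_trans)
  qed
  show "gcd n ((p - 1) * (p + 1)) = gcd n (p - 1) * gcd n (p + 1)"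
  proof (rule dvd_antisym)
    obtain x y where xy: "gcd n ((p - 1) * (p + 1)) = x * y" "x dvd p - 1" "y dvd p + 1"
      using division_decomp[of "gcd n ((p - 1) * (p + 1))" "p - 1" "p + 1"] by auto
    have "x dvd n" "y dvd n" using xy(1) by (metis dvd_trans dvd_triv_left dvd_triv_right gcd_dvd1)+
    then show "gcd n ((p - 1) * (p + 1)) dvd gcd n (p - 1) * gcd n (p + 1)"
      unfolding xy(1) using xy by (intro mult_dvd_mono gcd_greatest)
    have "gcd n (p - 1) * gcd n (p + 1) dvd n" using divides_mult[OF _ _ cop] by simp
    moreover have "gcd n (p - 1) * gcd n (p + 1) dvd (p - 1) * (p + 1)" by (intro mult_dvd_mono) simp_all
    ultimately show "gcd n (p - 1) * gcd n (p + 1) dvd gcd n ((p - 1) * (p + 1))" by simp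
  qed
qed

lemma Omega_eq: "Omega s l = tau l * tau s - tau l"
  by (simp add: Omega_def tau_def diff_mult_distrib2)

lemma card_divisors_not_dvd:
  assumes n: "odd (n::nat)" "0 < p"
  shows "card {r. r dvd gcd n ((p - 1) * (p + 1)) \<and> \<not> r dvd p - 1} = Omega (gcd n (p + 1)) (gcd n (p - 1))"
proof -
  let ?l = "gcd n (p - 1)" and ?s = "gcd n (p + 1)"
  have n0: "0 < n" using n(1) by (auto intro: Nat.gr0I)
  have pos: "0 < ?l" "0 < ?s" using n0 by simp_all
  have "{r. r dvd gcd n ((p - 1) * (p + 1)) \<and> \<not> r dvd p - 1} = {r. r dvd ?l * ?s} - {r. r dvd ?l}"
  proof -
    have "r dvd p - 1 \<longleftrightarrow> r dvd ?l" if "r dvd gcd n ((p - 1) * (p + 1))" for r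
      using dvd_trans[OF that gcd_dvd1] by (simp only: gcd_greatest_iff simp_thms)
    then show ?thesis unfolding gcd_odd_mult_neighbours(2)[OF n, symmetric] by blast
  qed
  moreover have "card ({r. r dvd ?l * ?s} - {r. r dvd ?l}) = tau (?l * ?s) - tau ?l"
    unfolding tau_def using pos by (intro card_Diff_subset) auto
  moreover have "tau (?l * ?s) = tau ?l * tau ?s"
    using tau_mult_coprime[OF gcd_odd_mult_neighbours(1)[OF n] pos] .
  ultimately show ?thesis by (simp only: Omega_eq)
qed

lemma card_image_fibres:
  assumes "finite A" "finite T" "f ` A \<subseteq> T" and cls: "\<And>x y. x \<in> A \<Longrightarrow> y \<in> A \<Longrightarrow> g x = g y \<Longrightarrow> f x = f y"
  shows "card (g ` A) = (\<Sum>t\<in>T. card (g ` {x \<in> A. f x = t}))"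
proof -
  have "g ` A = (\<Union>t\<in>T. g ` {x \<in> A. f x = t})" using assms(3) by auto
  also have "card \<dots> = (\<Sum>t\<in>T. card (g ` {x \<in> A. f x = t}))"
    by (rule card_UN_disjoint) (use assms(1,2) cls in auto)
  finally show ?thesis .
qed

context prime_modulus
begin

lemma N_red_Hgrp:
  assumes "0 < c" "0 < d" "coprime c d" "squarefree d" "t dvd l * m" "l dvd c * d" "m dvd d"
  shows "N_red p (Hgrp c d t) =
    card ({K \<in> hom_images (Qgrp c d) (GL2 p). reducible p K \<and> card K = t} // conj_rel (GL2 p))"
proof -
  have "{K. subgroup K (GL2 p) \<and> reducible p K \<and> (GL2 p)\<lparr>carrier := K\<rparr> \<cong> Hgrp c d t}
    = {K \<in> hom_images (Qgrp c d) (GL2 p). reducible p K \<and> card K = t}"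
    using iso_Hgrp_iff[OF group_GL2 _ assms]
      hom_images_subgroup[OF comm_group.axioms(2)[OF comm_group_Qgrp] group_GL2] by blast
  then show ?thesis by (simp add: N_red_def)
qed

theorem num_iso_classes_Zp2_by_Qgrp:
  assumes cd: "0 < c" "0 < d" "odd c" "odd d" "\<not> p dvd c * d" "coprime c d" "squarefree d"
    and l: "l = gcd (c * d) (p - 1)" and m: "m = gcd d (p - 1)"
  shows "num_iso_classes (split_extensions Zp2 (Qgrp c d))
    = (\<Sum>t | t dvd l * m. N_red p (Hgrp c d t)) + Omega (gcd (c * d) (p + 1)) l"
proof -
  let ?H = "hom_images (Qgrp c d) (GL2 p)" and ?C = "conj_rel (GL2 p)"
  let ?R = "{K \<in> ?H. reducible p K}" and ?I = "{K \<in> ?H. \<not> reducible p K}"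
  let ?cls = "\<lambda>K. ?C `` {K}"
  have quot: "A // ?C = ?cls ` A" for A by (auto simp: quotient_def)
  have sub: "subgroup K (GL2 p)" if "K \<in> ?H" for K
    using hom_images_subgroup[OF comm_group.axioms(2)[OF comm_group_Qgrp] group_GL2 that] .
  have cls: "(K, K') \<in> ?C" if "K \<in> ?H" "K' \<in> ?H" "?cls K = ?cls K'" for K K'
    using GL.conj_class_eq_iff[OF sub[OF that(1)] sub[OF that(2)]] that(3) by blast
  have finH: "finite ?H"
    by (rule finite_subset[of _ "Pow (carrier (GL2 p))"]) (use sub subgroup.subset finite_GL2 in auto)
  obtain D where "\<forall>r. \<not> int p dvd r * r - r + D" using ex_irreducible_quadratic by blast
  then interpret quadratic_extension p D by unfold_locales blast
  have "coprime p (c * d * d)"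
    using prime_imp_coprime[OF p cd(5)] by (simp add: coprime_mult_right_iff)
  then have "coprime (p * p) (c * d * d)" by simp
  then have "coprime (order Zp2) (order (Qgrp c d))"
    using cd by (simp only: order_Qgrp order_Zmn p_pos)
  moreover have "finite (carrier Zp2)" unfolding carrier_Zp2 by simp
  moreover have "group (AutoGroup Zp2)"
    using comm_group_Zmn comm_group.axioms(2) group.AutoGroup by blast
  ultimately have "num_iso_classes (split_extensions Zp2 (Qgrp c d)) = card (?H // ?C)"
    using num_iso_classes_split_extensions[OF comm_group_Zmn comm_group_Qgrp _
      finite_Qgrp[OF cd(1,2)] _ images_determine_homs_Qgrp[OF cd(1,2,6)] group_GL2 GL2_iso_AutoGroup]
    by blast
  also have "?H // ?C = ?cls ` ?R \<union> ?cls ` ?I" unfolding quot by blast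
  also have "card \<dots> = card (?cls ` ?R) + card (?cls ` ?I)"
  proof (rule card_Un_disjoint)
    show "?cls ` ?R \<inter> ?cls ` ?I = {}"
    proof (rule ccontr)
      assume "?cls ` ?R \<inter> ?cls ` ?I \<noteq> {}"
      then obtain K K' where K: "K \<in> ?R" "K' \<in> ?I" "?cls K = ?cls K'" by blast
      then have "(K, K') \<in> ?C" using cls by blast
      then show False using reducible_conj_rel K by blast
    qed
  qed (use finH in simp_all)
  also have "card (?cls ` ?I) = Omega (gcd (c * d) (p + 1)) l"
    using card_irreducible_classes[OF cd(1,2,5)] card_divisors_not_dvd[of "c * d" p] cd(3,4)
    unfolding quot l by simp
  also have "card (?cls ` ?R) = (\<Sum>t | t dvd l * m. card (?cls ` {K \<in> ?R. card K = t}))"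
  proof (rule card_image_fibres)
    have "0 < l * m" using cd by (simp add: l m)
    then show "finite {t. t dvd l * m}" by simp
    show "card ` ?R \<subseteq> {t. t dvd l * m}"
      using card_reducible_image_dvd(1)[OF _ _ cd(1,2,5)] by (auto simp: l m)
    show "card K = card K'" if "K \<in> ?R" "K' \<in> ?R" "?cls K = ?cls K'" for K K'
      using GL.card_conj_rel[OF cls[of K K']] that by simp
  qed (use finH in simp)
  also have "\<dots> = (\<Sum>t | t dvd l * m. N_red p (Hgrp c d t))"
  proof (rule sum.cong)
    fix t assume "t \<in> {t. t dvd l * m}"
    then have "N_red p (Hgrp c d t) = card ({K \<in> ?H. reducible p K \<and> card K = t} // ?C)"
      using N_red_Hgrp[OF cd(1,2,6,7), of t l m] by (simp add: l m)
    moreover have "{K \<in> ?H. reducible p K \<and> card K = t} = {K \<in> ?R. card K = t}" by blast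
    ultimately show "card (?cls ` {K \<in> ?R. card K = t}) = N_red p (Hgrp c d t)" by (simp only: quot)
  qed simp
  finally show ?thesis .
qed

end

theorem theorem1p3:
  fixes p c d l m s :: nat
  assumes "prime p"
    and "odd c" and "odd d" and "c > 0" and "d > 0"
    and "\<not> p dvd c * d"
    and "cubefree c" and "squarefree d" and "gcd c d = 1"
    and "l = gcd (c * d) (p - 1)"
    and "m = gcd d (p - 1)"
    and "s = gcd (c * d) (p + 1)"
  shows
    "(num_iso_classes
        (split_extensions (integer_mod_group p \<times>\<times> integer_mod_group p) (Qgrp c d))
      = (\<Sum>t | t dvd l * m. N_red p (Hgrp c d t)) + Omega s l)
     \<and>
     (\<forall>\<alpha>::nat. \<alpha> > 0 \<longrightarrow>
        num_iso_classes (split_extensions (integer_mod_group (p ^ \<alpha>)) (Qgrp c d)) = tau l)"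
proof -
  interpret prime_modulus p by unfold_locales fact
  have cop: "coprime c d" using assms(9) by (simp only: coprime_iff_gcd_eq_1)
  show ?thesis
    using num_iso_classes_Zp2_by_Qgrp[OF assms(4,5,2,3,6) cop assms(8,10,11)]
      num_iso_classes_cyclic_by_Qgrp[OF assms(1) _ assms(4,5,2,3,6) cop] assms(10,12) by simp
qed

end
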